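(* Let $\lambda$ be a partition with $|\lambda|=n$. For all $T\in\mathrm{RSSYT}_{\ge0}(\lambda)$, $$P_T=\sum_{\tau\in\mathrm{PSYT}_{\ge0}(\lambda;T)}\ \prod_{(\square_1,\square_2)\in\mathrm{Inv}(\tau)}\left(\frac{q^{T(\square_1)}t^{c(\square_1)+1}-q^{T(\square_2)}t^{c(\square_2)}}{q^{T(\square_1)}t^{c(\square_1)}-q^{T(\square_2)}t^{c(\square_2)}}\right)F_\tau .$$
   Context: **Tableaux.** Partitions are identified with Young diagrams in English notation. The box in column $a$ and row $b$ has content $c(\square)=a-b$. Let $|\lambda|=n$. $\mathrm{RYT}_{\ge0}(\lambda)$ is the set of labellings $T:\lambda\to\mathbb{Z}_{\ge0}$ weakly decreasing along rows and columns; $\mathrm{RSSYT}_{\ge0}(\lambda)$ is the subset of those strictly decreasing along columns; $\mathrm{SYT}(\lambda)$ is the set of standard Young tableaux. $\mathrm{PSYT}_{\ge0}(\lambda)$ is the set of labellings $\tau:\lambda\to\{jq^b:1\le j\le n,\,b\ge0\}$ in which each $j\in\{1,\dots,n\}$ occurs in exactly one box and which are strictly increasing along rows and columns, where $jq^m<kq^\ell$ iff $m>\ell$, or $m=\ell$ and $j<k$; $\mathrm{SYT}(\lambda)\subset\mathrm{PSYT}_{\ge0}(\lambda)$ (taking $b=0$). If $\tau(\square)=iq^b$ write $c_\tau(i)=c(\square)$, $w_\tau(i)=b$. $s_j(\tau)$ is obtained by exchanging the indices $j,j+1$ (keeping the power of $q$ in each box), defined when the result lies in $\mathrm{PSYT}_{\ge0}(\lambda)$.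 $\Psi(\tau)$ replaces each label $kq^a$ by $(k-1)q^a$ if $k\ge2$, and by $nq^{a+1}$ if $k=1$. The partial order on $\mathrm{PSYT}_{\ge0}(\lambda)$ is generated by: $\Psi(\tau)>\tau$; $s_i(\tau)>\tau$ if $w_\tau(i)<w_\tau(i+1)$; $s_i(\tau)>\tau$ if $w_\tau(i)=w_\tau(i+1)$ and $c_\tau(i)-c_\tau(i+1)>1$. $\mathfrak{p}_\lambda(\tau)\in\mathrm{RYT}_{\ge0}(\lambda)$ records the powers of $q$; $\mathrm{PSYT}_{\ge0}(\lambda;T)=\mathfrak{p}_\lambda^{-1}(T)$, with unique maximum $\mathrm{Top}(T)$. $S(T)\in\mathrm{SYT}(\lambda)$ numbers the boxes in the order: $\square_1$ before $\square_2$ iff $T(\square_1)>T(\square_2)$, or $T(\square_1)=T(\square_2)$ and $\square_1$ precedes $\square_2$ in the column-standard labelling (columns left to right, each top to bottom). For $\tau\in\mathrm{PSYT}_{\ge0}(\lambda;T)$, $\mathrm{Inv}(\tau)$ is the set of ordered pairs of boxes $(\square_1,\square_2)$ with $S(T)(\square_1)<S(T)(\square_2)$ and $i>j$, where $\tau(\square_1)=iq^a$, $\tau(\square_2)=jq^b$. **Algebras** (over $\mathbb{Q}(q,t)$). $\mathcal{H}_n$: generators $T_1,\dots,T_{n-1}$, relations $(T_i-1)(T_i+t)=0$, $T_iT_{i+1}T_i=T_{i+1}T_iT_{i+1}$, $T_iT_j=T_jT_i$ for $|i-j|>1$. Put $\overline\theta_1=1$, $\overline\theta_{i+1}=tT_i^{-1}\overline\theta_iT_i^{-1}$,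 $\overline\varphi_i=(tT_i^{-1})\overline\theta_i-\overline\theta_i(tT_i^{-1})$. $\lambda$ also denotes the $\mathcal{H}_n$-module with basis $\mathrm{SYT}(\lambda)$ determined by: $\overline\theta_i(\tau)=t^{c_\tau(i)}\tau$; $\overline\varphi_i(\tau)=(t^{c_\tau(i)}-t^{c_\tau(i+1)})s_i(\tau)$ if $s_i(\tau)>\tau$; $T_i\tau=\tau$ if $i,i+1$ are in the same row; $T_i\tau=-t\tau$ if in the same column. $\mathcal{A}_n$: generators $T_i$ (generating $\mathcal{H}_n$), $\theta_1,\dots,\theta_n$, with $\theta_i\theta_j=\theta_j\theta_i$, $\theta_{i+1}=tT_i^{-1}\theta_iT_i^{-1}$, $T_i\theta_j=\theta_jT_i$ for $j\notin\{i,i+1\}$; $\pi_n:=t^{n-1}\theta_1T_1^{-1}\cdots T_{n-1}^{-1}$; $\rho_n:\mathcal{A}_n\to\mathcal{H}_n$, $T_i\mapsto T_i$, $\theta_i\mapsto\overline\theta_i$. $\mathcal{D}_n$: generators $T_i,\theta_i$ (generating $\mathcal{A}_n$), $X_1,\dots,X_n$, with $X_iX_j=X_jX_i$, $X_{i+1}=tT_i^{-1}X_iT_i^{-1}$, $T_iX_j=X_jT_i$ for $j\notin\{i,i+1\}$, $\pi_nX_i=X_{i+1}\pi_n$ for $i\le n-1$, $\pi_nX_n=qX_1\pi_n$. $\epsilon^{(n)}=\frac1{[n]_t!}\sum_{\sigma\in\mathfrak{S}_n}t^{\binom n2-\ell(\sigma)}T_\sigma$, $[n]_t!=\prod_{i=1}^n\frac{1-t^i}{1-t}$.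 **Modules.** $V_\lambda=\mathcal{D}_n\otimes_{\mathcal{A}_n}\rho_n^*(\lambda)$, with basis $X^\alpha\otimes\tau$ ($\alpha\in\mathbb{Z}_{\ge0}^n$, $\tau\in\mathrm{SYT}(\lambda)$); $\pi_n$ acts invertibly. $V_\lambda$ has a basis $\{F_\tau:\tau\in\mathrm{PSYT}_{\ge0}(\lambda)\}$ determined by: $\theta_iF_\tau=q^{w_\tau(i)}t^{c_\tau(i)}F_\tau$; $F_\tau=1\otimes\tau$ for $\tau\in\mathrm{SYT}(\lambda)$; $\big(tT_i^{-1}+\frac{(t-1)q^{w_\tau(i+1)}t^{c_\tau(i+1)}}{q^{w_\tau(i)}t^{c_\tau(i)}-q^{w_\tau(i+1)}t^{c_\tau(i+1)}}\big)F_\tau=F_{s_i(\tau)}$ if $s_i(\tau)>\tau$; $F_{\Psi(\tau)}=q^{w_\tau(1)}X_n\pi_n^{-1}F_\tau$. $U_T=\mathrm{span}\{F_\tau:\mathfrak{p}_\lambda(\tau)=T\}$ is an $\mathcal{A}_n$-submodule. For $T\in\mathrm{RSSYT}_{\ge0}(\lambda)$, $P_T$ is the unique element of $\epsilon^{(n)}(U_T)$ of the form $F_{\mathrm{Top}(T)}+\sum_{y\in\mathrm{PSYT}_{\ge0}(\lambda;T)\setminus\{\mathrm{Top}(T)\}}\kappa_yF_y$ with $\kappa_y\in\mathbb{Q}(q,t)$. *)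

theory Defs
  imports
    "HOL-Algebra.QuotRing"
    "HOL-Algebra.Module"
    "HOL-Algebra.Free_Abelian_Groups"
    "HOL-Computational_Algebra.Polynomial"
    "HOL-Computational_Algebra.Fraction_Field"
    "HOL-Combinatorics.Permutations"
begin

section \<open>Tableaux\<close>

definition is_partition :: "nat list \<Rightarrow> bool" where
  "is_partition lam \<longleftrightarrow> sorted_wrt (\<ge>) lam \<and> 0 \<notin> set lam"

text \<open>A box is a pair (column, row). Columns and rows are counted from 0, which leaves
  contents unchanged; indices \<open>j\<close> of labels \<open>j q^b\<close> are counted from 1.\<close>

type_synonym box = "nat \<times> nat"

definition diagram :: "nat list \<Rightarrow> box set" where
  "diagram lam = {(a, b). b < length lam \<and> a < lam ! b}"

fun box_content :: "box \<Rightarrow> int" where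
  "box_content (a, b) = int a - int b"

text \<open>Labellings are extensional functions on the diagram, so that equality of labellings
  is equality of functions.\<close>

definition RYT :: "nat list \<Rightarrow> (box \<Rightarrow> nat) set" where
  "RYT lam = {T \<in> diagram lam \<rightarrow>\<^sub>E UNIV.
     (\<forall>a a' b. (a, b) \<in> diagram lam \<and> (a', b) \<in> diagram lam \<and> a < a' \<longrightarrow> T (a, b) \<ge> T (a', b)) \<and>
     (\<forall>a b b'. (a, b) \<in> diagram lam \<and> (a, b') \<in> diagram lam \<and> b < b' \<longrightarrow> T (a, b) \<ge> T (a, b'))}"

definition RSSYT :: "nat list \<Rightarrow> (box \<Rightarrow> nat) set" where
  "RSSYT lam = {T \<in> RYT lam.
     \<forall>a b b'. (a, b) \<in> diagram lam \<and> (a, b') \<in> diagram lam \<and> b < b' \<longrightarrow> T (a, b) > T (a, b')}"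

text \<open>The label \<open>j q^b\<close> is represented by the pair \<open>(j, b)\<close>.\<close>

type_synonym label = "nat \<times> nat"
type_synonym tableau = "box \<Rightarrow> label"

fun label_less :: "label \<Rightarrow> label \<Rightarrow> bool" where
  "label_less (j, m) (k, l) \<longleftrightarrow> m > l \<or> (m = l \<and> j < k)"

definition PSYT :: "nat list \<Rightarrow> tableau set" where
  "PSYT lam = {\<tau> \<in> diagram lam \<rightarrow>\<^sub>E ({1..sum_list lam} \<times> UNIV).
     (\<forall>j\<in>{1..sum_list lam}. \<exists>!x. x \<in> diagram lam \<and> fst (\<tau> x) = j) \<and>
     (\<forall>a a' b. (a, b) \<in> diagram lam \<and> (a', b) \<in> diagram lam \<and> a < a'
        \<longrightarrow> label_less (\<tau> (a, b)) (\<tau> (a', b))) \<and>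
     (\<forall>a b b'. (a, b) \<in> diagram lam \<and> (a, b') \<in> diagram lam \<and> b < b'
        \<longrightarrow> label_less (\<tau> (a, b)) (\<tau> (a, b')))}"

text \<open>Standard Young tableaux, as the elements of \<^const>\<open>PSYT\<close> all of whose powers of \<open>q\<close> are 0.\<close>

definition SYT :: "nat list \<Rightarrow> tableau set" where
  "SYT lam = {\<tau> \<in> PSYT lam. \<forall>x\<in>diagram lam. snd (\<tau> x) = 0}"

definition box_of :: "nat list \<Rightarrow> tableau \<Rightarrow> nat \<Rightarrow> box" where
  "box_of lam \<tau> i = (THE x. x \<in> diagram lam \<and> fst (\<tau> x) = i)"

definition cont :: "nat list \<Rightarrow> tableau \<Rightarrow> nat \<Rightarrow> int" where
  "cont lam \<tau> i = box_content (box_of lam \<tau> i)"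

definition wt :: "nat list \<Rightarrow> tableau \<Rightarrow> nat \<Rightarrow> nat" where
  "wt lam \<tau> i = snd (\<tau> (box_of lam \<tau> i))"

text \<open>\<open>s_act lam j \<tau>\<close> is always some labelling; \<open>s\<^sub>j(\<tau>)\<close> is defined when it lies in
  \<open>PSYT lam\<close>.\<close>

definition s_act :: "nat list \<Rightarrow> nat \<Rightarrow> tableau \<Rightarrow> tableau" where
  "s_act lam j \<tau> = (\<lambda>x\<in>diagram lam. (transpose j (Suc j) (fst (\<tau> x)), snd (\<tau> x)))"

definition Psi :: "nat list \<Rightarrow> tableau \<Rightarrow> tableau" where
  "Psi lam \<tau> = (\<lambda>x\<in>diagram lam.
     (case \<tau> x of (k, a) \<Rightarrow> if k \<ge> 2 then (k - 1, a) else (sum_list lam, a + 1)))"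

text \<open>A pair \<open>(\<tau>, \<tau>')\<close> in \<open>psyt_gen\<close> is a generating relation \<open>\<tau> < \<tau>'\<close>.\<close>

definition psyt_gen :: "nat list \<Rightarrow> (tableau \<times> tableau) set" where
  "psyt_gen lam =
     {(\<tau>, Psi lam \<tau>) | \<tau>. \<tau> \<in> PSYT lam \<and> sum_list lam \<ge> 1}
     \<union> {(\<tau>, s_act lam i \<tau>) | \<tau> i. \<tau> \<in> PSYT lam \<and> i \<in> {1..<sum_list lam} \<and> s_act lam i \<tau> \<in> PSYT lam
          \<and> wt lam \<tau> i < wt lam \<tau> (i + 1)}
     \<union> {(\<tau>, s_act lam i \<tau>) | \<tau> i. \<tau> \<in> PSYT lam \<and> i \<in> {1..<sum_list lam} \<and> s_act lam i \<tau> \<in> PSYT lam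
          \<and> wt lam \<tau> i = wt lam \<tau> (i + 1) \<and> cont lam \<tau> i - cont lam \<tau> (i + 1) > 1}"

definition psyt_less :: "nat list \<Rightarrow> tableau \<Rightarrow> tableau \<Rightarrow> bool" where
  "psyt_less lam \<tau> \<tau>' \<longleftrightarrow> (\<tau>, \<tau>') \<in> (psyt_gen lam)\<^sup>+"

definition p_map :: "nat list \<Rightarrow> tableau \<Rightarrow> (box \<Rightarrow> nat)" where
  "p_map lam \<tau> = (\<lambda>x\<in>diagram lam. snd (\<tau> x))"

definition PSYT_over :: "nat list \<Rightarrow> (box \<Rightarrow> nat) \<Rightarrow> tableau set" where
  "PSYT_over lam T = {\<tau> \<in> PSYT lam. p_map lam \<tau> = T}"

definition Top :: "nat list \<Rightarrow> (box \<Rightarrow> nat) \<Rightarrow> tableau" where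
  "Top lam T = (THE \<tau>. \<tau> \<in> PSYT_over lam T \<and>
     (\<forall>\<tau>'\<in>PSYT_over lam T. \<tau>' = \<tau> \<or> psyt_less lam \<tau>' \<tau>))"

fun box_before :: "(box \<Rightarrow> nat) \<Rightarrow> box \<Rightarrow> box \<Rightarrow> bool" where
  "box_before T (a, b) (a', b') \<longleftrightarrow>
     T (a, b) > T (a', b') \<or>
     (T (a, b) = T (a', b') \<and> (a < a' \<or> (a = a' \<and> b < b')))"

definition S_tab :: "nat list \<Rightarrow> (box \<Rightarrow> nat) \<Rightarrow> tableau" where
  "S_tab lam T = (\<lambda>x\<in>diagram lam. (card {y \<in> diagram lam. box_before T y x} + 1, 0))"

definition Inv :: "nat list \<Rightarrow> tableau \<Rightarrow> (box \<times> box) set" where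
  "Inv lam \<tau> = {(x, y). x \<in> diagram lam \<and> y \<in> diagram lam \<and>
     fst (S_tab lam (p_map lam \<tau>) x) < fst (S_tab lam (p_map lam \<tau>) y) \<and>
     fst (\<tau> x) > fst (\<tau> y)}"

section \<open>The ground field\<close>

text \<open>The field \<open>\<rat>(q,t)\<close>, as the fraction field of \<open>\<rat>[q][t]\<close>.\<close>

type_synonym ratqt = "rat poly poly fract"

definition qq :: ratqt where "qq = Fract [:[:0, 1:]:] 1"
definition tt :: ratqt where "tt = Fract [:0, 1:] 1"

lemma tt_nonzero: "tt \<noteq> 0"
  unfolding tt_def by (simp add: Zero_fract_def eq_fract)

section \<open>Algebras given by generators and relations\<close>

text \<open>The free monoid on a type, written additively because the product of
  \<^typ>\<open>'a \<Rightarrow>\<^sub>0 'b\<close> is the convolution product for an additively written monoid \<^typ>\<open>'a\<close>.\<close>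

datatype 'g fword = FWord (letters: "'g list")

instantiation fword :: (type) monoid_add
begin

definition zero_fword :: "'g fword" where "zero_fword = FWord []"
definition plus_fword :: "'g fword \<Rightarrow> 'g fword \<Rightarrow> 'g fword" where
  "plus_fword u v = FWord (letters u @ letters v)"

instance
  by standard (simp_all add: zero_fword_def plus_fword_def)

end

type_synonym 'g falg = "'g fword \<Rightarrow>\<^sub>0 ratqt"

definition gen :: "'g \<Rightarrow> 'g falg" where
  "gen g = Poly_Mapping.single (FWord [g]) 1"

definition scalar :: "ratqt \<Rightarrow> 'g falg" where
  "scalar c = Poly_Mapping.single 0 c"

definition free_alg :: "'g set \<Rightarrow> 'g falg ring" where
  "free_alg G = \<lparr>carrier = {f. \<forall>w\<in>Poly_Mapping.keys f. set (letters w) \<subseteq> G},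
     monoid.mult = (*), monoid.one = 1, ring.zero = 0, ring.add = (+)\<rparr>"

text \<open>A presentation consists of a set of generators and a set of relators.\<close>

type_synonym 'g presentation = "'g set \<times> 'g falg set"

definition rel_ideal :: "'g presentation \<Rightarrow> 'g falg set" where
  "rel_ideal P = genideal (free_alg (fst P)) (snd P)"

definition alg :: "'g presentation \<Rightarrow> 'g falg set ring" where
  "alg P = free_alg (fst P) Quot rel_ideal P"

definition cls :: "'g presentation \<Rightarrow> 'g falg \<Rightarrow> 'g falg set" where
  "cls P f = rel_ideal P +>\<^bsub>free_alg (fst P)\<^esub> f"

text \<open>The algebra map from \<open>P\<close> to \<open>Q\<close> that sends each generator \<open>g\<close> to the class of \<open>f g\<close>, given by
  substitution in a representative. It is a well-defined homomorphism when \<^term>\<open>gen_subst f\<close> sends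
  the relators of \<open>P\<close> into the relation ideal of \<open>Q\<close>.\<close>

definition gen_subst :: "('g \<Rightarrow> 'g falg) \<Rightarrow> 'g falg \<Rightarrow> 'g falg" where
  "gen_subst f p = (\<Sum>w\<in>Poly_Mapping.keys p.
     scalar (Poly_Mapping.lookup p w) * prod_list (map f (letters w)))"

definition alg_map :: "'g presentation \<Rightarrow> ('g \<Rightarrow> 'g falg) \<Rightarrow> 'g falg set \<Rightarrow> 'g falg set" where
  "alg_map Q f C = cls Q (gen_subst f (SOME p. p \<in> C))"

lemma free_alg_simps:
  "carrier (free_alg G) = {f. \<forall>w\<in>Poly_Mapping.keys f. set (letters w) \<subseteq> G}"
  "monoid.mult (free_alg G) = (*)" "monoid.one (free_alg G) = 1"
  "ring.zero (free_alg G) = 0" "ring.add (free_alg G) = (+)"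
  by (simp_all add: free_alg_def)

lemma ring_free_alg: "ring (free_alg G)"
proof (rule ringI)
  have keys: "x \<in> carrier (free_alg G) \<longleftrightarrow> Poly_Mapping.keys x \<subseteq> {w. set (letters w) \<subseteq> G}" for x
    by (auto simp: free_alg_simps(1))
  have m: "x * y \<in> carrier (free_alg G)"
    if "x \<in> carrier (free_alg G)" "y \<in> carrier (free_alg G)" for x y :: "'a falg"
  proof -
    have "set (letters w) \<subseteq> G" if w: "w \<in> Poly_Mapping.keys (x * y)" for w
    proof -
      obtain u v where "u \<in> Poly_Mapping.keys x" "v \<in> Poly_Mapping.keys y" "w = u + v"
        using keys_mult[of x y] w by blast
      with \<open>x \<in> _\<close> \<open>y \<in> _\<close> show ?thesis
        unfolding free_alg_simps(1) plus_fword_def by simp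
    qed
    then show ?thesis by (simp add: free_alg_simps(1))
  qed
  have a: "x + y \<in> carrier (free_alg G)"
    if "x \<in> carrier (free_alg G)" "y \<in> carrier (free_alg G)" for x y :: "'a falg"
    using that Poly_Mapping.keys_add[of x y] unfolding keys by blast
  have n: "- x \<in> carrier (free_alg G)" if "x \<in> carrier (free_alg G)" for x :: "'a falg"
    using that by (simp add: keys)
  have z: "0 \<in> carrier (free_alg G)" by (simp add: keys)
  have o: "1 \<in> carrier (free_alg G)"
    unfolding keys single_one[symmetric] by (simp add: zero_fword_def)
  show "abelian_group (free_alg G)"
    by (rule abelian_groupI; unfold free_alg_simps(4,5);
        (rule a z add.assoc add.commute add_0 | assumption | (rule bexI[OF _ n], simp))+)
  show "monoid (free_alg G)"
    by (rule monoidI; unfold free_alg_simps(2,3);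
        (rule m o mult.assoc mult_1 mult_1_right | assumption)+)
qed (simp_all only: free_alg_simps(2,5) ring_distribs)

lemma ring_alg:
  assumes "snd P \<subseteq> carrier (free_alg (fst P))"
  shows "ring (alg P)"
proof -
  interpret ring "free_alg (fst P)" by (rule ring_free_alg)
  show ?thesis unfolding alg_def rel_ideal_def
    by (rule ideal.quotient_is_ring[OF genideal_ideal[OF assms]])
qed

lemma free_alg_closed:
  "0 \<in> carrier (free_alg G)" "1 \<in> carrier (free_alg G)" "scalar c \<in> carrier (free_alg G)"
  "g \<in> G \<Longrightarrow> gen g \<in> carrier (free_alg G)"
  "\<lbrakk>x \<in> carrier (free_alg G); y \<in> carrier (free_alg G)\<rbrakk> \<Longrightarrow> x + y \<in> carrier (free_alg G)"
  "\<lbrakk>x \<in> carrier (free_alg G); y \<in> carrier (free_alg G)\<rbrakk> \<Longrightarrow> x - y \<in> carrier (free_alg G)"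
  "\<lbrakk>x \<in> carrier (free_alg G); y \<in> carrier (free_alg G)\<rbrakk> \<Longrightarrow> x * y \<in> carrier (free_alg G)"
  "(\<And>x. x \<in> set xs \<Longrightarrow> x \<in> carrier (free_alg G)) \<Longrightarrow> prod_list xs \<in> carrier (free_alg G)"
  "(\<And>i. i \<in> I \<Longrightarrow> h i \<in> carrier (free_alg G)) \<Longrightarrow> sum h I \<in> carrier (free_alg G)"
proof -
  interpret ring "free_alg G" by (rule ring_free_alg)
  show z: "0 \<in> carrier (free_alg G)" using zero_closed by (simp add: free_alg_simps)
  show o: "1 \<in> carrier (free_alg G)" using one_closed by (simp only: free_alg_simps)
  show "scalar c \<in> carrier (free_alg G)"
    by (auto simp: free_alg_simps scalar_def zero_fword_def)
  show "g \<in> G \<Longrightarrow> gen g \<in> carrier (free_alg G)"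
    by (auto simp: free_alg_simps gen_def)
  show a: "x + y \<in> carrier (free_alg G)"
    if "x \<in> carrier (free_alg G)" "y \<in> carrier (free_alg G)" for x y
    using a_closed[OF that] by (simp only: free_alg_simps)
  show "x - y \<in> carrier (free_alg G)"
    if "x \<in> carrier (free_alg G)" "y \<in> carrier (free_alg G)" for x y
    using that keys_diff[of x y] by (auto simp: free_alg_simps)
  show m: "x * y \<in> carrier (free_alg G)"
    if "x \<in> carrier (free_alg G)" "y \<in> carrier (free_alg G)" for x y
    using m_closed[OF that] by (simp only: free_alg_simps)
  show "(\<And>x. x \<in> set xs \<Longrightarrow> x \<in> carrier (free_alg G)) \<Longrightarrow> prod_list xs \<in> carrier (free_alg G)"
    by (induction xs) (use o m in auto)
  show "(\<And>i. i \<in> I \<Longrightarrow> h i \<in> carrier (free_alg G)) \<Longrightarrow> sum h I \<in> carrier (free_alg G)"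
    by (induction I rule: infinite_finite_induct) (use z a in auto)
qed

lemma cls_closed:
  assumes "snd P \<subseteq> carrier (free_alg (fst P))" "f \<in> carrier (free_alg (fst P))"
  shows "cls P f \<in> carrier (alg P)"
proof -
  interpret ring "free_alg (fst P)" by (rule ring_free_alg)
  interpret ideal "rel_ideal P" "free_alg (fst P)"
    unfolding rel_ideal_def by (rule genideal_ideal[OF assms(1)])
  show ?thesis using assms(2)
    unfolding cls_def alg_def FactRing_def by (simp add: a_rcosetsI a_subset)
qed

lemma alg_map_closed:
  assumes P: "snd P \<subseteq> carrier (free_alg (fst P))" and Q: "snd Q \<subseteq> carrier (free_alg (fst Q))"
    and f: "\<And>g. g \<in> fst P \<Longrightarrow> f g \<in> carrier (free_alg (fst Q))" and C: "C \<in> carrier (alg P)"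
  shows "alg_map Q f C \<in> carrier (alg Q)"
proof -
  interpret ring "free_alg (fst P)" by (rule ring_free_alg)
  interpret ideal "rel_ideal P" "free_alg (fst P)"
    unfolding rel_ideal_def by (rule genideal_ideal[OF P])
  obtain p where p: "p \<in> carrier (free_alg (fst P))" "C = rel_ideal P +>\<^bsub>free_alg (fst P)\<^esub> p"
    using C unfolding alg_def FactRing_def A_RCOSETS_def' by auto
  have "p \<in> C" using p a_rcos_self by blast
  then have "(SOME p. p \<in> C) \<in> C" by (rule someI)
  moreover have "C \<subseteq> carrier (free_alg (fst P))" using p a_r_coset_subset_G a_subset by blast
  ultimately have "(SOME p. p \<in> C) \<in> carrier (free_alg (fst P))" by blast
  then have w: "set (letters w) \<subseteq> fst P" if "w \<in> Poly_Mapping.keys (SOME p. p \<in> C)" for w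
    using that by (simp add: free_alg_simps(1))
  have "gen_subst f (SOME p. p \<in> C) \<in> carrier (free_alg (fst Q))"
    unfolding gen_subst_def
  proof (rule free_alg_closed(9), rule free_alg_closed(7), rule free_alg_closed(3), rule free_alg_closed(8))
    fix w x assume "w \<in> Poly_Mapping.keys (SOME p. p \<in> C)" and x: "x \<in> set (map f (letters w))"
    from this(1) have "set (letters w) \<subseteq> fst P" by (rule w)
    then show "x \<in> carrier (free_alg (fst Q))" using x f by auto
  qed
  then show ?thesis unfolding alg_map_def by (rule cls_closed[OF Q])
qed

lemma rel_imp_cls_zero:
  assumes "snd P \<subseteq> carrier (free_alg (fst P))" "r \<in> snd P"
  shows "cls P r = \<zero>\<^bsub>alg P\<^esub>"
proof -
  interpret ring "free_alg (fst P)" by (rule ring_free_alg)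
  interpret ideal "rel_ideal P" "free_alg (fst P)"
    unfolding rel_ideal_def by (rule genideal_ideal[OF assms(1)])
  have "r \<in> rel_ideal P" unfolding rel_ideal_def using genideal_self[OF assms(1)] assms(2) by blast
  then show ?thesis unfolding cls_def alg_def FactRing_def by (simp add: a_rcos_const)
qed

section \<open>Left modules\<close>

text \<open>The library's \<open>module\<close> is restricted to commutative rings. The fields \<open>mult\<close> and \<open>one\<close> of the
  record type of \<open>M\<close> play no role.\<close>

locale left_module = R?: ring R + M?: abelian_group M
  for R (structure) and M (structure) +
  assumes smult_closed: "\<lbrakk>a \<in> carrier R; x \<in> carrier M\<rbrakk> \<Longrightarrow> a \<odot>\<^bsub>M\<^esub> x \<in> carrier M"
    and smult_l_distr: "\<lbrakk>a \<in> carrier R; b \<in> carrier R; x \<in> carrier M\<rbrakk> \<Longrightarrow>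
      (a \<oplus> b) \<odot>\<^bsub>M\<^esub> x = a \<odot>\<^bsub>M\<^esub> x \<oplus>\<^bsub>M\<^esub> b \<odot>\<^bsub>M\<^esub> x"
    and smult_r_distr: "\<lbrakk>a \<in> carrier R; x \<in> carrier M; y \<in> carrier M\<rbrakk> \<Longrightarrow>
      a \<odot>\<^bsub>M\<^esub> (x \<oplus>\<^bsub>M\<^esub> y) = a \<odot>\<^bsub>M\<^esub> x \<oplus>\<^bsub>M\<^esub> a \<odot>\<^bsub>M\<^esub> y"
    and smult_assoc: "\<lbrakk>a \<in> carrier R; b \<in> carrier R; x \<in> carrier M\<rbrakk> \<Longrightarrow>
      (a \<otimes> b) \<odot>\<^bsub>M\<^esub> x = a \<odot>\<^bsub>M\<^esub> (b \<odot>\<^bsub>M\<^esub> x)"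
    and smult_one: "x \<in> carrier M \<Longrightarrow> \<one> \<odot>\<^bsub>M\<^esub> x = x"

definition restrict_scalars :: "('r \<Rightarrow> 'r) \<Rightarrow> ('r, 'm) module \<Rightarrow> ('r, 'm) module" where
  "restrict_scalars h M = M\<lparr>module.smult := (\<lambda>a x. h a \<odot>\<^bsub>M\<^esub> x)\<rparr>"

text \<open>The tensor product \<open>D \<otimes>\<^sub>A M\<close> for a ring homomorphism \<open>h : A \<rightarrow> D\<close> (through which \<open>D\<close> is a
  right \<open>A\<close>-module) and a left \<open>A\<close>-module \<open>M\<close>: the free abelian group on the pairs \<open>(d, m)\<close> modulo
  the usual relations, with \<open>D\<close> acting on the left factor.\<close>

definition tensor_rel :: "'r ring \<Rightarrow> 'r ring \<Rightarrow> ('r \<Rightarrow> 'r) \<Rightarrow> ('r, 'm) module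
    \<Rightarrow> ('r \<times> 'm \<Rightarrow>\<^sub>0 int) set" where
  "tensor_rel A D h M =
     {frag_of (d \<oplus>\<^bsub>D\<^esub> d', m) - frag_of (d, m) - frag_of (d', m) | d d' m.
        d \<in> carrier D \<and> d' \<in> carrier D \<and> m \<in> carrier M}
     \<union> {frag_of (d, m \<oplus>\<^bsub>M\<^esub> m') - frag_of (d, m) - frag_of (d, m') | d m m'.
        d \<in> carrier D \<and> m \<in> carrier M \<and> m' \<in> carrier M}
     \<union> {frag_of (d \<otimes>\<^bsub>D\<^esub> h a, m) - frag_of (d, a \<odot>\<^bsub>M\<^esub> m) | d a m.
        d \<in> carrier D \<and> a \<in> carrier A \<and> m \<in> carrier M}"

definition tensor_free :: "'r ring \<Rightarrow> ('r, 'm) module \<Rightarrow> ('r \<times> 'm \<Rightarrow>\<^sub>0 int) monoid" where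
  "tensor_free D M = free_Abelian_group (carrier D \<times> carrier M)"

definition tensor_ker :: "'r ring \<Rightarrow> 'r ring \<Rightarrow> ('r \<Rightarrow> 'r) \<Rightarrow> ('r, 'm) module
    \<Rightarrow> ('r \<times> 'm \<Rightarrow>\<^sub>0 int) set" where
  "tensor_ker A D h M = generate (tensor_free D M) (tensor_rel A D h M)"

definition tensor :: "'r ring \<Rightarrow> 'r ring \<Rightarrow> ('r \<Rightarrow> 'r) \<Rightarrow> ('r, 'm) module
    \<Rightarrow> ('r, ('r \<times> 'm \<Rightarrow>\<^sub>0 int) set) module" where
  "tensor A D h M = (let E = tensor_free D M; N = tensor_ker A D h M in
     \<lparr>carrier = carrier (E Mod N),
      monoid.mult = undefined, monoid.one = undefined,
      ring.zero = monoid.one (E Mod N), ring.add = monoid.mult (E Mod N),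
      module.smult = (\<lambda>d C. \<Union>x\<in>C. N #>\<^bsub>E\<^esub> frag_extend (\<lambda>(d', m). frag_of (d \<otimes>\<^bsub>D\<^esub> d', m)) x)\<rparr>)"

definition pure_tensor :: "'r ring \<Rightarrow> 'r ring \<Rightarrow> ('r \<Rightarrow> 'r) \<Rightarrow> ('r, 'm) module
    \<Rightarrow> 'r \<Rightarrow> 'm \<Rightarrow> ('r \<times> 'm \<Rightarrow>\<^sub>0 int) set" where
  "pure_tensor A D h M d m = tensor_ker A D h M #>\<^bsub>tensor_free D M\<^esub> frag_of (d, m)"

lemma left_module_tensor:
  assumes "ring D" "abelian_group M" "h ` carrier A \<subseteq> carrier D"
    and clo: "\<And>a m. a \<in> carrier A \<Longrightarrow> m \<in> carrier M \<Longrightarrow> a \<odot>\<^bsub>M\<^esub> m \<in> carrier M"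
  shows "left_module D (tensor A D h M)"
proof -
  interpret D: ring D by fact
  interpret M: abelian_group M by fact
  define E where "E = tensor_free D M"
  define N where "N = tensor_ker A D h M"
  let ?f = "\<lambda>d. frag_extend (\<lambda>(d', m). frag_of (d \<otimes>\<^bsub>D\<^esub> d', m))"
  have Esimps: "carrier E = {c. Poly_Mapping.keys c \<subseteq> carrier D \<times> carrier M}"
    "monoid.mult E = (+)" "one E = 0"
    by (auto simp: E_def tensor_free_def free_Abelian_group_def)
  interpret E: comm_group E
    unfolding E_def tensor_free_def by (rule abelian_free_Abelian_group)
  have invE: "inv\<^bsub>E\<^esub> x = - x" if "x \<in> carrier E" for x
    using that unfolding E_def tensor_free_def by (simp add: inv_free_Abelian_group)
  have fr: "frag_of (d, m) \<in> carrier E" if "d \<in> carrier D" "m \<in> carrier M" for d m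
    using that by (simp add: Esimps)
  have sub: "x - y \<in> carrier E" if "x \<in> carrier E" "y \<in> carrier E" for x y
    using that keys_diff[of x y] by (auto simp: Esimps)
  have relE: "tensor_rel A D h M \<subseteq> carrier E"
    unfolding tensor_rel_def using assms(3) clo
    by (intro Un_least subsetI; elim CollectE exE conjE; hypsubst)
       (intro sub fr; auto)+
  have sgN: "subgroup N E"
    unfolding N_def tensor_ker_def E_def[symmetric] by (rule E.generate_is_subgroup[OF relE])
  then interpret N: normal N E
    using E.subgroup_imp_normal by blast
  interpret Q: comm_group "E Mod N" by (rule E.abelian_FactGroup[OF sgN])
  have fE: "?f d x \<in> carrier E" if "d \<in> carrier D" "x \<in> carrier E" for d x
  proof -
    have "Poly_Mapping.keys ((\<lambda>(d', m). frag_of (d \<otimes>\<^bsub>D\<^esub> d', m)) p) \<subseteq> carrier D \<times> carrier M"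
      if "p \<in> Poly_Mapping.keys x" for p
    proof -
      have "p \<in> carrier D \<times> carrier M" using that \<open>x \<in> carrier E\<close> by (auto simp: Esimps(1))
      then show ?thesis using \<open>d \<in> carrier D\<close> by (cases p) simp
    qed
    then have "Poly_Mapping.keys (?f d x) \<subseteq> carrier D \<times> carrier M"
      by (intro order_trans[OF keys_frag_extend] UN_least)
    then show ?thesis by (simp add: Esimps(1))
  qed
  have relN: "x \<in> N" if "x \<in> tensor_rel A D h M" for x
    using that unfolding N_def tensor_ker_def by (rule generate.incl)
  have frel: "?f d x \<in> N" if d: "d \<in> carrier D" and x: "x \<in> tensor_rel A D h M" for d x
  proof -
    have "?f d x \<in> tensor_rel A D h M"
      using x unfolding tensor_rel_def
    proof (elim UnE CollectE exE conjE)
      fix d1 d2 m assume *: "x = frag_of (d1 \<oplus>\<^bsub>D\<^esub> d2, m) - frag_of (d1, m) - frag_of (d2, m)"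
        "d1 \<in> carrier D" "d2 \<in> carrier D" "m \<in> carrier M"
      show "?f d x \<in> {frag_of (d \<oplus>\<^bsub>D\<^esub> d', m) - frag_of (d, m) - frag_of (d', m) | d d' m.
        d \<in> carrier D \<and> d' \<in> carrier D \<and> m \<in> carrier M}
     \<union> {frag_of (d, m \<oplus>\<^bsub>M\<^esub> m') - frag_of (d, m) - frag_of (d, m') | d m m'.
        d \<in> carrier D \<and> m \<in> carrier M \<and> m' \<in> carrier M}
     \<union> {frag_of (d \<otimes>\<^bsub>D\<^esub> h a, m) - frag_of (d, a \<odot>\<^bsub>M\<^esub> m) | d a m.
        d \<in> carrier D \<and> a \<in> carrier A \<and> m \<in> carrier M}"
        by (intro UnI1 CollectI exI[of _ "d \<otimes>\<^bsub>D\<^esub> d1"] exI[of _ "d \<otimes>\<^bsub>D\<^esub> d2"] exI[of _ m])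
           (use * d in \<open>auto simp: frag_extend_diff D.r_distr\<close>)
    next
      fix d1 m1 m2 assume *: "x = frag_of (d1, m1 \<oplus>\<^bsub>M\<^esub> m2) - frag_of (d1, m1) - frag_of (d1, m2)"
        "d1 \<in> carrier D" "m1 \<in> carrier M" "m2 \<in> carrier M"
      show "?f d x \<in> {frag_of (d \<oplus>\<^bsub>D\<^esub> d', m) - frag_of (d, m) - frag_of (d', m) | d d' m.
        d \<in> carrier D \<and> d' \<in> carrier D \<and> m \<in> carrier M}
     \<union> {frag_of (d, m \<oplus>\<^bsub>M\<^esub> m') - frag_of (d, m) - frag_of (d, m') | d m m'.
        d \<in> carrier D \<and> m \<in> carrier M \<and> m' \<in> carrier M}
     \<union> {frag_of (d \<otimes>\<^bsub>D\<^esub> h a, m) - frag_of (d, a \<odot>\<^bsub>M\<^esub> m) | d a m.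
        d \<in> carrier D \<and> a \<in> carrier A \<and> m \<in> carrier M}"
        by (rule UnI1, rule UnI2,
            intro CollectI exI[of _ "d \<otimes>\<^bsub>D\<^esub> d1"] exI[of _ m1] exI[of _ m2])
           (use * d in \<open>auto simp: frag_extend_diff\<close>)
    next
      fix d1 a m assume *: "x = frag_of (d1 \<otimes>\<^bsub>D\<^esub> h a, m) - frag_of (d1, a \<odot>\<^bsub>M\<^esub> m)"
        "d1 \<in> carrier D" "a \<in> carrier A" "m \<in> carrier M"
      show "?f d x \<in> {frag_of (d \<oplus>\<^bsub>D\<^esub> d', m) - frag_of (d, m) - frag_of (d', m) | d d' m.
        d \<in> carrier D \<and> d' \<in> carrier D \<and> m \<in> carrier M}
     \<union> {frag_of (d, m \<oplus>\<^bsub>M\<^esub> m') - frag_of (d, m) - frag_of (d, m') | d m m'.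
        d \<in> carrier D \<and> m \<in> carrier M \<and> m' \<in> carrier M}
     \<union> {frag_of (d \<otimes>\<^bsub>D\<^esub> h a, m) - frag_of (d, a \<odot>\<^bsub>M\<^esub> m) | d a m.
        d \<in> carrier D \<and> a \<in> carrier A \<and> m \<in> carrier M}"
        by (intro UnI2 CollectI exI[of _ "d \<otimes>\<^bsub>D\<^esub> d1"] exI[of _ a] exI[of _ m])
           (use * d assms(3) in \<open>auto simp: frag_extend_diff D.m_assoc\<close>)
    qed
    then show ?thesis by (rule relN)
  qed
  have N0: "0 \<in> N" using N.one_closed by (simp add: Esimps)
  have Nadd: "x + y \<in> N" if "x \<in> N" "y \<in> N" for x y using N.m_closed[OF that] by (simp add: Esimps)
  have Nneg: "- x \<in> N" if "x \<in> N" for x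
    using N.m_inv_closed[OF that] invE[of x] N.subset that by auto
  have fN: "?f d x \<in> N" if d: "d \<in> carrier D" and x: "x \<in> N" for d x
  proof -
    have NE: "N = generate E (tensor_rel A D h M)" by (simp add: N_def tensor_ker_def E_def)
    have "x \<in> generate E (tensor_rel A D h M)" using x NE by simp
    then show ?thesis
    proof (induction x rule: generate.induct)
      case one then show ?case using N0 by (simp add: Esimps)
    next
      case (incl x) show ?case using frel[OF d incl] by simp
    next
      case (inv x)
      then have "x \<in> carrier E" using relE by blast
      then show ?case using Nneg[OF frel[OF d inv]] by (simp add: invE frag_extend_minus)
    next
      case (eng x y)
      then show ?case using Nadd by (simp add: Esimps frag_extend_add)
    qed
  qed
  have coset_eq: "N #>\<^bsub>E\<^esub> x = N #>\<^bsub>E\<^esub> y"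
    if "x \<in> carrier E" "y \<in> carrier E" "x - y \<in> N" for x y
  proof -
    have "x \<otimes>\<^bsub>E\<^esub> inv\<^bsub>E\<^esub> y = x - y" using that by (simp add: invE Esimps)
    then have "x \<in> N #>\<^bsub>E\<^esub> y" unfolding r_coset_def
      using that by (auto simp: Esimps intro!: bexI[of _ "x - y"])
    then show ?thesis using E.repr_independence[OF _ that(2) sgN] by simp
  qed
  have dif: "x - y \<in> N" if "x \<in> N #>\<^bsub>E\<^esub> y" for x y
    using that by (auto simp: r_coset_def Esimps)
  define V where "V = tensor A D h M"
  have Vsimps: "carrier V = carrier (E Mod N)" "ring.zero V = one (E Mod N)"
    "ring.add V = monoid.mult (E Mod N)"
    "module.smult V = (\<lambda>d C. \<Union>x\<in>C. N #>\<^bsub>E\<^esub> ?f d x)"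
    by (simp_all add: V_def tensor_def E_def N_def Let_def)
  have sm: "d \<odot>\<^bsub>V\<^esub> (N #>\<^bsub>E\<^esub> x) = N #>\<^bsub>E\<^esub> ?f d x" if "d \<in> carrier D" "x \<in> carrier E" for d x
  proof -
    have "N #>\<^bsub>E\<^esub> ?f d y = N #>\<^bsub>E\<^esub> ?f d x" if y: "y \<in> N #>\<^bsub>E\<^esub> x" for y
    proof (rule coset_eq)
      have "y \<in> carrier E" using y \<open>x \<in> carrier E\<close> E.r_coset_subset_G N.subset by blast
      then show "?f d y \<in> carrier E" using fE \<open>d \<in> _\<close> by blast
      show "?f d x \<in> carrier E" using fE that \<open>x \<in> carrier E\<close> \<open>d \<in> _\<close> by blast
      show "?f d y - ?f d x \<in> N" using fN[OF \<open>d \<in> _\<close> dif[OF y]] by (simp add: frag_extend_diff)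
    qed
    moreover have "x \<in> N #>\<^bsub>E\<^esub> x" using that E.rcos_self sgN by blast
    ultimately have "(\<Union>y\<in>N #>\<^bsub>E\<^esub> x. N #>\<^bsub>E\<^esub> ?f d y) = N #>\<^bsub>E\<^esub> ?f d x" by blast
    then show ?thesis by (simp only: Vsimps(4))
  qed
  have ad: "(N #>\<^bsub>E\<^esub> x) \<oplus>\<^bsub>V\<^esub> (N #>\<^bsub>E\<^esub> y) = N #>\<^bsub>E\<^esub> (x + y)" if "x \<in> carrier E" "y \<in> carrier E" for x y
    using N.rcos_sum[OF that] by (simp add: Vsimps Esimps)
  have carV: "carrier V = (\<lambda>x. N #>\<^bsub>E\<^esub> x) ` carrier E"
    by (simp add: Vsimps carrier_FactGroup)
  have plusE: "x + y \<in> carrier E" if "x \<in> carrier E" "y \<in> carrier E" for x y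
    using E.m_closed[OF that] by (simp add: Esimps)
  have agV: "abelian_group V"
    by (rule abelian_groupI; unfold Vsimps(1-3);
        (rule Q.m_closed Q.one_closed Q.m_assoc Q.l_one Q.l_inv_ex Q.m_comm | assumption)+)
  have "left_module D V"
  proof (intro left_module.intro left_module_axioms.intro)
    show "ring D" "abelian_group V" by fact+
  next
    fix a x assume "a \<in> carrier D" "x \<in> carrier V"
    then show "a \<odot>\<^bsub>V\<^esub> x \<in> carrier V" by (auto simp: carV sm fE)
  next
    fix a b x assume ab: "a \<in> carrier D" "b \<in> carrier D" and "x \<in> carrier V"
    then obtain y where y: "y \<in> carrier E" "x = N #>\<^bsub>E\<^esub> y" by (auto simp: carV)
    have key: "?f (a \<oplus>\<^bsub>D\<^esub> b) z - (?f a z + ?f b z) \<in> N" if "Poly_Mapping.keys z \<subseteq> carrier D \<times> carrier M" for z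
      using that
    proof (induction z rule: frag_induction)
      case zero then show ?case by (simp add: N0)
    next
      case (one p)
      obtain d m where p: "p = (d, m)" by (cases p)
      with one have dm: "d \<in> carrier D" "m \<in> carrier M" by auto
      have "frag_of (a \<otimes>\<^bsub>D\<^esub> d \<oplus>\<^bsub>D\<^esub> b \<otimes>\<^bsub>D\<^esub> d, m) - frag_of (a \<otimes>\<^bsub>D\<^esub> d, m) - frag_of (b \<otimes>\<^bsub>D\<^esub> d, m)
          \<in> tensor_rel A D h M"
        unfolding tensor_rel_def using ab dm by (intro UnI1) blast
      then show ?case using ab dm relN by (simp add: p D.l_distr diff_diff_eq)
    next
      case (diff u v)
      have "?f (a \<oplus>\<^bsub>D\<^esub> b) (u - v) - (?f a (u - v) + ?f b (u - v)) =
        (?f (a \<oplus>\<^bsub>D\<^esub> b) u - (?f a u + ?f b u)) + - (?f (a \<oplus>\<^bsub>D\<^esub> b) v - (?f a v + ?f b v))"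
        by (simp add: frag_extend_diff)
      then show ?case using Nadd[OF diff(1) Nneg[OF diff(2)]] by metis
    qed
    have "N #>\<^bsub>E\<^esub> ?f (a \<oplus>\<^bsub>D\<^esub> b) y = N #>\<^bsub>E\<^esub> (?f a y + ?f b y)"
      by (rule coset_eq) (use key y ab fE plusE in \<open>auto simp: Esimps(1)\<close>)
    then show "(a \<oplus>\<^bsub>D\<^esub> b) \<odot>\<^bsub>V\<^esub> x = a \<odot>\<^bsub>V\<^esub> x \<oplus>\<^bsub>V\<^esub> b \<odot>\<^bsub>V\<^esub> x"
      using y ab by (simp add: sm ad fE)
  next
    fix a x y assume a: "a \<in> carrier D" and "x \<in> carrier V" "y \<in> carrier V"
    then obtain u v where "u \<in> carrier E" "x = N #>\<^bsub>E\<^esub> u" "v \<in> carrier E" "y = N #>\<^bsub>E\<^esub> v"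
      by (auto simp: carV)
    then show "a \<odot>\<^bsub>V\<^esub> (x \<oplus>\<^bsub>V\<^esub> y) = a \<odot>\<^bsub>V\<^esub> x \<oplus>\<^bsub>V\<^esub> a \<odot>\<^bsub>V\<^esub> y"
      using a by (simp add: sm ad fE plusE frag_extend_add)
  next
    fix a b x assume ab: "a \<in> carrier D" "b \<in> carrier D" and "x \<in> carrier V"
    then obtain y where y: "y \<in> carrier E" "x = N #>\<^bsub>E\<^esub> y" by (auto simp: carV)
    have "?f (a \<otimes>\<^bsub>D\<^esub> b) z = ?f a (?f b z)" if "Poly_Mapping.keys z \<subseteq> carrier D \<times> carrier M" for z
      using that
      by (induction z rule: frag_induction) (use ab in \<open>auto simp: frag_extend_diff D.m_assoc\<close>)
    then show "(a \<otimes>\<^bsub>D\<^esub> b) \<odot>\<^bsub>V\<^esub> x = a \<odot>\<^bsub>V\<^esub> (b \<odot>\<^bsub>V\<^esub> x)"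
      using y ab by (simp add: sm fE) (simp add: Esimps)
  next
    fix x assume "x \<in> carrier V"
    then obtain y where y: "y \<in> carrier E" "x = N #>\<^bsub>E\<^esub> y" by (auto simp: carV)
    have "?f \<one>\<^bsub>D\<^esub> z = z" if "Poly_Mapping.keys z \<subseteq> carrier D \<times> carrier M" for z
      using that by (induction z rule: frag_induction) (auto simp: frag_extend_diff)
    then show "\<one>\<^bsub>D\<^esub> \<odot>\<^bsub>V\<^esub> x = x" using y by (simp add: sm) (simp add: Esimps)
  qed
  then show ?thesis by (simp add: V_def)
qed

text \<open>Linear algebra over \<open>\<rat>(q,t)\<close> in a module over a presented algebra.\<close>

definition kscale :: "'g presentation \<Rightarrow> ('g falg set, 'm) module \<Rightarrow> ratqt \<Rightarrow> 'm \<Rightarrow> 'm" where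
  "kscale P M c x = cls P (scalar c) \<odot>\<^bsub>M\<^esub> x"

definition lincomb :: "'g presentation \<Rightarrow> ('g falg set, 'm) module \<Rightarrow> ('i \<Rightarrow> 'm) \<Rightarrow> ('i \<Rightarrow> ratqt)
    \<Rightarrow> 'i set \<Rightarrow> 'm" where
  "lincomb P M x c J = (\<Oplus>\<^bsub>M\<^esub>i\<in>J. kscale P M (c i) (x i))"

definition kspan :: "'g presentation \<Rightarrow> ('g falg set, 'm) module \<Rightarrow> ('i \<Rightarrow> 'm) \<Rightarrow> 'i set \<Rightarrow> 'm set" where
  "kspan P M x I = {lincomb P M x c J | c J. finite J \<and> J \<subseteq> I}"

definition kbasis :: "'g presentation \<Rightarrow> ('g falg set, 'm) module \<Rightarrow> ('i \<Rightarrow> 'm) \<Rightarrow> 'i set \<Rightarrow> bool" where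
  "kbasis P M x I \<longleftrightarrow> x \<in> I \<rightarrow> carrier M \<and>
     (\<forall>v\<in>carrier M. \<exists>!c. finite {i. c i \<noteq> 0} \<and> {i. c i \<noteq> 0} \<subseteq> I \<and>
        v = lincomb P M x c {i. c i \<noteq> 0})"

section \<open>The algebras \<open>H\<^sub>n\<close>, \<open>A\<^sub>n\<close>, \<open>D\<^sub>n\<close>\<close>

datatype gens = Tgen nat | Thgen nat | Xgen nat

abbreviation fT :: "nat \<Rightarrow> gens falg" where "fT i \<equiv> gen (Tgen i)"
abbreviation fTh :: "nat \<Rightarrow> gens falg" where "fTh i \<equiv> gen (Thgen i)"
abbreviation fX :: "nat \<Rightarrow> gens falg" where "fX i \<equiv> gen (Xgen i)"

text \<open>The quadratic relation \<open>(T\<^sub>i - 1)(T\<^sub>i + t) = 0\<close> reads \<open>T\<^sub>i (T\<^sub>i + t - 1) = t\<close>; this gives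
  the inverse of \<open>T\<^sub>i\<close>. In the free algebra, \<open>fTinv i\<close> is an inverse only modulo this relation.\<close>

definition fTinv :: "nat \<Rightarrow> gens falg" where
  "fTinv i = scalar (1 / tt) * (fT i + scalar (tt - 1))"

lemma scalar_central: "scalar c * f = f * scalar c"
proof -
  have f: "f = (\<Sum>k\<in>Poly_Mapping.keys f. Poly_Mapping.single k (Poly_Mapping.lookup f k))"
    by (rule poly_mapping_eqI)
       (auto simp: lookup_sum lookup_single when_def in_keys_iff sum.delta)
  show ?thesis
    by (subst (1 2) f) (simp add: scalar_def sum_distrib_left sum_distrib_right mult_single mult.commute)
qed

lemma fTinv_inverse:
  "fTinv i * fT i - 1 = scalar (1 / tt) * ((fT i - 1) * (fT i + scalar tt))"
  "fT i * fTinv i - 1 = scalar (1 / tt) * ((fT i - 1) * (fT i + scalar tt))"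
proof -
  have aux: "u * (x + (s - 1)) * x - 1 = u * ((x - 1) * (x + s))"
    "x * (u * (x + (s - 1))) - 1 = u * ((x - 1) * (x + s))"
    if "u * s = 1" "s * x = x * s" "u * x = x * u" for u s x :: "gens falg"
  proof -
    have "u * (x * y) = x * (u * y)" for y
      by (simp only: mult.assoc[symmetric] that(3))
    with that show "u * (x + (s - 1)) * x - 1 = u * ((x - 1) * (x + s))"
      "x * (u * (x + (s - 1))) - 1 = u * ((x - 1) * (x + s))"
      by (simp_all add: algebra_simps)
  qed
  have d: "scalar (tt - 1) = (scalar tt - 1 :: gens falg)"
    by (simp add: scalar_def single_diff)
  have u: "scalar (1 / tt) * scalar tt = (1 :: gens falg)"
    using tt_nonzero by (simp add: scalar_def mult_single)
  show "fTinv i * fT i - 1 = scalar (1 / tt) * ((fT i - 1) * (fT i + scalar tt))"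
    "fT i * fTinv i - 1 = scalar (1 / tt) * ((fT i - 1) * (fT i + scalar tt))"
    unfolding fTinv_def d by (rule aux[OF u scalar_central scalar_central])+
qed

definition pi_elt :: "nat \<Rightarrow> gens falg" where
  "pi_elt n = scalar (tt ^ (n - 1)) * fTh 1 * prod_list (map fTinv [1..<n])"

definition hecke_rels :: "nat \<Rightarrow> gens falg set" where
  "hecke_rels n =
     {(fT i - 1) * (fT i + scalar tt) | i. i \<in> {1..<n}}
     \<union> {fT i * fT (i+1) * fT i - fT (i+1) * fT i * fT (i+1) | i. i \<in> {1..<n} \<and> i + 1 \<in> {1..<n}}
     \<union> {fT i * fT j - fT j * fT i | i j. i \<in> {1..<n} \<and> j \<in> {1..<n} \<and> \<bar>int i - int j\<bar> > 1}"

definition affine_rels :: "nat \<Rightarrow> gens falg set" where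
  "affine_rels n =
     {fTh i * fTh j - fTh j * fTh i | i j. i \<in> {1..n} \<and> j \<in> {1..n}}
     \<union> {fTh (i+1) - scalar tt * fTinv i * fTh i * fTinv i | i. i \<in> {1..<n}}
     \<union> {fT i * fTh j - fTh j * fT i | i j. i \<in> {1..<n} \<and> j \<in> {1..n} \<and> j \<notin> {i, i+1}}"

definition daha_rels :: "nat \<Rightarrow> gens falg set" where
  "daha_rels n =
     {fX i * fX j - fX j * fX i | i j. i \<in> {1..n} \<and> j \<in> {1..n}}
     \<union> {fX (i+1) - scalar tt * fTinv i * fX i * fTinv i | i. i \<in> {1..<n}}
     \<union> {fT i * fX j - fX j * fT i | i j. i \<in> {1..<n} \<and> j \<in> {1..n} \<and> j \<notin> {i, i+1}}
     \<union> {pi_elt n * fX i - fX (i+1) * pi_elt n | i. i \<in> {1..<n}}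
     \<union> (if n \<ge> 1 then {pi_elt n * fX n - scalar qq * fX 1 * pi_elt n} else {})"

definition H_pres :: "nat \<Rightarrow> gens presentation" where
  "H_pres n = (Tgen ` {1..<n}, hecke_rels n)"

definition A_pres :: "nat \<Rightarrow> gens presentation" where
  "A_pres n = (Tgen ` {1..<n} \<union> Thgen ` {1..n}, hecke_rels n \<union> affine_rels n)"

definition D_pres :: "nat \<Rightarrow> gens presentation" where
  "D_pres n = (Tgen ` {1..<n} \<union> Thgen ` {1..n} \<union> Xgen ` {1..n},
     hecke_rels n \<union> affine_rels n \<union> daha_rels n)"

text \<open>The value of \<open>thbar\<close> at 0 is junk.\<close>

fun thbar :: "nat \<Rightarrow> gens falg" where
  "thbar 0 = 1"
| "thbar (Suc 0) = 1"
| "thbar (Suc (Suc i)) = scalar tt * fTinv (Suc i) * thbar (Suc i) * fTinv (Suc i)"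

definition phibar :: "nat \<Rightarrow> gens falg" where
  "phibar i = (scalar tt * fTinv i) * thbar i - thbar i * (scalar tt * fTinv i)"

lemma fTinv_closed: "Tgen i \<in> G \<Longrightarrow> fTinv i \<in> carrier (free_alg G)"
  unfolding fTinv_def by (intro free_alg_closed) auto

lemma thbar_closed:
  "\<lbrakk>Tgen ` {1..<n} \<subseteq> G; i \<le> n\<rbrakk> \<Longrightarrow> thbar i \<in> carrier (free_alg G)"
  by (induction i rule: thbar.induct) (auto intro!: free_alg_closed fTinv_closed)

lemma pi_elt_closed:
  "\<lbrakk>Tgen ` {1..<n} \<subseteq> G; Thgen 1 \<in> G\<rbrakk> \<Longrightarrow> pi_elt n \<in> carrier (free_alg G)"
  unfolding pi_elt_def by (intro free_alg_closed) (auto intro!: fTinv_closed)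

lemma hecke_rels_closed: "Tgen ` {1..<n} \<subseteq> G \<Longrightarrow> hecke_rels n \<subseteq> carrier (free_alg G)"
  unfolding hecke_rels_def by (auto intro!: free_alg_closed)

lemma affine_rels_closed:
  "\<lbrakk>Tgen ` {1..<n} \<subseteq> G; Thgen ` {1..n} \<subseteq> G\<rbrakk> \<Longrightarrow> affine_rels n \<subseteq> carrier (free_alg G)"
  unfolding affine_rels_def by (auto intro!: free_alg_closed fTinv_closed)

lemma daha_rels_closed:
  "\<lbrakk>Tgen ` {1..<n} \<subseteq> G; Thgen ` {1..n} \<subseteq> G; Xgen ` {1..n} \<subseteq> G\<rbrakk>
    \<Longrightarrow> daha_rels n \<subseteq> carrier (free_alg G)"
  unfolding daha_rels_def by (auto intro!: free_alg_closed fTinv_closed pi_elt_closed)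

lemma pres_closed:
  "snd (H_pres n) \<subseteq> carrier (free_alg (fst (H_pres n)))"
  "snd (A_pres n) \<subseteq> carrier (free_alg (fst (A_pres n)))"
  "snd (D_pres n) \<subseteq> carrier (free_alg (fst (D_pres n)))"
  unfolding H_pres_def A_pres_def D_pres_def fst_conv snd_conv
  by (intro Un_least hecke_rels_closed affine_rels_closed daha_rels_closed; blast)+

text \<open>\<open>rho n : A\<^sub>n \<rightarrow> H\<^sub>n\<close> and the canonical map \<open>incl n : A\<^sub>n \<rightarrow> D\<^sub>n\<close>. There is no generator
  \<open>Xgen i\<close> in \<open>A\<^sub>n\<close>.\<close>

definition rho :: "nat \<Rightarrow> gens falg set \<Rightarrow> gens falg set" where
  "rho n = alg_map (H_pres n)
     (\<lambda>g. case g of Tgen i \<Rightarrow> fT i | Thgen i \<Rightarrow> thbar i | Xgen i \<Rightarrow> undefined)"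

definition incl :: "nat \<Rightarrow> gens falg set \<Rightarrow> gens falg set" where
  "incl n = alg_map (D_pres n) gen"

definition perm_length :: "nat \<Rightarrow> (nat \<Rightarrow> nat) \<Rightarrow> nat" where
  "perm_length n \<sigma> = card {(i, j). i \<in> {1..n} \<and> j \<in> {1..n} \<and> i < j \<and> \<sigma> i > \<sigma> j}"

definition word_perm :: "nat list \<Rightarrow> nat \<Rightarrow> nat" where
  "word_perm u = foldr (\<lambda>i p. transpose i (Suc i) \<circ> p) u id"

definition reduced_word :: "nat \<Rightarrow> (nat \<Rightarrow> nat) \<Rightarrow> nat list \<Rightarrow> bool" where
  "reduced_word n \<sigma> u \<longleftrightarrow> set u \<subseteq> {1..<n} \<and> word_perm u = \<sigma> \<and> length u = perm_length n \<sigma>"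

text \<open>As an element of the free algebra, \<open>fTperm n \<sigma>\<close> depends on the choice of a reduced word of
  \<open>\<sigma>\<close>; its class in \<open>H\<^sub>n\<close> does not.\<close>

definition fTperm :: "nat \<Rightarrow> (nat \<Rightarrow> nat) \<Rightarrow> gens falg" where
  "fTperm n \<sigma> = prod_list (map fT (SOME u. reduced_word n \<sigma> u))"

definition t_factorial :: "nat \<Rightarrow> ratqt" where
  "t_factorial n = (\<Prod>i\<in>{1..n}. (1 - tt ^ i) / (1 - tt))"

text \<open>The value \<open>(n choose 2)\<close> is the maximal length, so the subtraction below never truncates.\<close>

definition eps :: "nat \<Rightarrow> gens falg" where
  "eps n = scalar (1 / t_factorial n) *
     (\<Sum>\<sigma> | \<sigma> permutes {1..n}. scalar (tt ^ ((n choose 2) - perm_length n \<sigma>)) * fTperm n \<sigma>)"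

section \<open>The modules \<open>\<lambda>\<close> and \<open>V\<^sub>\<lambda>\<close>\<close>

text \<open>\<open>L\<close> is the \<open>H\<^sub>n\<close>-module \<open>\<lambda>\<close>, and \<open>b \<tau>\<close> is its basis vector indexed by the standard
  tableau \<open>\<tau>\<close>. These conditions determine \<open>L\<close> and \<open>b\<close> up to isomorphism.\<close>

definition specht_module :: "nat list \<Rightarrow> (gens falg set, 'm) module \<Rightarrow> (tableau \<Rightarrow> 'm) \<Rightarrow> bool" where
  "specht_module lam L b \<longleftrightarrow>
     (let n = sum_list lam; H = H_pres n in
      left_module (alg H) L \<and>
      kbasis H L b (SYT lam) \<and>
      (\<forall>\<tau>\<in>SYT lam. \<forall>i\<in>{1..n}.
         cls H (thbar i) \<odot>\<^bsub>L\<^esub> b \<tau> = kscale H L (tt powi cont lam \<tau> i) (b \<tau>)) \<and>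
      (\<forall>\<tau>\<in>SYT lam. \<forall>i\<in>{1..<n}. s_act lam i \<tau> \<in> PSYT lam \<and> psyt_less lam \<tau> (s_act lam i \<tau>) \<longrightarrow>
         cls H (phibar i) \<odot>\<^bsub>L\<^esub> b \<tau> =
           kscale H L (tt powi cont lam \<tau> i - tt powi cont lam \<tau> (i + 1)) (b (s_act lam i \<tau>))) \<and>
      (\<forall>\<tau>\<in>SYT lam. \<forall>i\<in>{1..<n}. snd (box_of lam \<tau> i) = snd (box_of lam \<tau> (i + 1)) \<longrightarrow>
         cls H (fT i) \<odot>\<^bsub>L\<^esub> b \<tau> = b \<tau>) \<and>
      (\<forall>\<tau>\<in>SYT lam. \<forall>i\<in>{1..<n}. fst (box_of lam \<tau> i) = fst (box_of lam \<tau> (i + 1)) \<longrightarrow>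
         cls H (fT i) \<odot>\<^bsub>L\<^esub> b \<tau> = kscale H L (- tt) (b \<tau>)))"

type_synonym 'm ind = "(gens falg set \<times> 'm \<Rightarrow>\<^sub>0 int) set"

definition V_mod :: "nat list \<Rightarrow> (gens falg set, 'm) module \<Rightarrow> (gens falg set, 'm ind) module" where
  "V_mod lam L = (let n = sum_list lam in
     tensor (alg (A_pres n)) (alg (D_pres n)) (incl n) (restrict_scalars (rho n) L))"

lemma left_module_V_mod:
  assumes "specht_module lam L b"
  shows "left_module (alg (D_pres (sum_list lam))) (V_mod lam L)"
proof -
  define n where "n = sum_list lam"
  interpret L: left_module "alg (H_pres n)" L
    using assms by (simp add: specht_module_def Let_def n_def)
  have abL: "abelian_group (restrict_scalars (rho n) L)"
    using L.M.abelian_group_axioms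
    by (simp add: restrict_scalars_def abelian_group_def abelian_group_axioms_def abelian_monoid_def)
  have "left_module (alg (D_pres n)) (tensor (alg (A_pres n)) (alg (D_pres n)) (incl n) (restrict_scalars (rho n) L))"
  proof (rule left_module_tensor[OF ring_alg[OF pres_closed(3)] abL])
    show "incl n ` carrier (alg (A_pres n)) \<subseteq> carrier (alg (D_pres n))"
    proof (intro image_subsetI)
      fix C assume C: "C \<in> carrier (alg (A_pres n))"
      have "gen g \<in> carrier (free_alg (fst (D_pres n)))" if "g \<in> fst (A_pres n)" for g
        using that by (intro free_alg_closed(4)) (auto simp: A_pres_def D_pres_def)
      then show "incl n C \<in> carrier (alg (D_pres n))"
        unfolding incl_def by (rule alg_map_closed[OF pres_closed(2,3) _ C])
    qed
  next
    fix a m assume a: "a \<in> carrier (alg (A_pres n))" and "m \<in> carrier (restrict_scalars (rho n) L)"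
    moreover have "rho n a \<in> carrier (alg (H_pres n))"
      unfolding rho_def
      by (rule alg_map_closed[OF pres_closed(2,1) _ a])
         (auto intro!: free_alg_closed(4) thbar_closed[of n] simp: A_pres_def H_pres_def)
    ultimately show "a \<odot>\<^bsub>restrict_scalars (rho n) L\<^esub> m \<in> carrier (restrict_scalars (rho n) L)"
      by (simp add: restrict_scalars_def L.smult_closed)
  qed
  then show ?thesis by (simp add: V_mod_def Let_def n_def)
qed

definition one_tensor :: "nat list \<Rightarrow> (gens falg set, 'm) module \<Rightarrow> 'm \<Rightarrow> 'm ind" where
  "one_tensor lam L m = (let n = sum_list lam in
     pure_tensor (alg (A_pres n)) (alg (D_pres n)) (incl n) (restrict_scalars (rho n) L)
       \<one>\<^bsub>alg (D_pres n)\<^esub> m)"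

text \<open>The action on \<open>V\<^sub>\<lambda>\<close> of the element of \<open>D\<^sub>n\<close> represented by \<open>f\<close>.\<close>

definition V_act :: "nat list \<Rightarrow> (gens falg set, 'm) module \<Rightarrow> gens falg \<Rightarrow> 'm ind \<Rightarrow> 'm ind" where
  "V_act lam L f v = cls (D_pres (sum_list lam)) f \<odot>\<^bsub>V_mod lam L\<^esub> v"

text \<open>The inverse of the action of \<open>\<pi>\<^sub>n\<close>, which is bijective on \<open>V\<^sub>\<lambda>\<close>.\<close>

definition pi_inv :: "nat list \<Rightarrow> (gens falg set, 'm) module \<Rightarrow> 'm ind \<Rightarrow> 'm ind" where
  "pi_inv lam L = inv_into (carrier (V_mod lam L)) (V_act lam L (pi_elt (sum_list lam)))"

definition eigval :: "nat list \<Rightarrow> tableau \<Rightarrow> nat \<Rightarrow> ratqt" where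
  "eigval lam \<tau> i = qq ^ wt lam \<tau> i * tt powi cont lam \<tau> i"

definition F_basis :: "nat list \<Rightarrow> (gens falg set, 'm) module \<Rightarrow> (tableau \<Rightarrow> 'm)
    \<Rightarrow> (tableau \<Rightarrow> 'm ind) \<Rightarrow> bool" where
  "F_basis lam L b F \<longleftrightarrow>
     (let n = sum_list lam in
      kbasis (D_pres n) (V_mod lam L) F (PSYT lam) \<and>
      (\<forall>\<tau>\<in>PSYT lam. \<forall>i\<in>{1..n}.
         V_act lam L (fTh i) (F \<tau>) = V_act lam L (scalar (eigval lam \<tau> i)) (F \<tau>)) \<and>
      (\<forall>\<tau>\<in>SYT lam. F \<tau> = one_tensor lam L (b \<tau>)) \<and>
      (\<forall>\<tau>\<in>PSYT lam. \<forall>i\<in>{1..<n}. s_act lam i \<tau> \<in> PSYT lam \<and> psyt_less lam \<tau> (s_act lam i \<tau>) \<longrightarrow>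
         V_act lam L
           (scalar tt * fTinv i +
            scalar ((tt - 1) * eigval lam \<tau> (i + 1) / (eigval lam \<tau> i - eigval lam \<tau> (i + 1))))
           (F \<tau>) = F (s_act lam i \<tau>)) \<and>
      (\<forall>\<tau>\<in>PSYT lam. n \<ge> 1 \<longrightarrow>
         F (Psi lam \<tau>) =
           V_act lam L (scalar (qq ^ wt lam \<tau> 1) * fX n) (pi_inv lam L (F \<tau>))))"

definition U_sub :: "nat list \<Rightarrow> (gens falg set, 'm) module \<Rightarrow> (tableau \<Rightarrow> 'm ind)
    \<Rightarrow> (box \<Rightarrow> nat) \<Rightarrow> 'm ind set" where
  "U_sub lam L F T = kspan (D_pres (sum_list lam)) (V_mod lam L) F (PSYT_over lam T)"

definition P_elt :: "nat list \<Rightarrow> (gens falg set, 'm) module \<Rightarrow> (tableau \<Rightarrow> 'm ind)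
    \<Rightarrow> (box \<Rightarrow> nat) \<Rightarrow> 'm ind" where
  "P_elt lam L F T = (THE P. P \<in> V_act lam L (eps (sum_list lam)) ` U_sub lam L F T \<and>
     (\<exists>\<kappa>. P = F (Top lam T) \<oplus>\<^bsub>V_mod lam L\<^esub>
        lincomb (D_pres (sum_list lam)) (V_mod lam L) F \<kappa> (PSYT_over lam T - {Top lam T})))"

end

theory Submission
  imports Defs
begin

text \<open>In the basis \<open>F\<^sub>\<tau>\<close> of \<open>U\<^sub>T\<close> each \<open>T\<^sub>i\<close> acts by blocks of size at most two. If \<open>s\<^sub>i(\<tau>)\<close> is not a
  tableau, then \<open>i\<close> and \<open>i + 1\<close> are neighbours in a row (columns are excluded because \<open>T\<close> decreases
  strictly along them), the intertwiner kills \<open>F\<^sub>\<tau>\<close> because the \<open>\<theta>\<^sub>j\<close> have simple joint spectrum, and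
  hence \<open>T\<^sub>i F\<^sub>\<tau> = F\<^sub>\<tau>\<close>. If \<open>s\<^sub>i(\<tau>) > \<tau>\<close>, a vector \<open>\<Sum>c\<^sub>\<tau> F\<^sub>\<tau>\<close> is fixed on that block iff \<open>c\<^sub>\<tau> = g c\<close>
  with \<open>c\<close> the coefficient at \<open>s\<^sub>i(\<tau>)\<close> and \<open>g\<close> the factor of the one inversion that \<open>\<tau>\<close> has in
  addition to those of \<open>s\<^sub>i(\<tau>)\<close>. So the product formula is fixed by all \<open>T\<^sub>i\<close>, and a fixed vector is
  determined by its coefficient at \<open>Top(T)\<close>. The image of \<open>\<epsilon>\<close> is fixed by Matsumoto's theorem, and
  \<open>\<epsilon>\<close> scales fixed vectors by a nonzero factor, the value of which is not needed.\<close>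

section \<open>Reduced words\<close>

text \<open>The factor of an inversion arises as follows. Let \<open>s_i(\<tau>) > \<tau>\<close>,
  and let x and y be the eigenvalues of \<open>\<theta>_i\<close> and \<open>\<theta>_(i+1)\<close>
  on \<open>F_\<tau>\<close>. The prescribed formula for \<open>F\<close> gives
  \<open>T_i F_\<tau> = F_(s_i(\<tau>)) + \<alpha> F_\<tau>\<close> with
  \<open>\<alpha> = (1 - t) x / (x - y)\<close>. The quadratic relation supplies the other column of
  the block, whose eigenvalues 1 and -t determine its trace and determinant. In the eigenvector for
  1 the two coefficients have the ratio \<open>t + \<alpha> = (t y - x) / (y - x)\<close>. Since x
  and y depend only on the boxes of \<open>i\<close> and \<open>i + 1\<close>, this ratio belongs to
  a pair of boxes, and the product does not depend on the path that leads from \<tau> to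
  \<open>Top(T)\<close>. The obstacle on the side of \<open>\<epsilon>\<close> is that each
  \<open>T_\<sigma>\<close> is formed from an arbitrarily chosen reduced word. Comparing
  \<open>T_i T_\<sigma>\<close> with the chosen word of \<open>s_i \<sigma>\<close> therefore
  requires independence of the word. It is proved for operators on a set, so that it applies
  directly to coordinate functions on \<open>U_T\<close>.\<close>

lemma transpose_Suc_less_iff:
  fixes a b i :: nat
  assumes "a \<noteq> b" "{a, b} \<noteq> {i, Suc i}"
  shows "transpose i (Suc i) a < transpose i (Suc i) b \<longleftrightarrow> a < b"
  using assms by (auto simp: transpose_def doubleton_eq_iff)

text \<open>Induction upwards from 1 gives \<open>i \<le> f i\<close>, induction downwards from
  \<open>n\<close> gives \<open>f i \<le> i\<close>. This recognizes both the permutation without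
  descents and the tableau without a step up.\<close>

lemma strict_mono_on_interval_id:
  fixes f :: "nat \<Rightarrow> nat"
  assumes "f ` {1..n} \<subseteq> {1..n}" and step: "\<And>i. i \<in> {1..<n} \<Longrightarrow> f i < f (Suc i)" and i: "i \<in> {1..n}"
  shows "f i = i"
proof (rule antisym)
  have "i \<le> n \<longrightarrow> i \<le> f i" if "1 \<le> i" for i
    using that
  proof (induction i rule: nat_induct_at_least)
    case base show ?case using assms(1) by force
  next
    case (Suc i) then show ?case using step[of i] by auto
  qed
  then show "i \<le> f i" using i by auto
  have "i \<ge> 1 \<longrightarrow> f i \<le> i" if "i \<le> n" for i
    using that
  proof (induction i rule: inc_induct)
    case base show ?case using assms(1) by force
  next
    case (step i) then show ?case using assms(2)[of i] by auto
  qed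
  then show "f i \<le> i" using i by auto
qed

text \<open>Multiplication by a transposition on the left exchanges values, so the test compares the
  positions of the values \<open>i\<close> and \<open>Suc i\<close>.\<close>

definition left_descent :: "(nat \<Rightarrow> nat) \<Rightarrow> nat \<Rightarrow> bool" where
  "left_descent \<sigma> i \<longleftrightarrow> Hilbert_Choice.inv \<sigma> i > Hilbert_Choice.inv \<sigma> (Suc i)"

definition inversions :: "nat \<Rightarrow> (nat \<Rightarrow> nat) \<Rightarrow> (nat \<times> nat) set" where
  "inversions n \<sigma> = {(i, j). i \<in> {1..n} \<and> j \<in> {1..n} \<and> i < j \<and> \<sigma> i > \<sigma> j}"

lemma finite_inversions: "finite (inversions n \<sigma>)"
  by (rule finite_subset[of _ "{1..n} \<times> {1..n}"]) (auto simp: inversions_def)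

lemma perm_length_le: "perm_length n \<sigma> \<le> n choose 2"
proof -
  have "card (inversions n \<sigma>) \<le> card {B. B \<subseteq> {1..n} \<and> card B = 2}"
  proof (rule card_inj_on_le[of "\<lambda>(i, j). {i, j}"])
    show "inj_on (\<lambda>(i, j). {i, j}) (inversions n \<sigma>)"
      by (auto simp: inj_on_def inversions_def doubleton_eq_iff)
    show "(\<lambda>(i, j). {i, j}) ` inversions n \<sigma> \<subseteq> {B. B \<subseteq> {1..n} \<and> card B = 2}"
      by (auto simp: inversions_def)
    show "finite {B. B \<subseteq> {1..n} \<and> card B = 2}" by simp
  qed
  also have "\<dots> = n choose 2" using n_subsets[of "{1..n}" 2] by simp
  finally show ?thesis by (simp add: perm_length_def inversions_def)
qed

lemma permutes_transpose_Suc: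
  "i \<in> {1..<n} \<Longrightarrow> transpose i (Suc i) permutes {1..n}"
  by (rule permutes_swap_id) auto

lemma inv_transpose_comp:
  assumes "\<sigma> permutes A"
  shows "Hilbert_Choice.inv (transpose i j \<circ> \<sigma>) k = Hilbert_Choice.inv \<sigma> (transpose i j k)"
  using assms by (simp add: o_inv_distrib permutes_bij)

lemma left_descent_transpose_comp:
  assumes "\<sigma> permutes A"
  shows "left_descent (transpose i (Suc i) \<circ> \<sigma>) i \<longleftrightarrow> \<not> left_descent \<sigma> i"
proof -
  have "Hilbert_Choice.inv \<sigma> i \<noteq> Hilbert_Choice.inv \<sigma> (Suc i)"
    using permutes_inv[OF assms] by (metis n_not_Suc_n permutes_inj injD)
  then show ?thesis by (auto simp: left_descent_def inv_transpose_comp[OF assms])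
qed

text \<open>Exchanging the values \<open>i\<close> and \<open>Suc i\<close> reverses the comparison
  at one pair of positions only, namely \<open>p\<close> and \<open>q\<close> where these values
  stand; as \<open>p < q\<close>, that pair becomes a new inversion.\<close>

lemma perm_length_up:
  assumes s: "\<sigma> permutes {1..n}" and i: "i \<in> {1..<n}" and d: "\<not> left_descent \<sigma> i"
  shows "perm_length n (transpose i (Suc i) \<circ> \<sigma>) = Suc (perm_length n \<sigma>)"
proof -
  define p q where "p = Hilbert_Choice.inv \<sigma> i" and "q = Hilbert_Choice.inv \<sigma> (Suc i)"
  have pq: "\<sigma> p = i" "\<sigma> q = Suc i" using s by (simp_all add: p_def q_def permutes_inverses)
  have "p \<noteq> q" using pq by auto
  with d have lt: "p < q" by (simp add: left_descent_def p_def q_def)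
  have mem: "p \<in> {1..n}" "q \<in> {1..n}"
    using i s pq by (metis atLeastLessThan_iff atLeastAtMost_iff permutes_in_image less_imp_le Suc_leI le_SucI)+
  have inj: "\<sigma> a = \<sigma> b \<longleftrightarrow> a = b" for a b using s permutes_inj by (metis injD)
  have eq: "inversions n (transpose i (Suc i) \<circ> \<sigma>) = insert (p, q) (inversions n \<sigma>)"
  proof (rule Set.set_eqI)
    fix z :: "nat \<times> nat"
    obtain a b where z: "z = (a, b)" by fastforce
    show "z \<in> inversions n (transpose i (Suc i) \<circ> \<sigma>) \<longleftrightarrow> z \<in> insert (p, q) (inversions n \<sigma>)"
    proof (cases "a < b \<and> {\<sigma> a, \<sigma> b} = {i, Suc i}")
      case True
      then have "(a = p \<and> b = q) \<or> (a = q \<and> b = p)"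
        using inj pq by (metis doubleton_eq_iff)
      then show ?thesis using True lt mem pq by (auto simp: z inversions_def)
    next
      case False
      then have "\<not> (a = p \<and> b = q)" using lt pq by auto
      then show ?thesis using False transpose_Suc_less_iff[of "\<sigma> b" "\<sigma> a" i] inj
        by (auto simp: z inversions_def insert_commute)
    qed
  qed
  have "(p, q) \<notin> inversions n \<sigma>" using pq by (simp add: inversions_def)
  then have "card (inversions n (transpose i (Suc i) \<circ> \<sigma>)) = Suc (card (inversions n \<sigma>))"
    unfolding eq by (simp add: finite_inversions)
  then show ?thesis by (simp add: perm_length_def inversions_def)
qed

lemma transpose_comp_transpose_comp: "transpose i j \<circ> (transpose i j \<circ> \<sigma>) = \<sigma>"
  by (simp add: fun_eq_iff)

lemma perm_length_down:
  assumes s: "\<sigma> permutes {1..n}" and i: "i \<in> {1..<n}" and d: "left_descent \<sigma> i"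
  shows "perm_length n \<sigma> = Suc (perm_length n (transpose i (Suc i) \<circ> \<sigma>))"
  using perm_length_up[OF permutes_compose[OF s permutes_transpose_Suc[OF i]] i] d
  by (simp add: left_descent_transpose_comp[OF s] transpose_comp_transpose_comp)

lemma word_perm_simps:
  "word_perm [] = id" "word_perm (i # u) = transpose i (Suc i) \<circ> word_perm u"
  by (simp_all add: word_perm_def)

lemma word_perm_permutes: "set u \<subseteq> {1..<n} \<Longrightarrow> word_perm u permutes {1..n}"
proof (induction u)
  case (Cons i u)
  show ?case
    unfolding word_perm_simps
    by (rule permutes_compose[OF Cons.IH permutes_transpose_Suc]) (use Cons.prems in auto)
qed (simp add: word_perm_simps permutes_id)

lemma perm_length_id [simp]: "perm_length n id = 0"
proof -
  have "{(i, j). i \<in> {1..n} \<and> j \<in> {1..n} \<and> i < j \<and> id i > id j} = {}" by auto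
  then show ?thesis by (simp only: perm_length_def card.empty)
qed

lemma perm_length_word_perm_le: "set u \<subseteq> {1..<n} \<Longrightarrow> perm_length n (word_perm u) \<le> length u"
proof (induction u)
  case (Cons i u)
  then have u: "set u \<subseteq> {1..<n}" and i: "i \<in> {1..<n}" by auto
  note p = word_perm_permutes[OF u]
  have "perm_length n (transpose i (Suc i) \<circ> word_perm u) \<le> Suc (perm_length n (word_perm u))"
    using perm_length_up[OF p i] perm_length_down[OF p i] by fastforce
  then show ?case using Cons.IH[OF u] by (simp only: word_perm_simps list.size)
qed (simp add: word_perm_simps)

lemma reduced_word_permutes: "reduced_word n \<sigma> u \<Longrightarrow> \<sigma> permutes {1..n}"
  using word_perm_permutes by (auto simp: reduced_word_def)

text \<open>A letter changes the length by exactly one, and no word is shorter than the length of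
  its permutation. So the first letter of a reduced word is a descent and the tail is again
  reduced.\<close>

lemma reduced_word_Cons_iff:
  "reduced_word n \<sigma> (i # u) \<longleftrightarrow>
    i \<in> {1..<n} \<and> \<sigma> permutes {1..n} \<and> left_descent \<sigma> i \<and> reduced_word n (transpose i (Suc i) \<circ> \<sigma>) u"
proof
  assume r: "reduced_word n \<sigma> (i # u)"
  let ?\<tau> = "word_perm u"
  have s: "\<sigma> permutes {1..n}" by (rule reduced_word_permutes[OF r])
  from r have u: "set u \<subseteq> {1..<n}" and i: "i \<in> {1..<n}" and eq: "\<sigma> = transpose i (Suc i) \<circ> ?\<tau>"
    and len: "perm_length n \<sigma> = Suc (length u)"
    by (auto simp: reduced_word_def word_perm_simps)
  have p: "?\<tau> permutes {1..n}" by (rule word_perm_permutes[OF u])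
  have le: "perm_length n ?\<tau> \<le> length u" by (rule perm_length_word_perm_le[OF u])
  have d: "\<not> left_descent ?\<tau> i" using perm_length_down[OF p i] le len eq by fastforce
  have "length u = perm_length n ?\<tau>" using perm_length_up[OF p i d] len eq by simp
  then show "i \<in> {1..<n} \<and> \<sigma> permutes {1..n} \<and> left_descent \<sigma> i \<and> reduced_word n (transpose i (Suc i) \<circ> \<sigma>) u"
    using d i s u left_descent_transpose_comp[OF p] by (simp add: eq reduced_word_def transpose_comp_transpose_comp)
next
  assume "i \<in> {1..<n} \<and> \<sigma> permutes {1..n} \<and> left_descent \<sigma> i \<and> reduced_word n (transpose i (Suc i) \<circ> \<sigma>) u"
  then show "reduced_word n \<sigma> (i # u)"
    using perm_length_down[of \<sigma> n i]
    by (simp add: reduced_word_def word_perm_simps transpose_comp_transpose_comp)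
qed

text \<open>Every descent can be split off as a first letter. Without descents the inverse
  permutation is increasing, hence the identity.\<close>

lemma reduced_word_exists:
  assumes "\<sigma> permutes {1..n}"
  shows "\<exists>u. reduced_word n \<sigma> u"
  using assms
proof (induction "perm_length n \<sigma>" arbitrary: \<sigma> rule: less_induct)
  case less
  show ?case
  proof (cases "\<exists>i\<in>{1..<n}. left_descent \<sigma> i")
    case True
    then obtain i where i: "i \<in> {1..<n}" "left_descent \<sigma> i" by blast
    have "\<exists>u. reduced_word n (transpose i (Suc i) \<circ> \<sigma>) u"
      using perm_length_down[OF less(2) i] permutes_compose[OF less(2) permutes_transpose_Suc[OF i(1)]]
      by (intro less(1)) simp_all
    then obtain u where "reduced_word n (transpose i (Suc i) \<circ> \<sigma>) u" by blast
    with i less(2) have "reduced_word n \<sigma> (i # u)" by (simp add: reduced_word_Cons_iff)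
    then show ?thesis by blast
  next
    case False
    have p: "Hilbert_Choice.inv \<sigma> permutes {1..n}" by (rule permutes_inv[OF less(2)])
    have "Hilbert_Choice.inv \<sigma> i < Hilbert_Choice.inv \<sigma> (Suc i)" if "i \<in> {1..<n}" for i
      using False that permutes_inj[OF p] by (metis left_descent_def injD n_not_Suc_n nat_neq_iff)
    then have "Hilbert_Choice.inv \<sigma> i = i" if "i \<in> {1..n}" for i
      using that permutes_image[OF p] by (intro strict_mono_on_interval_id[of "Hilbert_Choice.inv \<sigma>" n]) auto
    then have "Hilbert_Choice.inv \<sigma> = id" using permutes_not_in[OF p] by fastforce
    then have "\<sigma> = id" using inv_inv_eq[OF permutes_bij[OF less(2)]] by simp
    then show ?thesis by (intro exI[of _ "[]"]) (simp add: reduced_word_def word_perm_simps)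
  qed
qed

lemma transpose_Suc_braid:
  "transpose (Suc i) (Suc (Suc i)) \<circ> (transpose i (Suc i) \<circ> (transpose (Suc i) (Suc (Suc i)) \<circ> \<sigma>)) =
   transpose i (Suc i) \<circ> (transpose (Suc i) (Suc (Suc i)) \<circ> (transpose i (Suc i) \<circ> \<sigma>))"
  by (auto simp: fun_eq_iff transpose_def)

text \<open>Two adjacent descents mean that the positions of \<open>i\<close>, \<open>i + 1\<close>,
  \<open>i + 2\<close> decrease, so three letters can be split off in turn. The second word has the
  same length and, by the braid relation, the same product.\<close>

lemma reduced_word_braid:
  assumes s: "\<sigma> permutes {1..n}" and i: "i \<in> {1..<n}" "Suc i \<in> {1..<n}" and d: "left_descent \<sigma> i" "left_descent \<sigma> (Suc i)"
  shows "\<exists>w. reduced_word n \<sigma> (i # Suc i # i # w) \<and> reduced_word n \<sigma> (Suc i # i # Suc i # w)"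
proof -
  let ?s = "transpose i (Suc i)" and ?r = "transpose (Suc i) (Suc (Suc i))"
  have p1: "?s \<circ> \<sigma> permutes {1..n}" by (rule permutes_compose[OF s permutes_transpose_Suc[OF i(1)]])
  have p2: "?r \<circ> (?s \<circ> \<sigma>) permutes {1..n}" by (rule permutes_compose[OF p1 permutes_transpose_Suc[OF i(2)]])
  have p3: "?s \<circ> (?r \<circ> (?s \<circ> \<sigma>)) permutes {1..n}" by (rule permutes_compose[OF p2 permutes_transpose_Suc[OF i(1)]])
  obtain w where w: "reduced_word n (?s \<circ> (?r \<circ> (?s \<circ> \<sigma>))) w" using reduced_word_exists[OF p3] by blast
  have "left_descent (?s \<circ> \<sigma>) (Suc i)" "left_descent (?r \<circ> (?s \<circ> \<sigma>)) i"
    using d unfolding left_descent_def inv_transpose_comp[OF s] inv_transpose_comp[OF p1] by (auto simp: transpose_def)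
  then have r: "reduced_word n \<sigma> (i # Suc i # i # w)"
    using s i d w p1 p2 by (simp add: reduced_word_Cons_iff)
  then have "reduced_word n \<sigma> (Suc i # i # Suc i # w)"
    using transpose_Suc_braid[of i "word_perm w"] by (auto simp: reduced_word_def word_perm_simps)
  with r show ?thesis by blast
qed

lemma reduced_word_commute:
  assumes s: "\<sigma> permutes {1..n}" and i: "i \<in> {1..<n}" "j \<in> {1..<n}" and d: "left_descent \<sigma> i" "left_descent \<sigma> j"
    and ij: "\<bar>int i - int j\<bar> > 1"
  shows "\<exists>w. reduced_word n \<sigma> (i # j # w) \<and> reduced_word n \<sigma> (j # i # w)"
proof -
  let ?s = "transpose i (Suc i)" and ?r = "transpose j (Suc j)"
  have p1: "?s \<circ> \<sigma> permutes {1..n}" by (rule permutes_compose[OF s permutes_transpose_Suc[OF i(1)]])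
  have p2: "?r \<circ> (?s \<circ> \<sigma>) permutes {1..n}" by (rule permutes_compose[OF p1 permutes_transpose_Suc[OF i(2)]])
  obtain w where w: "reduced_word n (?r \<circ> (?s \<circ> \<sigma>)) w" using reduced_word_exists[OF p2] by blast
  have "left_descent (?s \<circ> \<sigma>) j"
    using d ij unfolding left_descent_def inv_transpose_comp[OF s] by (auto simp: transpose_def)
  then have r: "reduced_word n \<sigma> (i # j # w)"
    using s i d w p1 by (simp add: reduced_word_Cons_iff)
  moreover have "?s \<circ> (?r \<circ> word_perm w) = ?r \<circ> (?s \<circ> word_perm w)"
    using ij by (auto simp: fun_eq_iff transpose_def)
  ultimately have "reduced_word n \<sigma> (j # i # w)" by (auto simp: reduced_word_def word_perm_simps)
  with r show ?thesis by blast
qed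

text \<open>Matsumoto's theorem. Two reduced words starting with \<open>i \<noteq> j\<close> are joined through a reduced
  word starting with the long word of the parabolic subgroup of \<open>i\<close> and \<open>j\<close>.\<close>

lemma reduced_word_unique_action:
  assumes closed: "\<And>i c. i \<in> {1..<n} \<Longrightarrow> c \<in> S \<Longrightarrow> M i c \<in> S"
    and braid: "\<And>i c. i \<in> {1..<n} \<Longrightarrow> Suc i \<in> {1..<n} \<Longrightarrow> c \<in> S \<Longrightarrow>
      M i (M (Suc i) (M i c)) = M (Suc i) (M i (M (Suc i) c))"
    and commute: "\<And>i j c. i \<in> {1..<n} \<Longrightarrow> j \<in> {1..<n} \<Longrightarrow> \<bar>int i - int j\<bar> > 1 \<Longrightarrow> c \<in> S \<Longrightarrow>
      M i (M j c) = M j (M i c)"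
    and "reduced_word n \<sigma> u" "reduced_word n \<sigma> v" and c: "c \<in> S"
  shows "foldr M u c = foldr M v c"
  using assms(4,5)
proof (induction u arbitrary: \<sigma> v rule: length_induct)
  case (1 u)
  have len: "length u = length v" using 1(2,3) by (simp add: reduced_word_def)
  have S: "foldr M w c \<in> S" if "set w \<subseteq> {1..<n}" for w
    using that c closed by (induction w) auto
  have tail: "reduced_word n (transpose a (Suc a) \<circ> \<sigma>) w" if "reduced_word n \<sigma> (a # w)" for a w
    using that by (simp only: reduced_word_Cons_iff)
  show ?case
  proof (cases u)
    case Nil then show ?thesis using len by simp
  next
    case (Cons i u')
    then obtain j v' where v: "v = j # v'" using len by (cases v) auto
    have IH: "foldr M u' c = foldr M w c"
      if "reduced_word n (transpose i (Suc i) \<circ> \<sigma>) w" for w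
      using 1(1)[rule_format, of u'] 1(2) that by (auto simp: Cons reduced_word_Cons_iff)
    \<comment> \<open>The induction runs over the length and not over the structure of
      \<open>u\<close>, because it is applied to the tail of \<open>v\<close> as well.\<close>
    have IH': "foldr M v' c = foldr M w c"
      if "reduced_word n (transpose j (Suc j) \<circ> \<sigma>) w" for w
      using 1(1)[rule_format, of v'] 1(3) that len by (auto simp: Cons v reduced_word_Cons_iff)
    note r = 1(2,3)[unfolded Cons v reduced_word_Cons_iff]
    consider "i = j" | "\<bar>int i - int j\<bar> > 1" | "j = Suc i" | "i = Suc j" by linarith
    then show ?thesis
    proof cases
      case 1
      then show ?thesis using IH[of v'] r by (simp add: Cons v)
    next
      case 2
      then obtain w where w: "reduced_word n \<sigma> (i # j # w)" "reduced_word n \<sigma> (j # i # w)"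
        using reduced_word_commute[of \<sigma> n i j] r by blast
      have "foldr M u' c = foldr M (j # w) c" by (rule IH[OF tail[OF w(1)]])
      moreover have "foldr M v' c = foldr M (i # w) c" by (rule IH'[OF tail[OF w(2)]])
      moreover have "foldr M w c \<in> S" using w(1) by (intro S) (auto simp: reduced_word_def)
      ultimately show ?thesis using commute[of i j "foldr M w c"] 2 r by (simp add: Cons v)
    next
      case 3
      then obtain w where w: "reduced_word n \<sigma> (i # j # i # w)" "reduced_word n \<sigma> (j # i # j # w)"
        using reduced_word_braid[of \<sigma> n i] r by blast
      have "foldr M u' c = foldr M (j # i # w) c" by (rule IH[OF tail[OF w(1)]])
      moreover have "foldr M v' c = foldr M (i # j # w) c" by (rule IH'[OF tail[OF w(2)]])
      moreover have "foldr M w c \<in> S" using w(1) by (intro S) (auto simp: reduced_word_def)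
      ultimately show ?thesis using braid[of i "foldr M w c"] 3 r by (simp add: Cons v)
    next
      case 4
      then obtain w where w: "reduced_word n \<sigma> (i # j # i # w)" "reduced_word n \<sigma> (j # i # j # w)"
        using reduced_word_braid[of \<sigma> n j] r by blast
      have "foldr M u' c = foldr M (j # i # w) c" by (rule IH[OF tail[OF w(1)]])
      moreover have "foldr M v' c = foldr M (i # j # w) c" by (rule IH'[OF tail[OF w(2)]])
      moreover have "foldr M w c \<in> S" using w(1) by (intro S) (auto simp: reduced_word_def)
      ultimately show ?thesis using braid[of j "foldr M w c"] 4 r by (simp add: Cons v)
    qed
  qed
qed

section \<open>The symmetrizer of the Hecke algebra\<close>

text \<open>The sum is grouped into pairs \<sigma>, \<open>s_i \<sigma>\<close> with \<sigma> the
  shorter one. The weights are in the ratio t to 1, and \<open>T_i\<close> maps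
  \<open>t T_\<sigma> + T_(s_i \<sigma>)\<close> to
  \<open>t T_(s_i \<sigma>) + (1 - t) T_(s_i \<sigma>) + t T_\<sigma>\<close>, which is the same
  element.\<close>

lemma symmetrizer_invariant:
  fixes M :: "nat \<Rightarrow> ('x \<Rightarrow> 'k::field) \<Rightarrow> 'x \<Rightarrow> 'k"
  assumes closed: "\<And>i c. i \<in> {1..<n} \<Longrightarrow> c \<in> S \<Longrightarrow> M i c \<in> S"
    and braid: "\<And>i c. i \<in> {1..<n} \<Longrightarrow> Suc i \<in> {1..<n} \<Longrightarrow> c \<in> S \<Longrightarrow>
      M i (M (Suc i) (M i c)) = M (Suc i) (M i (M (Suc i) c))"
    and commute: "\<And>i j c. i \<in> {1..<n} \<Longrightarrow> j \<in> {1..<n} \<Longrightarrow> \<bar>int i - int j\<bar> > 1 \<Longrightarrow> c \<in> S \<Longrightarrow>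
      M i (M j c) = M j (M i c)"
    and quadratic: "\<And>i c x. i \<in> {1..<n} \<Longrightarrow> c \<in> S \<Longrightarrow> M i (M i c) x = (1 - t) * M i c x + t * c x"
    and linear: "\<And>(I :: (nat \<Rightarrow> nat) set) k f i x. i \<in> {1..<n} \<Longrightarrow> finite I \<Longrightarrow>
      M i (\<lambda>x. \<Sum>a\<in>I. k a * f a x) x = (\<Sum>a\<in>I. k a * M i (f a) x)"
    and rw: "\<And>\<sigma>. \<sigma> permutes {1..n} \<Longrightarrow> reduced_word n \<sigma> (rw \<sigma>)"
    and c: "c \<in> S" and i: "i \<in> {1..<n}"
  defines "E \<equiv> \<lambda>x. \<Sum>\<sigma> | \<sigma> permutes {1..n}. t ^ ((n choose 2) - perm_length n \<sigma>) * foldr M (rw \<sigma>) c x"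
  shows "M i E x = E x"
proof -
  define P U G s k where "P = {\<sigma>. \<sigma> permutes {1..n}}" and "U = {\<sigma> \<in> P. \<not> left_descent \<sigma> i}"
    and "G = (\<lambda>\<sigma>. foldr M (rw \<sigma>) c)" and "s = (\<lambda>\<sigma>. transpose i (Suc i) \<circ> \<sigma> :: nat \<Rightarrow> nat)"
    and "k = (\<lambda>\<sigma>. t ^ ((n choose 2) - perm_length n \<sigma>))"
  have finP: "finite P" unfolding P_def by (rule finite_permutations) simp
  have sP: "s \<sigma> \<in> P" if "\<sigma> \<in> P" for \<sigma>
    using that permutes_compose[OF _ permutes_transpose_Suc[OF i]] by (simp add: P_def s_def)
  have ss: "s (s \<sigma>) = \<sigma>" for \<sigma> by (simp add: s_def transpose_comp_transpose_comp)
  have sd: "left_descent (s \<sigma>) i \<longleftrightarrow> \<not> left_descent \<sigma> i" if "\<sigma> \<in> P" for \<sigma>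
    using that left_descent_transpose_comp by (simp add: P_def s_def)
  have split: "(\<Sum>\<sigma>\<in>P. h \<sigma>) = (\<Sum>\<sigma>\<in>U. h \<sigma> + h (s \<sigma>))" for h :: "_ \<Rightarrow> 'k"
  proof -
    have "(\<Sum>\<sigma>\<in>P. h \<sigma>) = (\<Sum>\<sigma>\<in>U. h \<sigma>) + (\<Sum>\<sigma>\<in>P - U. h \<sigma>)"
      using finP by (subst sum.subset_diff[of U P]) (auto simp: U_def)
    also have "(\<Sum>\<sigma>\<in>P - U. h \<sigma>) = (\<Sum>\<sigma>\<in>U. h (s \<sigma>))"
      by (rule sum.reindex_bij_witness[of _ s s]) (use sP sd ss in \<open>auto simp: U_def\<close>)
    finally show ?thesis by (simp add: sum.distrib)
  qed
  have GS: "G \<sigma> \<in> S" if "\<sigma> \<in> P" for \<sigma>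
  proof -
    have "foldr M w c \<in> S" if "set w \<subseteq> {1..<n}" for w
      using that c closed by (induction w) auto
    then show ?thesis using rw[of \<sigma>] that by (auto simp: P_def G_def reduced_word_def)
  qed
  have MG: "M i (G \<sigma>) = G (s \<sigma>)" if "\<sigma> \<in> U" for \<sigma>
  proof -
    have p: "\<sigma> permutes {1..n}" "s \<sigma> permutes {1..n}" using that sP by (auto simp: U_def P_def)
    have "reduced_word n (s \<sigma>) (i # rw \<sigma>)"
      using rw[OF p(1)] p i sd[of \<sigma>] ss that
      by (simp add: reduced_word_Cons_iff s_def[symmetric]) (simp add: s_def U_def P_def transpose_comp_transpose_comp)
    then have "foldr M (i # rw \<sigma>) c = foldr M (rw (s \<sigma>)) c"
      by (intro reduced_word_unique_action[where M = M and S = S and n = n, OF closed braid commute _ rw[OF p(2)] c])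
    then show ?thesis by (simp add: G_def)
  qed
  \<comment> \<open>The bound \<open>perm_length_le\<close> ensures that the natural subtraction in
    the exponent is not truncated.\<close>
  have ks: "k \<sigma> = t * k (s \<sigma>)" if "\<sigma> \<in> U" for \<sigma>
  proof -
    have "perm_length n (s \<sigma>) = Suc (perm_length n \<sigma>)"
      using that perm_length_up[OF _ i, of \<sigma>] by (simp add: U_def P_def s_def)
    with perm_length_le[of n "s \<sigma>"]
    have "(n choose 2) - perm_length n \<sigma> = Suc ((n choose 2) - perm_length n (s \<sigma>))" by linarith
    then show ?thesis by (simp add: k_def)
  qed
  have E: "E = (\<lambda>x. \<Sum>\<sigma>\<in>P. k \<sigma> * G \<sigma> x)" by (simp add: E_def P_def k_def G_def)
  have "M i E x = (\<Sum>\<sigma>\<in>P. k \<sigma> * M i (G \<sigma>) x)" unfolding E by (rule linear[OF i finP])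
  also have "\<dots> = (\<Sum>\<sigma>\<in>U. k \<sigma> * M i (G \<sigma>) x + k (s \<sigma>) * M i (G (s \<sigma>)) x)" by (rule split)
  also have "\<dots> = (\<Sum>\<sigma>\<in>U. k \<sigma> * G \<sigma> x + k (s \<sigma>) * G (s \<sigma>) x)"
  proof (rule sum.cong[OF refl])
    fix \<sigma> assume U: "\<sigma> \<in> U"
    have "M i (G (s \<sigma>)) x = (1 - t) * G (s \<sigma>) x + t * G \<sigma> x"
      using quadratic[OF i GS, of \<sigma> x] U by (simp add: MG[OF U] U_def)
    then show "k \<sigma> * M i (G \<sigma>) x + k (s \<sigma>) * M i (G (s \<sigma>)) x = k \<sigma> * G \<sigma> x + k (s \<sigma>) * G (s \<sigma>) x"
      unfolding MG[OF U] ks[OF U] by (simp only:) (simp add: algebra_simps)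
  qed
  also have "\<dots> = E x" unfolding E by (rule split[symmetric])
  finally show ?thesis .
qed

section \<open>The ground field\<close>

lemma tt_power: "tt ^ k = Fract (monom 1 k) 1"
  by (induction k) (simp_all add: tt_def One_fract_def mult_monom monom_0 monom_Suc pCons_one)

lemma qq_power: "qq ^ k = Fract [:monom 1 k:] 1"
  by (induction k) (simp_all add: qq_def One_fract_def monom_0 monom_Suc pCons_one)

lemma qq_tt_power_inject:
  assumes "qq ^ a * tt ^ k = qq ^ b * tt ^ l"
  shows "a = b \<and> k = l"
proof -
  have "smult (monom 1 a) (monom 1 k) = smult (monom (1::rat) b) (monom 1 l)"
    using assms by (simp add: tt_power qq_power eq_fract)
  then have "monom (monom (1::rat) a) k = monom (monom 1 b) l"
    by (simp add: smult_monom)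
  then show ?thesis by (auto simp: monom_eq_iff')
qed

text \<open>A large power of \<open>tt\<close> clears the negative exponents and reduces the claim
  to monomials. Thus an eigenvalue \<open>q^w t^c\<close> remembers both the weight and the
  content.\<close>

lemma qq_tt_powi_inject:
  "qq ^ a * tt powi c = qq ^ b * tt powi d \<longleftrightarrow> a = b \<and> c = d"
proof
  assume eq: "qq ^ a * tt powi c = qq ^ b * tt powi d"
  define N where "N = nat \<bar>c\<bar> + nat \<bar>d\<bar>"
  have shift: "tt powi e * tt ^ N = tt ^ nat (e + int N)" if "e + int N \<ge> 0" for e
    using that by (simp add: power_int_add[OF disjI1[OF tt_nonzero], symmetric] flip: power_int_of_nat)
  have nn: "c + int N \<ge> 0" "d + int N \<ge> 0" by (simp_all add: N_def)
  have "qq ^ a * (tt powi c * tt ^ N) = qq ^ b * (tt powi d * tt ^ N)"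
    using eq by (simp add: mult.assoc[symmetric])
  then have "a = b \<and> nat (c + int N) = nat (d + int N)"
    unfolding shift[OF nn(1)] shift[OF nn(2)] by (rule qq_tt_power_inject)
  then show "a = b \<and> c = d" using nn by linarith
qed simp

text \<open>The numerator specializes to \<open>card A\<close> at \<open>t = 1\<close>.\<close>

lemma sum_tt_power_nonzero:
  assumes "finite A" "A \<noteq> {}"
  shows "(\<Sum>x\<in>A. tt ^ k x) \<noteq> 0"
proof
  have "(\<Sum>x\<in>A. tt ^ k x) = Fract (\<Sum>x\<in>A. monom 1 (k x)) 1"
    using assms(1) by (induction A rule: finite_induct) (simp_all add: tt_power Zero_fract_def)
  moreover assume "(\<Sum>x\<in>A. tt ^ k x) = 0"
  ultimately have "(\<Sum>x\<in>A. monom 1 (k x)) = (0 :: rat poly poly)"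
    by (simp add: Zero_fract_def eq_fract)
  then have "poly (\<Sum>x\<in>A. monom 1 (k x)) 1 = (0 :: rat poly)" by simp
  then show False using assms by (simp add: poly_sum poly_monom)
qed

lemma t_factorial_nonzero: "t_factorial n \<noteq> 0"
proof -
  have "tt ^ i \<noteq> 1" if "i \<ge> 1" for i
    using qq_tt_power_inject[of 0 i 0 0] that by auto
  \<comment> \<open>The instance \<open>i = 1\<close> concerns the denominators: were
    \<open>1 - tt\<close> zero, division would return 0.\<close>
  from this this[of 1] show ?thesis by (simp add: t_factorial_def)
qed

section \<open>Modules over presented algebras\<close>

lemma scalar_add: "scalar (c + d) = scalar c + scalar d"
  by (simp add: scalar_def single_add)

lemma scalar_mult: "scalar (c * d) = scalar c * scalar d"
  by (simp add: scalar_def mult_single)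

lemma scalar_one: "scalar 1 = 1"
  by (simp add: scalar_def)

lemma scalar_zero: "scalar 0 = 0"
  by (simp add: scalar_def)

text \<open>Vectors are acted on by representatives in the free algebra instead of cosets, so that
  calculations take place in the ring type of \<open>falg\<close>; the relations enter through
  \<open>act_relator\<close>.\<close>

locale presented_module =
  fixes P :: "'g presentation" and M :: "('g falg set, 'm) module" (structure)
  assumes relators_closed: "snd P \<subseteq> carrier (free_alg (fst P))"
    and left_module: "left_module (alg P) M"
begin

sublocale left_module "alg P" M by (rule left_module)

definition act :: "'g falg \<Rightarrow> 'm \<Rightarrow> 'm" where
  "act f x = cls P f \<odot> x"

abbreviation words :: "'g falg set" where
  "words \<equiv> carrier (free_alg (fst P))"

lemma kscale_eq: "kscale P M c x = act (scalar c) x"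
  by (simp add: kscale_def act_def)

lemma cls_hom: "cls P \<in> ring_hom (free_alg (fst P)) (alg P)"
proof -
  interpret F: ring "free_alg (fst P)" by (rule ring_free_alg)
  interpret ideal "rel_ideal P" "free_alg (fst P)"
    unfolding rel_ideal_def by (rule F.genideal_ideal[OF relators_closed])
  show ?thesis using rcos_ring_hom by (simp add: alg_def cls_def[abs_def])
qed

lemma act_closed [simp, intro]: "f \<in> words \<Longrightarrow> x \<in> carrier M \<Longrightarrow> act f x \<in> carrier M"
  unfolding act_def by (rule smult_closed[OF cls_closed[OF relators_closed]])

lemma act_scalar_closed [simp, intro]: "x \<in> carrier M \<Longrightarrow> act (scalar c) x \<in> carrier M"
  by (rule act_closed[OF free_alg_closed(3)])

lemma act_add_left:
  assumes "f \<in> words" "g \<in> words" "x \<in> carrier M"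
  shows "act (f + g) x = act f x \<oplus> act g x"
  using assms ring_hom_add[OF cls_hom assms(1,2)]
  by (simp add: act_def free_alg_simps smult_l_distr cls_closed[OF relators_closed])

lemma act_mult:
  assumes "f \<in> words" "g \<in> words" "x \<in> carrier M"
  shows "act (f * g) x = act f (act g x)"
  using assms ring_hom_mult[OF cls_hom assms(1,2)]
  by (simp add: act_def free_alg_simps smult_assoc cls_closed[OF relators_closed])

lemma act_one: "x \<in> carrier M \<Longrightarrow> act 1 x = x"
  using ring_hom_one[OF cls_hom] by (simp add: act_def free_alg_simps smult_one)

lemma act_add_right:
  "f \<in> words \<Longrightarrow> x \<in> carrier M \<Longrightarrow> y \<in> carrier M \<Longrightarrow> act f (x \<oplus> y) = act f x \<oplus> act f y"
  by (simp add: act_def smult_r_distr cls_closed[OF relators_closed])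

lemma act_zero_right: "f \<in> words \<Longrightarrow> act f \<zero> = \<zero>"
  using act_add_right[of f \<zero> \<zero>] by (simp add: M.add.r_cancel_one')

lemma act_zero_left: "x \<in> carrier M \<Longrightarrow> act 0 x = \<zero>"
  using act_add_left[of 0 0 x] by (simp add: M.add.r_cancel_one' free_alg_closed)

lemma act_relator:
  assumes "f - g \<in> snd P" "g \<in> words" "x \<in> carrier M"
  shows "act f x = act g x"
proof -
  have r: "f - g \<in> words" using assms(1) relators_closed by blast
  have z: "act (f - g) x = \<zero>"
    using act_zero_left[OF assms(3)] rel_imp_cls_zero[OF relators_closed assms(1)]
      ring_hom_zero[OF cls_hom ring_free_alg R.ring_axioms]
    by (simp add: act_def free_alg_simps)
  show ?thesis
    using act_add_left[OF r assms(2,3)] z assms(2,3) by simp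
qed

lemma act_scalar_mult:
  assumes "x \<in> carrier M"
  shows "act (scalar c) (act (scalar d) x) = act (scalar (c * d)) x"
  using assms by (simp add: scalar_mult act_mult free_alg_closed)

lemma act_scalar_commute:
  assumes "f \<in> words" "x \<in> carrier M"
  shows "act f (act (scalar c) x) = act (scalar c) (act f x)"
  using assms scalar_central[of c f] by (simp add: act_mult[symmetric] free_alg_closed)

lemma act_scalar_add:
  "x \<in> carrier M \<Longrightarrow> act (scalar (c + d)) x = act (scalar c) x \<oplus> act (scalar d) x"
  by (simp add: scalar_add act_add_left free_alg_closed)

section \<open>Linear combinations and uniqueness of coordinates\<close>

abbreviation lc :: "('i \<Rightarrow> 'm) \<Rightarrow> ('i \<Rightarrow> ratqt) \<Rightarrow> 'i set \<Rightarrow> 'm" where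
  "lc \<equiv> lincomb P M"

lemma lincomb_empty [simp]: "lc x c {} = \<zero>"
  by (simp add: lincomb_def)

lemma lincomb_closed [intro]: "x \<in> J \<rightarrow> carrier M \<Longrightarrow> lc x c J \<in> carrier M"
  unfolding lincomb_def kscale_eq by (intro M.finsum_closed) auto

lemma lincomb_insert:
  assumes "finite J" "j \<notin> J" "x \<in> insert j J \<rightarrow> carrier M"
  shows "lc x c (insert j J) = act (scalar (c j)) (x j) \<oplus> lc x c J"
  using assms unfolding lincomb_def kscale_eq by (intro M.finsum_insert) auto

lemma lincomb_add:
  assumes "finite J" "x \<in> J \<rightarrow> carrier M"
  shows "lc x (\<lambda>i. c i + d i) J = lc x c J \<oplus> lc x d J"
proof -
  have "lc x (\<lambda>i. c i + d i) J = (\<Oplus>i\<in>J. act (scalar (c i)) (x i) \<oplus> act (scalar (d i)) (x i))"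
    unfolding lincomb_def kscale_eq
    using assms by (intro M.finsum_cong' refl) (auto simp: act_scalar_add Pi_iff)
  also have "\<dots> = lc x c J \<oplus> lc x d J"
    unfolding lincomb_def kscale_eq using assms by (intro M.finsum_addf) auto
  finally show ?thesis .
qed

lemma lincomb_cong:
  assumes "\<And>i. i \<in> J \<Longrightarrow> c i = d i" "x \<in> J \<rightarrow> carrier M"
  shows "lc x c J = lc x d J"
  unfolding lincomb_def kscale_eq using assms by (intro M.finsum_cong' refl) auto

lemma lincomb_mono_neutral:
  assumes "finite J" "K \<subseteq> J" "\<And>i. i \<in> J - K \<Longrightarrow> c i = 0" "x \<in> J \<rightarrow> carrier M"
  shows "lc x c K = lc x c J"
  unfolding lincomb_def kscale_eq
  using assms
  by (intro M.add.finprod_mono_neutral_cong_left) (auto simp: scalar_zero act_zero_left Pi_iff)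

lemma lincomb_single:
  assumes "finite J" "j \<in> J" "x \<in> J \<rightarrow> carrier M"
  shows "lc x (\<lambda>i. if i = j then k else 0) J = act (scalar k) (x j)"
proof -
  have "lc x (\<lambda>i. if i = j then k else 0) {j} = lc x (\<lambda>i. if i = j then k else 0) J"
    using assms by (intro lincomb_mono_neutral) auto
  then show ?thesis using assms(2,3) lincomb_insert[of "{}" j x] by (simp add: Pi_iff)
qed

lemma act_lincomb:
  assumes "finite J" "x \<in> J \<rightarrow> carrier M" and f: "f \<in> words"
    and m: "\<And>j. j \<in> J \<Longrightarrow> act f (x j) = lc x (m j) J"
  shows "act f (lc x c J) = lc x (\<lambda>i. \<Sum>j\<in>J. c j * m j i) J"
proof -
  have sm: "act (scalar k) (lc x d J) = lc x (\<lambda>i. k * d i) J" for k d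
    using assms(1,2)
  proof (induction J rule: finite_induct)
    case empty then show ?case by (simp add: act_zero_right free_alg_closed)
  next
    case (insert j J)
    then show ?case
      by (simp add: lincomb_insert act_add_right free_alg_closed act_scalar_mult lincomb_closed Pi_iff)
  qed
  \<comment> \<open>Only the support \<open>K\<close> of the vector grows in the induction; the
    index set \<open>J\<close> of the matrix stays fixed.\<close>
  have "act f (lc x c K) = lc x (\<lambda>i. \<Sum>j\<in>K. c j * m j i) J" if "finite K" "K \<subseteq> J" for K
    using that
  proof (induction K rule: finite_induct)
    case empty
    have "lc x (\<lambda>i. 0) J = lc x (\<lambda>i. 0) {}"
      using assms by (intro lincomb_mono_neutral[symmetric]) auto
    then show ?case using f by (simp add: act_zero_right)
  next
    case (insert j K)
    then have x: "x j \<in> carrier M" "x \<in> K \<rightarrow> carrier M" "x \<in> insert j K \<rightarrow> carrier M" "j \<in> J"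
      using assms(2) by auto
    have "act f (lc x c (insert j K)) = act (scalar (c j)) (act f (x j)) \<oplus> act f (lc x c K)"
      using insert x f
      by (simp add: lincomb_insert act_add_right act_scalar_commute lincomb_closed)
    also have "\<dots> = lc x (\<lambda>i. c j * m j i) J \<oplus> lc x (\<lambda>i. \<Sum>j\<in>K. c j * m j i) J"
      using insert x by (simp add: m sm)
    also have "\<dots> = lc x (\<lambda>i. c j * m j i + (\<Sum>j\<in>K. c j * m j i)) J"
      using assms(1,2) by (rule lincomb_add[symmetric])
    finally show ?case using insert by simp
  qed
  from this[OF assms(1) subset_refl] show ?thesis .
qed

lemma act_eigenvectors_lincomb:
  assumes "finite J" "x \<in> J \<rightarrow> carrier M" "f \<in> words"
    and ev: "\<And>j. j \<in> J \<Longrightarrow> act f (x j) = act (scalar (e j)) (x j)"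
  shows "act f (lc x c J) = lc x (\<lambda>i. e i * c i) J"
proof -
  have "act f (lc x c J) = lc x (\<lambda>i. \<Sum>j\<in>J. c j * (if i = j then e j else 0)) J"
    by (rule act_lincomb[OF assms(1-3)]) (simp add: lincomb_single[OF assms(1) _ assms(2)] ev)
  also have "\<dots> = lc x (\<lambda>i. e i * c i) J"
  proof (rule lincomb_cong[OF _ assms(2)])
    fix i assume "i \<in> J"
    have "(\<Sum>j\<in>J. c j * (if i = j then e j else 0)) = (\<Sum>j\<in>J. if i = j then e j * c j else 0)"
      by (rule sum.cong) auto
    then show "(\<Sum>j\<in>J. c j * (if i = j then e j else 0)) = e i * c i"
      using \<open>i \<in> J\<close> assms(1) by simp
  qed
  finally show ?thesis .
qed

lemma act_scalar_lincomb:
  assumes "finite J" "x \<in> J \<rightarrow> carrier M"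
  shows "act (scalar k) (lc x c J) = lc x (\<lambda>i. k * c i) J"
  using assms by (intro act_eigenvectors_lincomb) (auto simp: free_alg_closed)

lemma kbasis_exists:
  assumes "kbasis P M x I" "v \<in> carrier M"
  obtains J c where "finite J" "J \<subseteq> I" "v = lc x c J"
proof -
  have "\<exists>!c. finite {i. c i \<noteq> 0} \<and> {i. c i \<noteq> 0} \<subseteq> I \<and> v = lc x c {i. c i \<noteq> 0}"
    by (rule bspec[OF conjunct2[OF assms(1)[unfolded kbasis_def]] assms(2)])
  then show ?thesis by (elim ex1E conjE) (rule that)
qed

text \<open>Uniqueness in \<open>kbasis\<close> is stated for coefficient functions summed over
  their exact supports. Both functions are therefore set to zero outside \<open>J\<close> and then
  summed over their supports.\<close>

lemma kbasis_unique:
  assumes kb: "kbasis P M x I" and J: "finite J" "J \<subseteq> I" and eq: "lc x c J = lc x d J" and i: "i \<in> J"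
  shows "c i = d i"
proof -
  have x: "x \<in> J \<rightarrow> carrier M" using kb J by (auto simp: kbasis_def)
  define r where "r c i = (if i \<in> J then c i else 0)" for c :: "_ \<Rightarrow> ratqt" and i
  define Q where "Q e \<longleftrightarrow> finite {i. e i \<noteq> 0} \<and> {i. e i \<noteq> 0} \<subseteq> I \<and> lc x c J = lc x e {i. e i \<noteq> 0}" for e
  have r: "finite {i. r e i \<noteq> 0}" "{i. r e i \<noteq> 0} \<subseteq> I" "lc x e J = lc x (r e) {i. r e i \<noteq> 0}" for e
  proof -
    have sub: "{i. r e i \<noteq> 0} \<subseteq> J" by (auto simp: r_def)
    show "finite {i. r e i \<noteq> 0}" by (rule finite_subset[OF sub J(1)])
    show "{i. r e i \<noteq> 0} \<subseteq> I" by (rule order_trans[OF sub J(2)])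
    have "lc x e J = lc x (r e) J" by (rule lincomb_cong[OF _ x]) (simp add: r_def)
    also have "\<dots> = lc x (r e) {i. r e i \<noteq> 0}"
      by (rule lincomb_mono_neutral[OF J(1) sub _ x, symmetric]) simp
    finally show "lc x e J = lc x (r e) {i. r e i \<noteq> 0}" .
  qed
  have ex1: "\<exists>!e. Q e" unfolding Q_def
    by (rule bspec[OF conjunct2[OF kb[unfolded kbasis_def]] lincomb_closed[OF x]])
  have Q: "Q (r c)" "Q (r d)" unfolding Q_def by (intro conjI r) (unfold eq, intro conjI r)
  have "r c = r d"
    using the1_equality[where P = Q, OF ex1 Q(1)] the1_equality[where P = Q, OF ex1 Q(2)] by (rule trans[OF sym])
  then have "r c i = r d i" by (rule fun_cong)
  then show ?thesis using i by (simp add: r_def)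
qed

end

section \<open>Labellings of a diagram\<close>

lemma label_less_iff: "label_less p r \<longleftrightarrow> snd p > snd r \<or> (snd p = snd r \<and> fst p < fst r)"
  by (cases p; cases r) simp

lemma label_less_trans: "label_less p r \<Longrightarrow> label_less r s \<Longrightarrow> label_less p s"
  by (auto simp: label_less_iff)

lemma label_less_irrefl: "\<not> label_less p p"
  by (simp add: label_less_iff)

lemma box_content_eq: "box_content x = int (fst x) - int (snd x)"
  by (cases x) simp

lemma box_before_iff:
  "box_before T x y \<longleftrightarrow>
    T x > T y \<or> (T x = T y \<and> (fst x < fst y \<or> (fst x = fst y \<and> snd x < snd y)))"
  by (cases x; cases y) simp

lemma box_before_irrefl: "\<not> box_before T x x"
  by (simp add: box_before_iff)

lemma box_before_linear: "x \<noteq> y \<Longrightarrow> box_before T x y \<longleftrightarrow> \<not> box_before T y x"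
  by (auto simp: box_before_iff prod_eq_iff)

lemma box_before_trans: "box_before T x y \<Longrightarrow> box_before T y z \<Longrightarrow> box_before T x z"
  by (auto simp: box_before_iff)

text \<open>The part of \<open>PSYT\<close> that every exchange of indices preserves. It gives
  \<open>box_of\<close>, \<open>wt\<close> and \<open>cont\<close> a meaning for
  \<open>s_i(\<tau>)\<close> even when this is not a tableau.\<close>

definition labelling :: "nat list \<Rightarrow> tableau \<Rightarrow> bool" where
  "labelling lam \<tau> \<longleftrightarrow> \<tau> \<in> diagram lam \<rightarrow>\<^sub>E ({1..sum_list lam} \<times> UNIV) \<and>
     (\<forall>j\<in>{1..sum_list lam}. \<exists>!x. x \<in> diagram lam \<and> fst (\<tau> x) = j)"

lemma PSYT_iff:
  "\<tau> \<in> PSYT lam \<longleftrightarrow> labelling lam \<tau> \<and>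
     (\<forall>x\<in>diagram lam. \<forall>y\<in>diagram lam. snd x = snd y \<and> fst x < fst y \<longrightarrow> label_less (\<tau> x) (\<tau> y)) \<and>
     (\<forall>x\<in>diagram lam. \<forall>y\<in>diagram lam. fst x = fst y \<and> snd x < snd y \<longrightarrow> label_less (\<tau> x) (\<tau> y))"
  unfolding PSYT_def labelling_def by (auto simp del: label_less.simps)

lemma
  assumes "labelling lam \<tau>" "j \<in> {1..sum_list lam}"
  shows box_of_in: "box_of lam \<tau> j \<in> diagram lam"
    and fst_box_of: "fst (\<tau> (box_of lam \<tau> j)) = j"
proof -
  have "\<exists>!x. x \<in> diagram lam \<and> fst (\<tau> x) = j" using assms by (simp add: labelling_def)
  from theI'[OF this] show "box_of lam \<tau> j \<in> diagram lam" "fst (\<tau> (box_of lam \<tau> j)) = j"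
    unfolding box_of_def by blast+
qed

lemma fst_label_in: "labelling lam \<tau> \<Longrightarrow> x \<in> diagram lam \<Longrightarrow> fst (\<tau> x) \<in> {1..sum_list lam}"
  by (auto simp: labelling_def PiE_iff mem_Times_iff)

lemma box_of_eqI:
  assumes "labelling lam \<tau>" "x \<in> diagram lam" "fst (\<tau> x) = j"
  shows "box_of lam \<tau> j = x"
proof -
  have "j \<in> {1..sum_list lam}" using fst_label_in[OF assms(1,2)] assms(3) by simp
  then have "\<exists>!x. x \<in> diagram lam \<and> fst (\<tau> x) = j" using assms(1) by (simp add: labelling_def)
  then show ?thesis unfolding box_of_def using assms(2,3) by (intro the1_equality) auto
qed

lemma label_box_of:
  assumes "labelling lam \<tau>" "j \<in> {1..sum_list lam}"
  shows "\<tau> (box_of lam \<tau> j) = (j, wt lam \<tau> j)"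
  using fst_box_of[OF assms] by (simp add: wt_def prod_eq_iff)

lemma box_of_eq_iff:
  assumes "labelling lam \<tau>" "j \<in> {1..sum_list lam}" "k \<in> {1..sum_list lam}"
  shows "box_of lam \<tau> j = box_of lam \<tau> k \<longleftrightarrow> j = k"
  using fst_box_of[OF assms(1)] assms(2,3) by metis

text \<open>A labelling that increases along diagonals is determined by the contents and the weights of
  its labels: the least label in different positions would have to precede itself.\<close>

lemma labelling_eqI:
  assumes l: "labelling lam \<tau>" "labelling lam \<tau>'"
    and d: "\<And>x y. x \<in> diagram lam \<Longrightarrow> y \<in> diagram lam \<Longrightarrow> box_content x = box_content y \<Longrightarrow>
      fst x < fst y \<Longrightarrow> label_less (\<tau> x) (\<tau> y)"
    and d': "\<And>x y. x \<in> diagram lam \<Longrightarrow> y \<in> diagram lam \<Longrightarrow> box_content x = box_content y \<Longrightarrow>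
      fst x < fst y \<Longrightarrow> label_less (\<tau>' x) (\<tau>' y)"
    and wt: "\<And>j. j \<in> {1..sum_list lam} \<Longrightarrow> wt lam \<tau> j = wt lam \<tau>' j"
    and cont: "\<And>j. j \<in> {1..sum_list lam} \<Longrightarrow> cont lam \<tau> j = cont lam \<tau>' j"
  shows "\<tau> = \<tau>'"
proof -
  let ?n = "sum_list lam"
  \<comment> \<open>The rank of the label with index \<open>j\<close>. It is computed from the
    weights alone, hence is common to both labellings.\<close>
  define m where "m j = card {k \<in> {1..?n}. label_less (k, wt lam \<tau> k) (j, wt lam \<tau> j)}" for j
  have m: "m j < m k" if "j \<in> {1..?n}" "label_less (j, wt lam \<tau> j) (k, wt lam \<tau> k)" for j k
    unfolding m_def
  proof (rule psubset_card_mono)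
    have "{i \<in> {1..?n}. label_less (i, wt lam \<tau> i) (j, wt lam \<tau> j)} \<subseteq>
        {i \<in> {1..?n}. label_less (i, wt lam \<tau> i) (k, wt lam \<tau> k)}"
      using label_less_trans[OF _ that(2)] by (auto simp del: label_less.simps)
    moreover have "j \<in> {i \<in> {1..?n}. label_less (i, wt lam \<tau> i) (k, wt lam \<tau> k)}"
      using that by (simp del: label_less.simps)
    moreover have "j \<notin> {i \<in> {1..?n}. label_less (i, wt lam \<tau> i) (j, wt lam \<tau> j)}"
      by (simp add: label_less_irrefl del: label_less.simps)
    ultimately show "{i \<in> {1..?n}. label_less (i, wt lam \<tau> i) (j, wt lam \<tau> j)} \<subset>
        {i \<in> {1..?n}. label_less (i, wt lam \<tau> i) (k, wt lam \<tau> k)}" by blast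
  qed simp
  \<comment> \<open>The two labellings play different roles here; the claim is applied twice with
    the roles exchanged. Let \<open>x\<close> hold \<open>j\<close> in \<open>\<tau>1\<close>. Its
    index \<open>k\<close> in \<open>\<tau>2\<close> has smaller rank, since \<open>x\<close>
    precedes the box of \<open>j\<close> on their diagonal. By induction \<open>x\<close> also holds
    \<open>k\<close> in \<open>\<tau>1\<close>, where it already holds \<open>j\<close>.\<close>
  have key: False
    if l: "labelling lam \<tau>1" "labelling lam \<tau>2"
      and d: "\<And>x y. x \<in> diagram lam \<Longrightarrow> y \<in> diagram lam \<Longrightarrow> box_content x = box_content y \<Longrightarrow>
        fst x < fst y \<Longrightarrow> label_less (\<tau>2 x) (\<tau>2 y)"
      and w: "\<And>j. j \<in> {1..?n} \<Longrightarrow> wt lam \<tau>1 j = wt lam \<tau> j" "\<And>j. j \<in> {1..?n} \<Longrightarrow> wt lam \<tau>2 j = wt lam \<tau> j"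
      and c: "cont lam \<tau>1 j = cont lam \<tau>2 j" and j: "j \<in> {1..?n}"
      and IH: "\<And>k. m k < m j \<Longrightarrow> k \<in> {1..?n} \<Longrightarrow> box_of lam \<tau>1 k = box_of lam \<tau>2 k"
      and lt: "fst (box_of lam \<tau>1 j) < fst (box_of lam \<tau>2 j)" for \<tau>1 \<tau>2 j
  proof -
    define x k where "x = box_of lam \<tau>1 j" and "k = fst (\<tau>2 x)"
    have x: "x \<in> diagram lam" using box_of_in[OF l(1) j] by (simp add: x_def)
    have k: "k \<in> {1..?n}" using fst_label_in[OF l(2) x] by (simp add: k_def)
    have bk: "box_of lam \<tau>2 k = x" using box_of_eqI[OF l(2) x] by (simp add: k_def)
    have "label_less (\<tau>2 x) (\<tau>2 (box_of lam \<tau>2 j))"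
      using d[OF x box_of_in[OF l(2) j]] c lt by (simp add: x_def cont_def)
    then have "label_less (k, wt lam \<tau> k) (j, wt lam \<tau> j)"
      using label_box_of[OF l(2) k] label_box_of[OF l(2) j] w(2) j k by (simp add: bk)
    then have "m k < m j" "k \<noteq> j" using m[OF k] label_less_irrefl by auto
    then show False using IH[OF _ k] bk box_of_eq_iff[OF l(1) k j] by (simp add: x_def)
  qed
  have eq: "box_of lam \<tau> j = box_of lam \<tau>' j" if "j \<in> {1..?n}" for j
    using that
  proof (induction "m j" arbitrary: j rule: less_induct)
    case less
    have "fst (box_of lam \<tau> j) = fst (box_of lam \<tau>' j)"
    proof (rule ccontr)
      assume "fst (box_of lam \<tau> j) \<noteq> fst (box_of lam \<tau>' j)"
      then consider "fst (box_of lam \<tau> j) < fst (box_of lam \<tau>' j)" | "fst (box_of lam \<tau>' j) < fst (box_of lam \<tau> j)"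
        by linarith
      then show False
      proof cases
        case 1
        show ?thesis by (rule key[of \<tau> \<tau>' j]) (use l d' wt cont less 1 in auto)
      next
        case 2
        show ?thesis by (rule key[of \<tau>' \<tau> j]) (use l d wt cont less 2 in auto)
      qed
    qed
    then show ?case using cont[OF less(2)] by (simp add: cont_def box_content_eq prod_eq_iff)
  qed
  show ?thesis
  proof (rule PiE_ext[of _ "diagram lam"])
    show "\<tau> \<in> diagram lam \<rightarrow>\<^sub>E {1..?n} \<times> UNIV" "\<tau>' \<in> diagram lam \<rightarrow>\<^sub>E {1..?n} \<times> UNIV"
      using l by (simp_all add: labelling_def)
    fix x assume x: "x \<in> diagram lam"
    define j where "j = fst (\<tau> x)"
    have j: "j \<in> {1..?n}" using fst_label_in[OF l(1) x] by (simp add: j_def)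
    have "box_of lam \<tau> j = x" using box_of_eqI[OF l(1) x] by (simp add: j_def)
    then show "\<tau> x = \<tau>' x"
      using label_box_of[OF l(1) j] label_box_of[OF l(2) j] wt[OF j] eq[OF j] by simp
  qed
qed

lemma s_act_apply:
  "x \<in> diagram lam \<Longrightarrow> s_act lam i \<tau> x = (transpose i (Suc i) (fst (\<tau> x)), snd (\<tau> x))"
  by (simp add: s_act_def)

lemma s_act_label_iff:
  "(x \<in> diagram lam \<and> fst (s_act lam i \<tau> x) = j) =
   (x \<in> diagram lam \<and> fst (\<tau> x) = transpose i (Suc i) j)"
  by (auto simp: s_act_apply)

lemma p_map_s_act: "p_map lam (s_act lam i \<tau>) = p_map lam \<tau>"
  by (auto simp: p_map_def s_act_def)

lemma transpose_Suc_in: "i \<in> {1..<n} \<Longrightarrow> j \<in> {1..n} \<Longrightarrow> transpose i (Suc i) j \<in> {1..n}"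
  by (auto simp: transpose_def)

lemma labelling_s_act:
  assumes l: "labelling lam \<tau>" and i: "i \<in> {1..<sum_list lam}"
  shows "labelling lam (s_act lam i \<tau>)"
  unfolding labelling_def
proof (intro conjI ballI)
  show "s_act lam i \<tau> \<in> diagram lam \<rightarrow>\<^sub>E {1..sum_list lam} \<times> UNIV"
    using transpose_Suc_in[OF i fst_label_in[OF l]] by (auto simp: s_act_def)
  fix j assume "j \<in> {1..sum_list lam}"
  from transpose_Suc_in[OF i this]
  have "\<exists>!x. x \<in> diagram lam \<and> fst (\<tau> x) = transpose i (Suc i) j" using l by (simp add: labelling_def)
  then show "\<exists>!x. x \<in> diagram lam \<and> fst (s_act lam i \<tau> x) = j"
    by (subst s_act_label_iff)
qed

lemma box_of_s_act:
  "box_of lam (s_act lam i \<tau>) j = box_of lam \<tau> (transpose i (Suc i) j)"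
  unfolding box_of_def by (subst s_act_label_iff) (rule refl)

lemma cont_s_act: "cont lam (s_act lam i \<tau>) j = cont lam \<tau> (transpose i (Suc i) j)"
  by (simp add: cont_def box_of_s_act)

lemma wt_s_act:
  assumes "labelling lam \<tau>" "i \<in> {1..<sum_list lam}" "j \<in> {1..sum_list lam}"
  shows "wt lam (s_act lam i \<tau>) j = wt lam \<tau> (transpose i (Suc i) j)"
  using box_of_in[OF assms(1) transpose_Suc_in[OF assms(2,3)]]
  by (simp add: wt_def box_of_s_act s_act_apply)

lemma s_act_s_act:
  assumes "labelling lam \<tau>"
  shows "s_act lam i (s_act lam i \<tau>) = \<tau>"
proof -
  have "\<tau> \<in> extensional (diagram lam)" using assms by (auto simp: labelling_def PiE_def)
  then show ?thesis
    by (intro extensionalityI[of _ "diagram lam"]) (simp_all add: s_act_def)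
qed

text \<open>Adjacent indices compare alike with every third index, and labels of different weight
  are compared by weight. Only the labels \<open>i\<close> and \<open>Suc i\<close> of equal weight
  can change their order.\<close>

lemma label_less_s_act:
  assumes l: "labelling lam \<tau>" and i: "i \<in> {1..<sum_list lam}"
    and uv: "u \<in> diagram lam" "v \<in> diagram lam" "label_less (\<tau> u) (\<tau> v)"
    and ne: "\<not> (u = box_of lam \<tau> i \<and> v = box_of lam \<tau> (Suc i) \<and> wt lam \<tau> i = wt lam \<tau> (Suc i))"
  shows "label_less (s_act lam i \<tau> u) (s_act lam i \<tau> v)"
proof (cases "snd (\<tau> u) = snd (\<tau> v)")
  case True
  with uv(3) have lt: "fst (\<tau> u) < fst (\<tau> v)" by (simp add: label_less_iff)
  have "\<not> (fst (\<tau> u) = i \<and> fst (\<tau> v) = Suc i)"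
  proof
    assume "fst (\<tau> u) = i \<and> fst (\<tau> v) = Suc i"
    then have "box_of lam \<tau> i = u" "box_of lam \<tau> (Suc i) = v"
      using box_of_eqI[OF l] uv by simp_all
    then show False using ne True by (simp add: wt_def)
  qed
  then have "{fst (\<tau> u), fst (\<tau> v)} \<noteq> {i, Suc i}" using lt by (auto simp: doubleton_eq_iff)
  then show ?thesis
    using transpose_Suc_less_iff[of "fst (\<tau> u)" "fst (\<tau> v)" i] lt True uv
    by (simp add: label_less_iff s_act_apply)
qed (use uv in \<open>auto simp: label_less_iff s_act_apply\<close>)

lemma s_act_in_PSYT:
  assumes \<tau>: "\<tau> \<in> PSYT lam" and i: "i \<in> {1..<sum_list lam}"
    and free: "wt lam \<tau> i \<noteq> wt lam \<tau> (Suc i) \<or>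
      (fst (box_of lam \<tau> i) \<noteq> fst (box_of lam \<tau> (Suc i)) \<and> snd (box_of lam \<tau> i) \<noteq> snd (box_of lam \<tau> (Suc i)))"
  shows "s_act lam i \<tau> \<in> PSYT lam"
proof -
  have l: "labelling lam \<tau>" using \<tau> by (simp add: PSYT_iff)
  have "label_less (s_act lam i \<tau> x) (s_act lam i \<tau> y)"
    if "x \<in> diagram lam" "y \<in> diagram lam" "label_less (\<tau> x) (\<tau> y)" "fst x = fst y \<or> snd x = snd y" for x y
    using that free by (intro label_less_s_act[OF l i]) auto
  then show ?thesis using \<tau> labelling_s_act[OF l i] unfolding PSYT_iff by blast
qed

section \<open>Tableaux over a fixed weight\<close>

text \<open>The conditions of the partial order for a step by \<open>s_i\<close>, without the demand
  that the result be a tableau; over a column-strict \<open>T\<close> that demand follows, by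
  \<open>up_iff\<close>.\<close>

definition up :: "nat list \<Rightarrow> tableau \<Rightarrow> nat \<Rightarrow> bool" where
  "up lam \<tau> i \<longleftrightarrow> wt lam \<tau> i < wt lam \<tau> (Suc i) \<or>
     (wt lam \<tau> i = wt lam \<tau> (Suc i) \<and> cont lam \<tau> i - cont lam \<tau> (Suc i) > 1)"

text \<open>An explicit candidate for \<open>Top\<close>: its indices follow the order of
  \<open>S(T)\<close>, so that it has no inversions.\<close>

definition Top_tab :: "nat list \<Rightarrow> (box \<Rightarrow> nat) \<Rightarrow> tableau" where
  "Top_tab lam T = (\<lambda>x\<in>diagram lam. (fst (S_tab lam T x), T x))"

lemma psyt_gen_cases:
  assumes "(\<tau>, \<tau>') \<in> psyt_gen lam"
  obtains (Psi) "\<tau> \<in> PSYT lam" "sum_list lam \<ge> 1" "\<tau>' = Psi lam \<tau>"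
  | (s) i where "\<tau> \<in> PSYT lam" "i \<in> {1..<sum_list lam}" "s_act lam i \<tau> \<in> PSYT lam" "up lam \<tau> i" "\<tau>' = s_act lam i \<tau>"
  using assms unfolding psyt_gen_def up_def by (elim UnE CollectE exE conjE) (simp_all add: prod_eq_iff)

lemma psyt_less_s_act:
  assumes "\<tau> \<in> PSYT lam" "i \<in> {1..<sum_list lam}" "s_act lam i \<tau> \<in> PSYT lam" "up lam \<tau> i"
  shows "psyt_less lam \<tau> (s_act lam i \<tau>)"
proof -
  have "(\<tau>, s_act lam i \<tau>) \<in> psyt_gen lam"
    using assms unfolding psyt_gen_def up_def by auto
  then show ?thesis by (auto simp: psyt_less_def)
qed

lemma finite_diagram: "finite (diagram lam)"
  and card_diagram: "card (diagram lam) = sum_list lam"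
proof -
  have eq: "diagram lam = prod.swap ` (SIGMA b:{..<length lam}. {..<lam ! b})"
    by (auto simp: diagram_def image_iff prod.swap_def)
  show "finite (diagram lam)" by (simp add: eq)
  have "card (diagram lam) = card (SIGMA b:{..<length lam}. {..<lam ! b})"
    unfolding eq by (rule card_image) simp
  also have "\<dots> = sum_list lam" by (simp add: sum_list_sum_nth atLeast0LessThan)
  finally show "card (diagram lam) = sum_list lam" .
qed

lemma finite_Inv: "finite (Inv lam \<tau>)"
  by (rule finite_subset[of _ "diagram lam \<times> diagram lam"]) (auto simp: Inv_def finite_diagram)

lemma S_tab_less_iff:
  assumes "x \<in> diagram lam" "y \<in> diagram lam"
  shows "fst (S_tab lam T x) < fst (S_tab lam T y) \<longleftrightarrow> box_before T x y"
proof -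
  have imp: "fst (S_tab lam T x) < fst (S_tab lam T y)"
    if "box_before T x y" "x \<in> diagram lam" "y \<in> diagram lam" for x y
  proof -
    have "{z \<in> diagram lam. box_before T z x} \<subset> {z \<in> diagram lam. box_before T z y}"
    proof -
      have "{z \<in> diagram lam. box_before T z x} \<subseteq> {z \<in> diagram lam. box_before T z y}"
        using box_before_trans[OF _ that(1)] by blast
      then show ?thesis using that(1,2) box_before_irrefl[of T x] by blast
    qed
    then have "card {z \<in> diagram lam. box_before T z x} < card {z \<in> diagram lam. box_before T z y}"
      by (rule psubset_card_mono[rotated]) (simp add: finite_diagram)
    then show ?thesis using that by (simp add: S_tab_def)
  qed
  show ?thesis using imp[of x y] imp[of y x] box_before_linear[of x y T] assms by fastforce
qed

lemma S_tab_in: "x \<in> diagram lam \<Longrightarrow> fst (S_tab lam T x) \<in> {1..sum_list lam}"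
proof -
  assume x: "x \<in> diagram lam"
  then have "{z \<in> diagram lam. box_before T z x} \<subset> diagram lam"
    using box_before_irrefl[of T x] by blast
  from psubset_card_mono[OF finite_diagram this] x show ?thesis
    by (simp add: S_tab_def card_diagram)
qed

section \<open>Tableaux over a column-strict weight\<close>

locale rssyt =
  fixes lam :: "nat list" and T :: "box \<Rightarrow> nat"
  assumes partition: "is_partition lam" and T: "T \<in> RSSYT lam"
begin

lemma diagram_down:
  assumes "(a, b) \<in> diagram lam" "a' \<le> a" "b' \<le> b"
  shows "(a', b') \<in> diagram lam"
proof -
  have "lam ! b \<le> lam ! b'"
    using assms partition by (cases "b' = b") (auto simp: is_partition_def diagram_def sorted_wrt_iff_nth_less)
  then show ?thesis using assms by (auto simp: diagram_def)
qed

lemma row_le: "x \<in> diagram lam \<Longrightarrow> y \<in> diagram lam \<Longrightarrow> snd x = snd y \<Longrightarrow> fst x \<le> fst y \<Longrightarrow> T y \<le> T x"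
  using T by (cases x; cases y; cases "fst x = fst y") (auto simp: RSSYT_def RYT_def)

lemma column_less: "x \<in> diagram lam \<Longrightarrow> y \<in> diagram lam \<Longrightarrow> fst x = fst y \<Longrightarrow> snd x < snd y \<Longrightarrow> T y < T x"
  using T by (cases x; cases y) (auto simp: RSSYT_def)

text \<open>If \<open>y\<close> were to the right of \<open>x\<close> and strictly below it, the box
  in the column of \<open>x\<close> and the row of \<open>y\<close> would have a value strictly
  below \<open>T x\<close> and at least \<open>T y\<close>.\<close>

lemma horizontal_strip:
  assumes "x \<in> diagram lam" "y \<in> diagram lam" "T x = T y" "x \<noteq> y"
  shows "fst x \<noteq> fst y" and "fst x < fst y \<Longrightarrow> snd y \<le> snd x"
proof -
  show "fst x \<noteq> fst y"
    using column_less[of x y] column_less[of y x] assms by (metis less_irrefl linorder_neqE_nat prod_eqI)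
  show "snd y \<le> snd x" if lt: "fst x < fst y"
  proof (rule ccontr)
    assume "\<not> snd y \<le> snd x"
    then have "(fst x, snd y) \<in> diagram lam" "T (fst x, snd y) < T x" "T y \<le> T (fst x, snd y)"
      using lt assms diagram_down[of "fst y" "snd y" "fst x" "snd y"]
        column_less[of x "(fst x, snd y)"] row_le[of "(fst x, snd y)" y] by auto
    then show False using assms by simp
  qed
qed

abbreviation X :: "tableau set" where "X \<equiv> PSYT_over lam T"

lemma X_PSYT: "\<tau> \<in> X \<Longrightarrow> \<tau> \<in> PSYT lam"
  by (simp add: PSYT_over_def)

lemma X_labelling: "\<tau> \<in> X \<Longrightarrow> labelling lam \<tau>"
  by (simp add: PSYT_over_def PSYT_iff)

lemma snd_X: "\<tau> \<in> X \<Longrightarrow> x \<in> diagram lam \<Longrightarrow> snd (\<tau> x) = T x"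
  by (auto simp: PSYT_over_def p_map_def)

lemma wt_X: "\<tau> \<in> X \<Longrightarrow> j \<in> {1..sum_list lam} \<Longrightarrow> wt lam \<tau> j = T (box_of lam \<tau> j)"
  by (simp add: wt_def snd_X box_of_in X_labelling)

lemma s_act_X_iff: "\<tau> \<in> X \<Longrightarrow> s_act lam i \<tau> \<in> X \<longleftrightarrow> s_act lam i \<tau> \<in> PSYT lam"
  by (simp add: PSYT_over_def p_map_s_act)

lemma finite_X: "finite X"
proof (rule finite_subset)
  show "X \<subseteq> diagram lam \<rightarrow>\<^sub>E {1..sum_list lam} \<times> T ` diagram lam"
  proof
    fix \<tau> assume \<tau>: "\<tau> \<in> X"
    then show "\<tau> \<in> diagram lam \<rightarrow>\<^sub>E {1..sum_list lam} \<times> T ` diagram lam"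
      using X_labelling[OF \<tau>] snd_X[OF \<tau>] by (auto simp: labelling_def PiE_iff mem_Times_iff)
  qed
qed (intro finite_PiE finite_cartesian_product finite_imageI finite_diagram finite_atLeastAtMost)

lemma Inv_X:
  assumes "\<tau> \<in> X"
  shows "Inv lam \<tau> = {(x, y). x \<in> diagram lam \<and> y \<in> diagram lam \<and> box_before T x y \<and> fst (\<tau> x) > fst (\<tau> y)}"
  using assms S_tab_less_iff by (auto simp: Inv_def PSYT_over_def)

text \<open>Passes through the corner in the row of \<open>x\<close> and the column of
  \<open>y\<close>. This is the monotonicity that \<open>labelling_eqI\<close> asks for.\<close>

lemma diagonal_less:
  assumes "\<tau> \<in> PSYT lam" "x \<in> diagram lam" "y \<in> diagram lam" "box_content x = box_content y" "fst x < fst y"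
  shows "label_less (\<tau> x) (\<tau> y)"
proof -
  have lt: "snd x < snd y" using assms(4,5) by (simp add: box_content_eq)
  have z: "(fst y, snd x) \<in> diagram lam"
    using assms(3) lt diagram_down[of "fst y" "snd y" "fst y" "snd x"] by simp
  have "label_less (\<tau> x) (\<tau> (fst y, snd x))" "label_less (\<tau> (fst y, snd x)) (\<tau> y)"
    using assms z lt unfolding PSYT_iff by force+
  then show ?thesis by (rule label_less_trans)
qed

text \<open>For equal weights the boxes of \<open>i\<close> and \<open>i + 1\<close> lie in a
  horizontal strip. If \<open>i + 1\<close> is to the left, it cannot be in the same row, where
  indices increase; so it is strictly lower, and its content is smaller by at least 2. If it is to
  the right, it is weakly higher and has the larger content. Hence the content condition is the
  column order used by \<open>S(T)\<close>, and a step up never involves boxes of equal weight in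
  one row or column.\<close>

lemma up_iff:
  assumes \<tau>: "\<tau> \<in> X" and i: "i \<in> {1..<sum_list lam}"
  shows "up lam \<tau> i \<longleftrightarrow> box_before T (box_of lam \<tau> (Suc i)) (box_of lam \<tau> i)"
    and "up lam \<tau> i \<Longrightarrow> s_act lam i \<tau> \<in> X"
proof -
  let ?x = "box_of lam \<tau> i" and ?y = "box_of lam \<tau> (Suc i)"
  have i': "i \<in> {1..sum_list lam}" "Suc i \<in> {1..sum_list lam}" using i by auto
  note l = X_labelling[OF \<tau>]
  note xy = box_of_in[OF l i'(1)] box_of_in[OF l i'(2)]
  have ne: "?x \<noteq> ?y" using box_of_eq_iff[OF l i'] by simp
  have rows: "snd ?x < snd ?y" if "T ?x = T ?y" "fst ?y < fst ?x"
  proof -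
    have "snd ?x \<noteq> snd ?y"
    proof
      assume "snd ?x = snd ?y"
      then have "label_less (\<tau> ?y) (\<tau> ?x)"
        using X_PSYT[OF \<tau>] xy that unfolding PSYT_iff by force
      then show False
        using that label_box_of[OF l i'(1)] label_box_of[OF l i'(2)] wt_X[OF \<tau>] i' by (simp add: label_less_iff)
    qed
    then show ?thesis using horizontal_strip(2)[OF xy(2,1)] ne that by simp
  qed
  have less: "snd ?y \<le> snd ?x" if "T ?x = T ?y" "fst ?x < fst ?y"
    using horizontal_strip(2)[OF xy] ne that by simp
  have cols: "fst ?x \<noteq> fst ?y" if "T ?x = T ?y" using horizontal_strip(1)[OF xy that ne] .
  note w = wt_X[OF \<tau> i'(1)] wt_X[OF \<tau> i'(2)]
  show iff: "up lam \<tau> i \<longleftrightarrow> box_before T ?y ?x"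
  proof (cases "T ?x = T ?y")
    case True
    have "int (fst ?x) - int (snd ?x) - (int (fst ?y) - int (snd ?y)) > 1 \<longleftrightarrow> fst ?y < fst ?x"
      using rows[OF True] less[OF True] cols[OF True] by linarith
    then show ?thesis
      using True cols[OF True] unfolding up_def box_before_iff cont_def box_content_eq w by simp
  qed (simp add: up_def box_before_iff w)
  assume "up lam \<tau> i"
  then have "box_before T ?y ?x" using iff by simp
  then have "wt lam \<tau> i \<noteq> wt lam \<tau> (Suc i) \<or> (fst ?x \<noteq> fst ?y \<and> snd ?x \<noteq> snd ?y)"
  proof (cases "T ?x = T ?y")
    case True
    with \<open>box_before T ?y ?x\<close> cols have "fst ?y < fst ?x" by (simp add: box_before_iff)
    with rows[OF True] show ?thesis by simp
  qed (simp add: w)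
  then show "s_act lam i \<tau> \<in> X"
    using s_act_in_PSYT[OF X_PSYT[OF \<tau>] i] s_act_X_iff[OF \<tau>] by simp
qed

lemma up_s_act:
  assumes \<tau>: "\<tau> \<in> X" and i: "i \<in> {1..<sum_list lam}" and s: "s_act lam i \<tau> \<in> X"
  shows "up lam (s_act lam i \<tau>) i \<longleftrightarrow> \<not> up lam \<tau> i"
proof -
  have i': "i \<in> {1..sum_list lam}" "Suc i \<in> {1..sum_list lam}" using i by auto
  have ne: "box_of lam \<tau> i \<noteq> box_of lam \<tau> (Suc i)" using box_of_eq_iff[OF X_labelling[OF \<tau>] i'] by simp
  show ?thesis
    unfolding up_iff(1)[OF \<tau> i] up_iff(1)[OF s i] box_of_s_act
    using box_before_linear[OF ne, of T] by simp
qed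

text \<open>Equal weight and column strictness leave only a common row. A box between the two would
  have the same weight by monotonicity, and hence an index strictly between \<open>i\<close> and
  \<open>i + 1\<close>.\<close>

lemma not_s_act:
  assumes \<tau>: "\<tau> \<in> X" and i: "i \<in> {1..<sum_list lam}" and s: "s_act lam i \<tau> \<notin> X"
  shows "wt lam \<tau> (Suc i) = wt lam \<tau> i" "cont lam \<tau> (Suc i) = cont lam \<tau> i + 1"
    "snd (box_of lam \<tau> (Suc i)) = snd (box_of lam \<tau> i)"
proof -
  let ?x = "box_of lam \<tau> i" and ?y = "box_of lam \<tau> (Suc i)"
  have i': "i \<in> {1..sum_list lam}" "Suc i \<in> {1..sum_list lam}" using i by auto
  note l = X_labelling[OF \<tau>]
  note xy = box_of_in[OF l i'(1)] box_of_in[OF l i'(2)]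
  have ne: "?x \<noteq> ?y" using box_of_eq_iff[OF l i'] by simp
  have no: "wt lam \<tau> i = wt lam \<tau> (Suc i) \<and> (fst ?x = fst ?y \<or> snd ?x = snd ?y)"
    using s s_act_X_iff[OF \<tau>, of i] s_act_in_PSYT[OF X_PSYT[OF \<tau>] i] by blast
  then have w: "T ?x = T ?y" using wt_X[OF \<tau>] i' by simp
  have row: "snd ?x = snd ?y" using no horizontal_strip(1)[OF xy w ne] by simp
  have "\<not> up lam \<tau> i" using up_iff(2)[OF \<tau> i] s by blast
  then have "box_before T ?x ?y" unfolding up_iff(1)[OF \<tau> i] box_before_linear[OF ne] .
  then have lt: "fst ?x < fst ?y" using w row by (simp add: box_before_iff)
  have "fst ?y = Suc (fst ?x)"
  proof (rule ccontr)
    assume "fst ?y \<noteq> Suc (fst ?x)"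
    with lt have lt': "Suc (fst ?x) < fst ?y" by simp
    define z where "z = (Suc (fst ?x), snd ?x)"
    have z: "z \<in> diagram lam"
      using diagram_down[of "fst ?y" "snd ?y" "Suc (fst ?x)" "snd ?x"] lt xy row by (simp add: z_def)
    have "T z = T ?x"
      using row_le[OF xy(1) z] row_le[OF z xy(2)] w row lt by (simp add: z_def)
    moreover have "label_less (\<tau> ?x) (\<tau> z)" "label_less (\<tau> z) (\<tau> ?y)"
      using X_PSYT[OF \<tau>] xy z lt' row unfolding PSYT_iff by (simp_all add: z_def)
    ultimately show False
      using w xy z snd_X[OF \<tau>] fst_box_of[OF l i'(1)] fst_box_of[OF l i'(2)] by (simp add: label_less_iff)
  qed
  then show "cont lam \<tau> (Suc i) = cont lam \<tau> i + 1" using row by (simp add: cont_def box_content_eq)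
  show "wt lam \<tau> (Suc i) = wt lam \<tau> i" "snd ?y = snd ?x" using no row by simp_all
qed

text \<open>The order \<open>S(T)\<close> depends on the weight only and is unchanged by
  \<open>s_i\<close>; the order of the indices changes for one pair of boxes. A step up means that
  the box of \<open>i + 1\<close> comes first in \<open>S(T)\<close>, so this pair is an inversion
  before the step and not after it.\<close>

lemma Inv_up:
  assumes \<tau>: "\<tau> \<in> X" and i: "i \<in> {1..<sum_list lam}" and u: "up lam \<tau> i"
  defines "p \<equiv> (box_of lam \<tau> (Suc i), box_of lam \<tau> i)"
  shows "Inv lam \<tau> = insert p (Inv lam (s_act lam i \<tau>))" and "p \<notin> Inv lam (s_act lam i \<tau>)"
proof -
  let ?x = "box_of lam \<tau> i" and ?y = "box_of lam \<tau> (Suc i)"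
  have s: "s_act lam i \<tau> \<in> X" by (rule up_iff(2)[OF \<tau> i u])
  have i': "i \<in> {1..sum_list lam}" "Suc i \<in> {1..sum_list lam}" using i by auto
  note l = X_labelling[OF \<tau>]
  note xy = box_of_in[OF l i'(1)] box_of_in[OF l i'(2)]
  note f = fst_box_of[OF l i'(1)] fst_box_of[OF l i'(2)]
  have b: "box_before T ?y ?x" using up_iff(1)[OF \<tau> i] u by simp
  then have b': "\<not> box_before T ?x ?y"
    using box_before_trans[of T ?x ?y ?x] box_before_irrefl[of T ?x] by blast
  show "p \<notin> Inv lam (s_act lam i \<tau>)"
    using xy f by (simp add: p_def Inv_X[OF s] s_act_apply)
  show "Inv lam \<tau> = insert p (Inv lam (s_act lam i \<tau>))"
  proof (rule Set.set_eqI)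
    fix z :: "box \<times> box"
    obtain v w where z: "z = (v, w)" by (rule prod.exhaust[of z])
    show "z \<in> Inv lam \<tau> \<longleftrightarrow> z \<in> insert p (Inv lam (s_act lam i \<tau>))"
    proof (cases "v \<in> diagram lam \<and> w \<in> diagram lam \<and> box_before T v w")
      case True
      have "v \<noteq> w"
      proof
        assume "v = w"
        with True show False by (simp add: box_before_irrefl)
      qed
      then have d: "fst (\<tau> v) \<noteq> fst (\<tau> w)"
        using True box_of_eqI[OF l, of v "fst (\<tau> w)"] box_of_eqI[OF l, of w "fst (\<tau> w)"] \<open>v \<noteq> w\<close> by argo
      show ?thesis
      proof (cases "{fst (\<tau> w), fst (\<tau> v)} = {i, Suc i}")
        case inside: True
        then have "v = ?y \<and> w = ?x"
          using True b' box_of_eqI[OF l, of v, OF _ refl] box_of_eqI[OF l, of w, OF _ refl]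
          by (auto simp: doubleton_eq_iff)
        then have "z = p" by (simp add: z p_def)
        moreover have "p \<in> Inv lam \<tau>" using xy f b by (simp add: p_def Inv_X[OF \<tau>])
        ultimately show ?thesis by simp
      next
        case False
        then have "z \<noteq> p" using f by (auto simp: z p_def)
        then show ?thesis
          using False True d transpose_Suc_less_iff[of "fst (\<tau> w)" "fst (\<tau> v)" i]
          by (simp add: z Inv_X[OF \<tau>] Inv_X[OF s] s_act_apply)
      qed
    next
      case False
      then show ?thesis using xy b by (auto simp: z p_def Inv_X[OF \<tau>] Inv_X[OF s])
    qed
  qed
qed

section \<open>The number of inversions and the maximal tableau\<close>

lemma card_Inv_up:
  assumes "\<tau> \<in> X" "i \<in> {1..<sum_list lam}" "up lam \<tau> i"
  shows "card (Inv lam \<tau>) = Suc (card (Inv lam (s_act lam i \<tau>)))"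
  using Inv_up[OF assms] finite_Inv by simp

text \<open>In a row, boxes with equal values are numbered from left to right by
  \<open>S(T)\<close>. In a column \<open>T\<close> decreases strictly, so the powers of q alone
  order the labels.\<close>

lemma Top_tab_in_X: "Top_tab lam T \<in> X"
proof -
  let ?n = "sum_list lam"
  have inj: "inj_on (\<lambda>x. fst (S_tab lam T x)) (diagram lam)"
    using S_tab_less_iff box_before_linear by (intro inj_onI) (metis less_irrefl)
  have sub: "(\<lambda>x. fst (S_tab lam T x)) ` diagram lam \<subseteq> {1..?n}" using S_tab_in by blast
  have onto: "(\<lambda>x. fst (S_tab lam T x)) ` diagram lam = {1..?n}"
    by (rule card_subset_eq[OF _ sub]) (simp_all add: card_image[OF inj] card_diagram)
  have "labelling lam (Top_tab lam T)"
    unfolding labelling_def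
  proof (intro conjI ballI)
    show "Top_tab lam T \<in> diagram lam \<rightarrow>\<^sub>E {1..?n} \<times> UNIV" using S_tab_in by (auto simp: Top_tab_def)
    fix j assume "j \<in> {1..?n}"
    then obtain x where "x \<in> diagram lam" "fst (S_tab lam T x) = j" using onto by (metis imageE)
    then show "\<exists>!x. x \<in> diagram lam \<and> fst (Top_tab lam T x) = j"
      using inj by (intro ex1I[of _ x]) (auto simp: Top_tab_def inj_on_def)
  qed
  moreover have "label_less (Top_tab lam T x) (Top_tab lam T y)"
    if "x \<in> diagram lam" "y \<in> diagram lam" "snd x = snd y" "fst x < fst y" for x y
    using that row_le[of x y] S_tab_less_iff[of x lam y T]
    by (auto simp: Top_tab_def label_less_iff box_before_iff)
  moreover have "label_less (Top_tab lam T x) (Top_tab lam T y)"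
    if "x \<in> diagram lam" "y \<in> diagram lam" "fst x = fst y" "snd x < snd y" for x y
    using that column_less[of x y] by (auto simp: Top_tab_def label_less_iff)
  moreover have "p_map lam (Top_tab lam T) = T"
    using T by (auto simp: p_map_def Top_tab_def RSSYT_def RYT_def fun_eq_iff PiE_iff extensional_def)
  ultimately show ?thesis unfolding PSYT_over_def PSYT_iff by blast
qed

lemma Inv_Top_tab: "Inv lam (Top_tab lam T) = {}"
proof -
  have "\<not> fst (Top_tab lam T y) < fst (Top_tab lam T x)"
    if "x \<in> diagram lam" "y \<in> diagram lam" "box_before T x y" for x y
    using that S_tab_less_iff[of x lam y T] by (simp add: Top_tab_def)
  then show ?thesis by (auto simp: Inv_X[OF Top_tab_in_X])
qed

text \<open>If no step goes up, the boxes of 1, 2, ... appear in the order of \<open>S(T)\<close>,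
  so each index equals its rank.\<close>

lemma up_exists:
  assumes \<tau>: "\<tau> \<in> X" and ne: "\<tau> \<noteq> Top_tab lam T"
  obtains i where "i \<in> {1..<sum_list lam}" "up lam \<tau> i"
proof (rule ccontr)
  assume "\<not> thesis"
  with that have no: "\<not> up lam \<tau> i" if "i \<in> {1..<sum_list lam}" for i using \<open>i \<in> _\<close> by blast
  let ?n = "sum_list lam"
  let ?f = "\<lambda>i. fst (S_tab lam T (box_of lam \<tau> i))"
  note l = X_labelling[OF \<tau>]
  have f: "?f i = i" if "i \<in> {1..?n}" for i
  proof (rule strict_mono_on_interval_id[OF _ _ that])
    show "?f ` {1..?n} \<subseteq> {1..?n}" using S_tab_in box_of_in[OF l] by blast
    fix i assume i: "i \<in> {1..<?n}"
    then have i': "i \<in> {1..?n}" "Suc i \<in> {1..?n}" by auto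
    have "box_before T (box_of lam \<tau> i) (box_of lam \<tau> (Suc i))"
      using no[OF i] unfolding up_iff(1)[OF \<tau> i]
      by (subst box_before_linear) (simp_all add: box_of_eq_iff[OF l i'])
    then show "?f i < ?f (Suc i)" using S_tab_less_iff box_of_in[OF l] i' by blast
  qed
  have "\<tau> = Top_tab lam T"
  proof (rule PiE_ext)
    show "\<tau> \<in> diagram lam \<rightarrow>\<^sub>E {1..?n} \<times> UNIV" "Top_tab lam T \<in> diagram lam \<rightarrow>\<^sub>E {1..?n} \<times> UNIV"
      using l X_labelling[OF Top_tab_in_X] by (simp_all add: labelling_def)
    fix x assume x: "x \<in> diagram lam"
    then show "\<tau> x = Top_tab lam T x"
      using f[OF fst_label_in[OF l x]] box_of_eqI[OF l x] snd_X[OF \<tau> x]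
      by (simp add: Top_tab_def prod_eq_iff)
  qed
  with ne show False ..
qed

lemma psyt_less_Top_tab: "\<tau> \<in> X \<Longrightarrow> \<tau> = Top_tab lam T \<or> psyt_less lam \<tau> (Top_tab lam T)"
proof (induction "card (Inv lam \<tau>)" arbitrary: \<tau> rule: less_induct)
  case less
  show ?case
  proof (cases "\<tau> = Top_tab lam T")
    case False
    then obtain i where i: "i \<in> {1..<sum_list lam}" "up lam \<tau> i" using up_exists less(2) by blast
    have s: "s_act lam i \<tau> \<in> X" by (rule up_iff(2)[OF less(2) i])
    have "psyt_less lam \<tau> (s_act lam i \<tau>)"
      using psyt_less_s_act i X_PSYT s less(2) by blast
    moreover have "s_act lam i \<tau> = Top_tab lam T \<or> psyt_less lam (s_act lam i \<tau>) (Top_tab lam T)"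
      using less(1)[OF _ s] card_Inv_up[OF less(2) i] by simp
    ultimately show ?thesis unfolding psyt_less_def by (metis trancl_trans)
  qed simp
qed

text \<open>\<^const>\<open>Psi\<close> raises the total weight, so only the \<open>s\<^sub>i\<close> occur between tableaux of the same
  weight.\<close>

lemma psyt_less_card_Inv:
  assumes "psyt_less lam \<tau> \<tau>'" "\<tau> \<in> X" "\<tau>' \<in> X"
  shows "card (Inv lam \<tau>') < card (Inv lam \<tau>)"
proof -
  define N where "N \<tau> = (\<Sum>x\<in>diagram lam. snd (\<tau> x))" for \<tau> :: tableau
  \<comment> \<open>The conclusion includes membership in \<open>X\<close>, so that the intermediate
    tableaux of a chain stay over \<open>T\<close> as long as the total weight is constant.\<close>
  have gen: "N \<tau> < N \<tau>' \<or> (N \<tau> = N \<tau>' \<and> (\<tau> \<in> X \<longrightarrow> \<tau>' \<in> X \<and> card (Inv lam \<tau>') < card (Inv lam \<tau>)))"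
    if "(\<tau>, \<tau>') \<in> psyt_gen lam" for \<tau> \<tau>'
    using that
  proof (cases rule: psyt_gen_cases)
    case Psi
    then have l: "labelling lam \<tau>" and n: "1 \<in> {1..sum_list lam}" by (auto simp: PSYT_iff)
    have ap: "snd (\<tau>' x) = snd (\<tau> x) + (if fst (\<tau> x) = 1 then 1 else 0)" if "x \<in> diagram lam" for x
      using fst_label_in[OF l that] that by (auto simp: Psi Psi_def split: prod.split)
    have "N \<tau> < N \<tau>'"
      unfolding N_def
    proof (rule sum_strict_mono_ex1[OF finite_diagram])
      show "\<forall>x\<in>diagram lam. snd (\<tau> x) \<le> snd (\<tau>' x)" using ap by simp
      show "\<exists>x\<in>diagram lam. snd (\<tau> x) < snd (\<tau>' x)"
        using ap[OF box_of_in[OF l n]] fst_box_of[OF l n] by (intro bexI[OF _ box_of_in[OF l n]]) simp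
    qed
    then show ?thesis ..
  next
    case (s i)
    have "N \<tau>' = N \<tau>" by (simp add: N_def s s_act_apply)
    moreover have "\<tau>' \<in> X \<and> card (Inv lam \<tau>') < card (Inv lam \<tau>)" if "\<tau> \<in> X"
      using card_Inv_up[OF that] up_iff(2)[OF that] s by simp
    ultimately show ?thesis by simp
  qed
  have "N \<tau> < N \<tau>' \<or> (N \<tau> = N \<tau>' \<and> (\<tau> \<in> X \<longrightarrow> \<tau>' \<in> X \<and> card (Inv lam \<tau>') < card (Inv lam \<tau>)))"
    using assms(1)[unfolded psyt_less_def]
  proof (induction rule: trancl_induct)
    case (base \<tau>') then show ?case by (rule gen)
  next
    case (step \<tau>' \<tau>'')
    then show ?case using gen[OF step(2)] by auto
  qed
  moreover have "N \<tau> = N \<tau>'" using snd_X assms(2,3) by (simp add: N_def)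
  ultimately show ?thesis using assms by simp
qed

text \<open>A second maximum would lie above \<open>Top_tab\<close> and would have fewer inversions
  than the empty set.\<close>

lemma Top_eq: "Top lam T = Top_tab lam T"
  unfolding Top_def
proof (rule the_equality)
  show "Top_tab lam T \<in> X \<and> (\<forall>\<tau>'\<in>X. \<tau>' = Top_tab lam T \<or> psyt_less lam \<tau>' (Top_tab lam T))"
    using Top_tab_in_X psyt_less_Top_tab by blast
  fix \<tau> assume "\<tau> \<in> X \<and> (\<forall>\<tau>'\<in>X. \<tau>' = \<tau> \<or> psyt_less lam \<tau>' \<tau>)"
  then show "\<tau> = Top_tab lam T"
    using Top_tab_in_X psyt_less_card_Inv[of "Top_tab lam T" \<tau>] by (fastforce simp: Inv_Top_tab)
qed

end

section \<open>The action of the affine Hecke algebra on \<open>U\<^sub>T\<close>\<close>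

locale daha_module = rssyt lam T
  for lam :: "nat list" and T :: "box \<Rightarrow> nat" +
  fixes n :: nat and L :: "(gens falg set, 'm) module" and b :: "tableau \<Rightarrow> 'm"
    and F :: "tableau \<Rightarrow> 'm ind"
  assumes n: "sum_list lam = n" and specht: "specht_module lam L b" and F_basis: "F_basis lam L b F"
begin

sublocale V: presented_module "D_pres n" "V_mod lam L"
  by (rule presented_module.intro[OF pres_closed(3) left_module_V_mod[OF specht, unfolded n]])

lemma V_act_eq: "V_act lam L f v = V.act f v"
  by (simp add: V_act_def V.act_def n)

lemma kbasis_F: "kbasis (D_pres n) (V_mod lam L) F (PSYT lam)"
  using F_basis by (simp add: F_basis_def Let_def n)

lemma F_closed: "\<tau> \<in> PSYT lam \<Longrightarrow> F \<tau> \<in> carrier (V_mod lam L)"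
  using kbasis_F by (auto simp: kbasis_def)

lemma F_funcset: "J \<subseteq> PSYT lam \<Longrightarrow> F \<in> J \<rightarrow> carrier (V_mod lam L)"
  using F_closed by blast

lemma X_subset: "X \<subseteq> PSYT lam"
  using X_PSYT by blast

lemma words_closed:
  "i \<in> {1..<n} \<Longrightarrow> fT i \<in> V.words" "j \<in> {1..n} \<Longrightarrow> fTh j \<in> V.words"
  by (auto simp: D_pres_def intro!: free_alg_closed)

abbreviation scale :: "ratqt \<Rightarrow> 'm ind \<Rightarrow> 'm ind" where
  "scale k v \<equiv> V.act (scalar k) v"

abbreviation vplus :: "'m ind \<Rightarrow> 'm ind \<Rightarrow> 'm ind" (infixl "\<oplus>V" 65) where
  "v \<oplus>V w \<equiv> v \<oplus>\<^bsub>V_mod lam L\<^esub> w"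

abbreviation carV :: "'m ind set" where "carV \<equiv> carrier (V_mod lam L)"

text \<open>Restricted to generators: between two scalars this rewriting would loop.\<close>

lemma act_gen_scale:
  "gen g \<in> V.words \<Longrightarrow> v \<in> carV \<Longrightarrow> V.act (gen g) (scale c v) = scale c (V.act (gen g) v)"
  by (rule V.act_scalar_commute)

lemma scalar_1_minus: "scalar (1 - k) = 1 - scalar k"
  by (simp add: scalar_def single_diff)

section \<open>The defining relations as identities between operators\<close>

lemma quadratic_act:
  assumes i: "i \<in> {1..<n}" and v: "v \<in> carV"
  shows "V.act (fT i) (V.act (fT i) v) = scale (1 - tt) (V.act (fT i) v) \<oplus>V scale tt v"
proof -
  note w = words_closed(1)[OF i]
  have eq: "(fT i - 1) * (fT i + scalar tt) = fT i * fT i - (scalar (1 - tt) * fT i + scalar tt)"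
    using scalar_central[of tt "fT i"] by (simp add: scalar_1_minus algebra_simps)
  have "(fT i - 1) * (fT i + scalar tt) \<in> snd (D_pres n)"
    using i unfolding D_pres_def hecke_rels_def snd_conv by blast
  then have "V.act (fT i * fT i) v = V.act (scalar (1 - tt) * fT i + scalar tt) v"
    unfolding eq using w v by (intro V.act_relator) (auto intro!: free_alg_closed)
  then show ?thesis using w v by (simp add: V.act_mult V.act_add_left free_alg_closed)
qed

lemma braid_act:
  assumes i: "i \<in> {1..<n}" "Suc i \<in> {1..<n}" and v: "v \<in> carV"
  shows "V.act (fT i) (V.act (fT (Suc i)) (V.act (fT i) v)) =
    V.act (fT (Suc i)) (V.act (fT i) (V.act (fT (Suc i)) v))"
proof -
  note w = words_closed(1)[OF i(1)] words_closed(1)[OF i(2)]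
  have "fT i * fT (Suc i) * fT i - fT (Suc i) * fT i * fT (Suc i) \<in> snd (D_pres n)"
    using i unfolding D_pres_def hecke_rels_def snd_conv Suc_eq_plus1 by blast
  then have "V.act (fT i * fT (Suc i) * fT i) v = V.act (fT (Suc i) * fT i * fT (Suc i)) v"
    using w v by (intro V.act_relator free_alg_closed(3,7))
  then show ?thesis using w v by (simp add: V.act_mult free_alg_closed)
qed

lemma commute_act:
  assumes i: "i \<in> {1..<n}" "j \<in> {1..<n}" "\<bar>int i - int j\<bar> > 1" and v: "v \<in> carV"
  shows "V.act (fT i) (V.act (fT j) v) = V.act (fT j) (V.act (fT i) v)"
proof -
  note w = words_closed(1)[OF i(1)] words_closed(1)[OF i(2)]
  have "fT i * fT j - fT j * fT i \<in> snd (D_pres n)"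
    using i unfolding D_pres_def hecke_rels_def snd_conv by blast
  then have "V.act (fT i * fT j) v = V.act (fT j * fT i) v"
    using w v by (intro V.act_relator free_alg_closed(3,7))
  then show ?thesis using w v by (simp add: V.act_mult)
qed

lemma theta_commute_act:
  assumes i: "i \<in> {1..<n}" "j \<in> {1..n}" "j \<notin> {i, Suc i}" and v: "v \<in> carV"
  shows "V.act (fTh j) (V.act (fT i) v) = V.act (fT i) (V.act (fTh j) v)"
proof -
  note w = words_closed(1)[OF i(1)] words_closed(2)[OF i(2)]
  have "fT i * fTh j - fTh j * fT i \<in> snd (D_pres n)"
    using i unfolding D_pres_def affine_rels_def snd_conv Suc_eq_plus1 by blast
  then have "V.act (fT i * fTh j) v = V.act (fTh j * fT i) v"
    using w v by (intro V.act_relator free_alg_closed(3,7))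
  then show ?thesis using w v by (simp add: V.act_mult)
qed

text \<open>The operator \<open>t T_i^(-1)\<close>, in the form that the quadratic relation gives
  it.\<close>

definition R :: "nat \<Rightarrow> 'm ind \<Rightarrow> 'm ind" where
  "R i v = V.act (fT i) v \<oplus>V scale (tt - 1) v"

lemma scalar_fTinv: "scalar tt * fTinv i = fT i + scalar (tt - 1)"
proof -
  have "scalar tt * scalar (1 / tt) = (1 :: gens falg)"
    using tt_nonzero by (simp add: scalar_mult[symmetric] scalar_one)
  then show ?thesis by (simp add: fTinv_def mult.assoc[symmetric])
qed

lemma act_fTinv:
  assumes i: "i \<in> {1..<n}" and v: "v \<in> carV"
  shows "V.act (fTinv i) v = scale (1 / tt) (R i v)"
  using words_closed(1)[OF i] v
  by (simp add: fTinv_def V.act_mult V.act_add_left free_alg_closed R_def)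

lemma R_closed: "i \<in> {1..<n} \<Longrightarrow> v \<in> carV \<Longrightarrow> R i v \<in> carV"
  by (simp add: R_def words_closed)

lemma R_scale:
  assumes i: "i \<in> {1..<n}" and v: "v \<in> carV"
  shows "R i (scale k v) = scale k (R i v)"
  using words_closed(1)[OF i] v
  by (simp add: R_def act_gen_scale V.act_add_right free_alg_closed V.act_scalar_mult mult.commute)

lemma R_T:
  assumes i: "i \<in> {1..<n}" and v: "v \<in> carV"
  shows "R i (V.act (fT i) v) = scale tt v" "V.act (fT i) (R i v) = scale tt v"
proof -
  note w = words_closed(1)[OF i]
  have z: "scale (1 - tt) u \<oplus>V (scale tt v \<oplus>V scale (tt - 1) u) = scale tt v" if u: "u \<in> carV" for u
  proof -
    have "scale (1 - tt) u \<oplus>V (scale tt v \<oplus>V scale (tt - 1) u) =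
        scale tt v \<oplus>V (scale (1 - tt) u \<oplus>V scale (tt - 1) u)"
      using u v by (simp add: V.M.a_lcomm)
    also have "\<dots> = scale tt v \<oplus>V scale (1 - tt + (tt - 1)) u"
      by (simp only: V.act_scalar_add[OF u])
    also have "\<dots> = scale tt v" using u v by (simp add: scalar_zero V.act_zero_left)
    finally show ?thesis .
  qed
  show "R i (V.act (fT i) v) = scale tt v"
    using z[of "V.act (fT i) v"] w v by (simp add: R_def quadratic_act[OF i] V.M.a_assoc)
  show "V.act (fT i) (R i v) = scale tt v"
    using z[of "V.act (fT i) v"] w v
    by (simp add: R_def V.act_add_right quadratic_act[OF i] act_gen_scale V.M.a_assoc)
qed

lemma theta_Suc_act:
  assumes i: "i \<in> {1..<n}" and v: "v \<in> carV"
  shows "V.act (fTh (Suc i)) v = scale (1 / tt) (R i (V.act (fTh i) (R i v)))"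
proof -
  have j: "i \<in> {1..n}" "Suc i \<in> {1..n}" using i by auto
  note w = words_closed(1)[OF i] words_closed(2)[OF j(1)] words_closed(2)[OF j(2)]
  have wi: "fTinv i \<in> V.words" using i by (intro fTinv_closed) (auto simp: D_pres_def)
  have "fTh (Suc i) - scalar tt * fTinv i * fTh i * fTinv i \<in> snd (D_pres n)"
    using i unfolding D_pres_def affine_rels_def snd_conv Suc_eq_plus1 by blast
  then have "V.act (fTh (Suc i)) v = V.act (scalar tt * fTinv i * fTh i * fTinv i) v"
    using w wi v by (intro V.act_relator free_alg_closed(3,7))
  also have "\<dots> = scale tt (scale (1 / tt) (R i (V.act (fTh i) (scale (1 / tt) (R i v)))))"
    using w wi v i R_closed by (simp add: V.act_mult free_alg_closed act_fTinv)
  also have "\<dots> = scale (1 / tt) (R i (V.act (fTh i) (R i v)))"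
    using w v i R_closed tt_nonzero
    by (simp add: V.act_scalar_mult act_gen_scale R_scale scalar_one V.act_one)
  finally show ?thesis .
qed

text \<open>With \<open>u = T_i v\<close> the relation between \<open>\<theta>_i\<close> and
  \<open>\<theta>_(i+1)\<close> gives \<open>\<theta>_i u = y u - (t - 1) x v\<close>. The constant
  \<open>c = (t - 1) x / (x - y)\<close> is the one for which \<open>u + c v\<close> becomes an
  eigenvector. The result may be zero, and \<open>T_F_row\<close> exploits this.\<close>

lemma intertwiner:
  assumes i: "i \<in> {1..<n}" and v: "v \<in> carV"
    and e1: "V.act (fTh i) v = scale x v" and e2: "V.act (fTh (Suc i)) v = scale y v" and ne: "x \<noteq> y"
  defines "G \<equiv> V.act (fT i) v \<oplus>V scale ((tt - 1) * x / (x - y)) v"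
  shows "V.act (fTh i) G = scale y G" and "V.act (fTh (Suc i)) G = scale x G"
proof -
  have j: "i \<in> {1..n}" "Suc i \<in> {1..n}" using i by auto
  note w = words_closed(1)[OF i] words_closed(2)[OF j(1)] words_closed(2)[OF j(2)]
  define u c where "u = V.act (fT i) v" and "c = (tt - 1) * x / (x - y)"
  have c: "c * (x - y) = (tt - 1) * x" using ne by (simp add: c_def)
  have u: "u \<in> carV" using w v by (simp add: u_def)
  have Rv: "R i v = u \<oplus>V scale (tt - 1) v" by (simp add: R_def u_def)
  have "scale tt (V.act (fTh (Suc i)) v) = R i (V.act (fTh i) (R i v))"
    using w v i R_closed tt_nonzero
    by (simp add: theta_Suc_act V.act_scalar_mult scalar_one V.act_one)
  \<comment> \<open>Applying \<open>T_i\<close> removes the outer \<open>R i\<close>, since their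
    composite is multiplication by \<open>tt\<close>.\<close>
  then have "V.act (fT i) (scale tt (scale y v)) = scale tt (V.act (fTh i) (R i v))"
    using R_T(2)[OF i, of "V.act (fTh i) (R i v)"] R_closed[OF i v] w by (simp add: e2)
  then have "scale (1 / tt) (scale tt (scale y u)) = scale (1 / tt) (scale tt (V.act (fTh i) (R i v)))"
    using w v by (simp add: act_gen_scale u_def)
  then have "V.act (fTh i) (R i v) = scale y u"
    using w v u R_closed[OF i v] tt_nonzero by (simp add: V.act_scalar_mult scalar_one V.act_one)
  then have *: "V.act (fTh i) u \<oplus>V scale ((tt - 1) * x) v = scale y u"
    using w v u by (simp add: Rv V.act_add_right act_gen_scale e1 V.act_scalar_mult)
  have "V.act (fTh (Suc i)) u = scale (1 / tt) (R i (V.act (fTh i) (scale tt v)))"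
    using u v by (simp add: theta_Suc_act[OF i] R_T(1)[OF i] u_def[symmetric]) (simp add: u_def R_T(1)[OF i])
  also have "\<dots> = scale x (R i v)"
    using w v i R_closed tt_nonzero
    by (simp add: V.act_scalar_mult act_gen_scale R_scale e1)
  finally have **: "V.act (fTh (Suc i)) u = scale x u \<oplus>V scale (x * (tt - 1)) v"
    using u v by (simp add: Rv V.act_add_right free_alg_closed V.act_scalar_mult)
  have "V.act (fTh i) G = V.act (fTh i) u \<oplus>V scale (c * x) v"
    using w v u by (simp add: G_def c_def[symmetric] u_def[symmetric] V.act_add_right act_gen_scale e1 V.act_scalar_mult)
  also have "c * x = (tt - 1) * x + y * c" using c by (simp add: algebra_simps)
  also have "V.act (fTh i) u \<oplus>V scale ((tt - 1) * x + y * c) v = scale y u \<oplus>V scale (y * c) v"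
    using w v u by (simp add: V.act_scalar_add V.M.a_assoc[symmetric] *)
  also have "\<dots> = scale y G"
    using v u by (simp add: G_def c_def[symmetric] u_def[symmetric] V.act_add_right free_alg_closed V.act_scalar_mult)
  finally show "V.act (fTh i) G = scale y G" .
  have "V.act (fTh (Suc i)) G = V.act (fTh (Suc i)) u \<oplus>V scale (c * y) v"
    using w v u by (simp add: G_def c_def[symmetric] u_def[symmetric] V.act_add_right act_gen_scale e2 V.act_scalar_mult)
  also have "\<dots> = scale x u \<oplus>V scale (x * (tt - 1) + c * y) v"
    using w v u by (simp add: ** V.act_scalar_add V.M.a_assoc)
  also have "x * (tt - 1) + c * y = x * c" using c by (simp add: algebra_simps)
  also have "scale x u \<oplus>V scale (x * c) v = scale x G"
    using v u by (simp add: G_def c_def[symmetric] u_def[symmetric] V.act_add_right free_alg_closed V.act_scalar_mult)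
  finally show "V.act (fTh (Suc i)) G = scale x G" .
qed

section \<open>Joint eigenvalues and the blocks of \<open>T_i\<close>\<close>

lemma theta_F: "\<tau> \<in> PSYT lam \<Longrightarrow> j \<in> {1..n} \<Longrightarrow> V.act (fTh j) (F \<tau>) = scale (eigval lam \<tau> j) (F \<tau>)"
  using F_basis unfolding F_basis_def Let_def V_act_eq n by blast

lemma eigval_eq_iff:
  "eigval lam \<tau> i = eigval lam \<tau>' j \<longleftrightarrow> wt lam \<tau> i = wt lam \<tau>' j \<and> cont lam \<tau> i = cont lam \<tau>' j"
  by (simp add: eigval_def qq_tt_powi_inject)

lemma eigval_s_act:
  assumes "labelling lam \<tau>" "i \<in> {1..<n}" "j \<in> {1..n}"
  shows "eigval lam (s_act lam i \<tau>) j = eigval lam \<tau> (transpose i (Suc i) j)"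
  using assms n by (simp add: eigval_def wt_s_act cont_s_act)

text \<open>The diagonal entry of \<open>T_i\<close> at \<open>F_\<tau>\<close>, valid in both
  directions of a block of size two and equal to 1 when \<open>s_i(\<tau>)\<close> is not a
  tableau.\<close>

definition \<alpha> :: "nat \<Rightarrow> tableau \<Rightarrow> ratqt" where
  "\<alpha> i \<tau> = (1 - tt) * eigval lam \<tau> i / (eigval lam \<tau> i - eigval lam \<tau> (Suc i))"

lemma one_minus_tt: "1 - tt \<noteq> 0"
  using qq_tt_power_inject[of 0 1 0 0] by auto

lemma eigval_nonzero: "eigval lam \<tau> i \<noteq> 0"
proof -
  have "qq \<noteq> 0" using qq_tt_power_inject[of 1 0 2 0] by auto
  then show ?thesis using tt_nonzero by (simp add: eigval_def)
qed

lemma eigval_not_s_act: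
  assumes \<tau>: "\<tau> \<in> X" and i: "i \<in> {1..<n}" and s: "s_act lam i \<tau> \<notin> X"
  shows "eigval lam \<tau> (Suc i) = tt * eigval lam \<tau> i" "eigval lam \<tau> i \<noteq> eigval lam \<tau> (Suc i)" "\<alpha> i \<tau> = 1"
proof -
  show *: "eigval lam \<tau> (Suc i) = tt * eigval lam \<tau> i"
    using not_s_act[OF \<tau> _ s] i n tt_nonzero by (simp add: eigval_def power_int_add_1)
  have "eigval lam \<tau> i - eigval lam \<tau> (Suc i) = (1 - tt) * eigval lam \<tau> i"
    by (simp add: * algebra_simps)
  then show "\<alpha> i \<tau> = 1" "eigval lam \<tau> i \<noteq> eigval lam \<tau> (Suc i)"
    using one_minus_tt eigval_nonzero[of \<tau> i] by (auto simp: \<alpha>_def)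
qed

text \<open>No basis vector \<open>F\<^sub>\<tau>\<close> has the exchanged eigenvalues, so the intertwiner vanishes.\<close>

lemma T_F_row:
  assumes \<tau>: "\<tau> \<in> X" and i: "i \<in> {1..<n}" and s: "s_act lam i \<tau> \<notin> X"
  shows "V.act (fT i) (F \<tau>) = F \<tau>"
proof -
  let ?x = "eigval lam \<tau> i" and ?y = "eigval lam \<tau> (Suc i)"
  let ?F = "F \<tau>"
  let ?s = "s_act lam i \<tau>"
  have j: "i \<in> {1..n}" "Suc i \<in> {1..n}" and i': "i \<in> {1..<sum_list lam}" using i n by auto
  note P = X_PSYT[OF \<tau>]
  note l = X_labelling[OF \<tau>]
  have Fc: "?F \<in> carV" by (rule F_closed[OF P])
  note w = words_closed(1)[OF i]
  define G where "G = V.act (fT i) ?F \<oplus>V scale ((tt - 1) * ?x / (?x - ?y)) ?F"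
  have Gc: "G \<in> carV" using Fc w by (simp add: G_def)
  have ev: "V.act (fTh k) G = scale (eigval lam \<tau> (transpose i (Suc i) k)) G" if k: "k \<in> {1..n}" for k
  proof (cases "k \<in> {i, Suc i}")
    case True
    then show ?thesis
      using intertwiner[OF i Fc theta_F[OF P j(1)] theta_F[OF P j(2)] eigval_not_s_act(2)[OF \<tau> i s]]
      by (auto simp: G_def)
  next
    case False
    then have "V.act (fTh k) G = V.act (fT i) (scale (eigval lam \<tau> k) ?F) \<oplus>V
        scale ((tt - 1) * ?x / (?x - ?y)) (scale (eigval lam \<tau> k) ?F)"
      using Fc w words_closed(2)[OF k] theta_commute_act[OF i k False Fc] theta_F[OF P k]
      by (simp add: G_def V.act_add_right act_gen_scale)
    also have "\<dots> = scale (eigval lam \<tau> k) G"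
      using Fc w by (simp add: G_def V.act_add_right free_alg_closed act_gen_scale V.act_scalar_mult mult.commute)
    finally show ?thesis using False by simp
  qed
  obtain J g where J: "finite J" "J \<subseteq> PSYT lam" "G = V.lc F g J"
    using V.kbasis_exists[OF kbasis_F Gc] .
  note FJ = F_funcset[OF J(2)]
  have "g \<sigma> = 0" if \<sigma>: "\<sigma> \<in> J" for \<sigma>
  proof (rule ccontr)
    assume g: "g \<sigma> \<noteq> 0"
    have P\<sigma>: "\<sigma> \<in> PSYT lam" using J(2) \<sigma> by blast
    \<comment> \<open>The eigenvalue equation of \<open>G\<close> is expanded in the basis and
      compared at \<sigma>; the nonzero \<open>g \<sigma>\<close> cancels.\<close>
    have eig: "eigval lam \<sigma> k = eigval lam ?s k" if k: "k \<in> {1..n}" for k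
    proof -
      have "V.lc F (\<lambda>\<sigma>. eigval lam \<sigma> k * g \<sigma>) J = V.act (fTh k) (V.lc F g J)"
        using J(2) theta_F k
        by (intro V.act_eigenvectors_lincomb[OF J(1) FJ words_closed(2)[OF k], symmetric]) blast
      also have "\<dots> = V.lc F (\<lambda>\<sigma>. eigval lam \<tau> (transpose i (Suc i) k) * g \<sigma>) J"
        using ev[OF k] V.act_scalar_lincomb[OF J(1) FJ] by (simp add: J(3))
      finally have "eigval lam \<sigma> k * g \<sigma> = eigval lam \<tau> (transpose i (Suc i) k) * g \<sigma>"
        by (rule V.kbasis_unique[OF kbasis_F J(1,2) _ \<sigma>])
      then show ?thesis using g eigval_s_act[OF l i k] by simp
    qed
    \<comment> \<open>The labelling \<open>?s\<close> is not a tableau, but it still increases along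
      diagonals: \<open>i\<close> and \<open>i + 1\<close> have different contents, so exchanging
      them disturbs no diagonal. The joint eigenvalues therefore identify it with the tableau
      \<sigma>, a contradiction.\<close>
    have "\<sigma> = ?s"
    proof (rule labelling_eqI)
      show "labelling lam \<sigma>" "labelling lam ?s" using P\<sigma> labelling_s_act[OF l i'] by (simp_all add: PSYT_iff)
      show "label_less (\<sigma> u) (\<sigma> v)"
        if "u \<in> diagram lam" "v \<in> diagram lam" "box_content u = box_content v" "fst u < fst v" for u v
        using diagonal_less[OF P\<sigma> that] .
      show "label_less (?s u) (?s v)"
        if "u \<in> diagram lam" "v \<in> diagram lam" "box_content u = box_content v" "fst u < fst v" for u v
        using not_s_act(2)[OF \<tau> i' s] that
        by (intro label_less_s_act[OF l i' that(1,2) diagonal_less[OF P that]]) (auto simp: cont_def)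
      show "wt lam \<sigma> k = wt lam ?s k" "cont lam \<sigma> k = cont lam ?s k" if "k \<in> {1..sum_list lam}" for k
        using eig[of k] that n by (simp_all add: eigval_eq_iff)
    qed
    then show False using P\<sigma> s s_act_X_iff[OF \<tau>] by simp
  qed
  then have "G = V.lc F g {}"
    unfolding J(3) by (intro V.lincomb_mono_neutral[symmetric] J(1) FJ) auto
  then have z: "G = \<zero>\<^bsub>V_mod lam L\<^esub>" by simp
  have "(tt - 1) * ?x / (?x - ?y) = - \<alpha> i \<tau>"
    by (simp add: \<alpha>_def minus_divide_left algebra_simps)
  then have c: "(tt - 1) * ?x / (?x - ?y) = - 1" using eigval_not_s_act(3)[OF \<tau> i s] by simp
  have "V.act (fT i) ?F \<oplus>V (scale (- 1) ?F \<oplus>V scale 1 ?F) = scale 1 ?F"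
    using z w Fc by (simp add: G_def c V.M.a_assoc[symmetric])
  moreover have "scale (- 1) ?F \<oplus>V scale 1 ?F = \<zero>\<^bsub>V_mod lam L\<^esub>"
    using V.act_scalar_add[OF Fc, of "- 1" 1] Fc by (simp add: scalar_zero V.act_zero_left)
  ultimately show ?thesis using w Fc by (simp add: scalar_one V.act_one)
qed

text \<open>The operator that defines \<open>F\<close> at \<open>s_i(\<tau>)\<close> is the
  intertwiner in another form: \<open>t T_i^(-1) = T_i + t - 1\<close>, and
  \<open>1 + y / (x - y) = x / (x - y)\<close>.\<close>

lemma T_F_up:
  assumes \<tau>: "\<tau> \<in> X" and i: "i \<in> {1..<n}" and u: "up lam \<tau> i"
  shows "V.act (fT i) (F \<tau>) = F (s_act lam i \<tau>) \<oplus>V scale (\<alpha> i \<tau>) (F \<tau>)"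
proof -
  let ?x = "eigval lam \<tau> i" and ?y = "eigval lam \<tau> (Suc i)"
  note P = X_PSYT[OF \<tau>]
  have i': "i \<in> {1..<sum_list lam}" using i n by simp
  have s: "s_act lam i \<tau> \<in> PSYT lam" using up_iff(2)[OF \<tau> i' u] X_PSYT by blast
  have Fc: "F \<tau> \<in> carV" by (rule F_closed[OF P])
  have ne: "?x \<noteq> ?y" using u by (auto simp: eigval_eq_iff up_def)
  note w = words_closed(1)[OF i]
  have "\<forall>\<tau>\<in>PSYT lam. \<forall>i\<in>{1..<n}. s_act lam i \<tau> \<in> PSYT lam \<and> psyt_less lam \<tau> (s_act lam i \<tau>) \<longrightarrow>
      V.act (scalar tt * fTinv i +
        scalar ((tt - 1) * eigval lam \<tau> (i + 1) / (eigval lam \<tau> i - eigval lam \<tau> (i + 1)))) (F \<tau>) = F (s_act lam i \<tau>)"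
    using F_basis unfolding F_basis_def Let_def V_act_eq n by blast
  then have "V.act (scalar tt * fTinv i + scalar ((tt - 1) * ?y / (?x - ?y))) (F \<tau>) = F (s_act lam i \<tau>)"
    using P i s psyt_less_s_act[OF P i' s u] by simp
  then have "F (s_act lam i \<tau>) = V.act (fT i) (F \<tau>) \<oplus>V scale (tt - 1 + (tt - 1) * ?y / (?x - ?y)) (F \<tau>)"
    using w Fc by (simp add: scalar_fTinv V.act_add_left free_alg_closed V.act_scalar_add V.M.a_assoc)
  also have "tt - 1 + (tt - 1) * ?y / (?x - ?y) = - \<alpha> i \<tau>"
    using ne by (simp add: \<alpha>_def field_simps)
  finally have "F (s_act lam i \<tau>) \<oplus>V scale (\<alpha> i \<tau>) (F \<tau>) =
      V.act (fT i) (F \<tau>) \<oplus>V scale (- \<alpha> i \<tau> + \<alpha> i \<tau>) (F \<tau>)"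
    using w Fc by (simp only: V.act_scalar_add[OF Fc]) (simp add: V.M.a_assoc)
  then show ?thesis using w Fc by (simp add: scalar_zero V.act_zero_left)
qed

text \<open>The two eigenvalues change places. The sum \<open>1 - t\<close> of both diagonal entries
  is the trace of a block with eigenvalues 1 and -t.\<close>

lemma \<alpha>_s_act:
  assumes \<tau>: "\<tau> \<in> X" and i: "i \<in> {1..<n}" and u: "up lam \<tau> i"
  shows "\<alpha> i (s_act lam i \<tau>) = 1 - tt - \<alpha> i \<tau>"
proof -
  let ?x = "eigval lam \<tau> i" and ?y = "eigval lam \<tau> (Suc i)"
  have ne: "?x \<noteq> ?y" using u by (auto simp: eigval_eq_iff up_def)
  have "\<alpha> i (s_act lam i \<tau>) = (1 - tt) * ?y / (?y - ?x)"
    using i eigval_s_act[OF X_labelling[OF \<tau>] i] by (simp add: \<alpha>_def)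
  also have "\<dots> = - ((1 - tt) * ?y / (?x - ?y))"
    by (metis minus_diff_eq minus_divide_right)
  also have "\<dots> = 1 - tt - \<alpha> i \<tau>"
    using ne by (simp add: \<alpha>_def field_simps)
  finally show ?thesis .
qed

text \<open>The coefficient of \<open>F\<close> at \<open>s_i(\<tau>)\<close> in
  \<open>T_i F_\<tau>\<close>. Upwards it is 1 by the normalization of \<open>F\<close>; downwards
  it is the value for which the block has determinant -t.\<close>

definition \<beta> :: "nat \<Rightarrow> tableau \<Rightarrow> ratqt" where
  "\<beta> i \<tau> = (if up lam \<tau> i then 1 else tt + \<alpha> i \<tau> * (1 - tt - \<alpha> i \<tau>))"

text \<open>The formula for \<open>F\<close> describes only steps up. For a step down the quadratic
  relation is applied to \<open>F\<close> at the lower tableau \<open>s_i(\<tau>)\<close>; its image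
  under \<open>T_i\<close> contains \<open>F_\<tau>\<close> with coefficient 1, so
  \<open>T_i F_\<tau>\<close> can be isolated.\<close>

lemma T_F_free:
  assumes \<tau>: "\<tau> \<in> X" and i: "i \<in> {1..<n}" and s: "s_act lam i \<tau> \<in> X"
  shows "V.act (fT i) (F \<tau>) = scale (\<alpha> i \<tau>) (F \<tau>) \<oplus>V scale (\<beta> i \<tau>) (F (s_act lam i \<tau>))"
proof (cases "up lam \<tau> i")
  case True
  then show ?thesis
    using T_F_up[OF \<tau> i True] F_closed X_PSYT \<tau> s
    by (simp add: \<beta>_def scalar_one V.act_one V.M.a_comm)
next
  case False
  let ?s = "s_act lam i \<tau>"
  have i': "i \<in> {1..<sum_list lam}" using i n by simp
  have ss: "s_act lam i ?s = \<tau>" by (rule s_act_s_act[OF X_labelling[OF \<tau>]])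
  have u: "up lam ?s i" using up_s_act[OF \<tau> i' s] False by simp
  have Fc: "F \<tau> \<in> carV" "F ?s \<in> carV" using F_closed X_PSYT \<tau> s by blast+
  have w: "fT i \<in> V.words" by (rule words_closed(1)[OF i])
  define a where "a = \<alpha> i ?s"
  have a: "\<alpha> i \<tau> = 1 - tt - a" using \<alpha>_s_act[OF s i u] by (simp add: ss a_def)
  have up: "V.act (fT i) (F ?s) = F \<tau> \<oplus>V scale a (F ?s)" using T_F_up[OF s i u] by (simp add: ss a_def)
  have "V.act (fT i) (F \<tau>) \<oplus>V scale a (V.act (fT i) (F ?s)) = V.act (fT i) (V.act (fT i) (F ?s))"
    using w Fc by (simp add: up V.act_add_right act_gen_scale)
  also have "\<dots> = scale (1 - tt) (V.act (fT i) (F ?s)) \<oplus>V scale tt (F ?s)"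
    by (rule quadratic_act[OF i Fc(2)])
  finally have eq: "V.act (fT i) (F \<tau>) \<oplus>V scale a (V.act (fT i) (F ?s)) =
    scale (1 - tt) (V.act (fT i) (F ?s)) \<oplus>V scale tt (F ?s)" .
  have Tc: "V.act (fT i) (F ?s) \<in> carV" using w Fc by simp
  have "V.act (fT i) (F \<tau>) = V.act (fT i) (F \<tau>) \<oplus>V scale (a + - a) (V.act (fT i) (F ?s))"
    using w Fc Tc by (simp add: scalar_zero V.act_zero_left)
  also have "\<dots> = (V.act (fT i) (F \<tau>) \<oplus>V scale a (V.act (fT i) (F ?s))) \<oplus>V scale (- a) (V.act (fT i) (F ?s))"
    unfolding V.act_scalar_add[OF Tc] using w Fc Tc by (intro V.M.a_assoc[symmetric]) auto
  also have "\<dots> = (scale (1 - tt) (V.act (fT i) (F ?s)) \<oplus>V scale (- a) (V.act (fT i) (F ?s))) \<oplus>V scale tt (F ?s)"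
    unfolding eq using Fc Tc by (simp add: V.M.a_ac)
  also have "\<dots> = scale (1 - tt - a) (V.act (fT i) (F ?s)) \<oplus>V scale tt (F ?s)"
    using V.act_scalar_add[OF Tc, of "1 - tt" "- a"] by simp
  also have "\<dots> = scale (1 - tt - a) (F \<tau>) \<oplus>V (scale ((1 - tt - a) * a) (F ?s) \<oplus>V scale tt (F ?s))"
    unfolding up using Fc by (simp add: V.act_add_right free_alg_closed V.act_scalar_mult V.M.a_assoc)
  also have "\<dots> = scale (\<alpha> i \<tau>) (F \<tau>) \<oplus>V scale (\<beta> i \<tau>) (F ?s)"
    using False by (simp add: V.act_scalar_add[OF Fc(2), symmetric] a \<beta>_def algebra_simps)
  finally show ?thesis .
qed

section \<open>Passage to coordinates\<close>

abbreviation lcX :: "(tableau \<Rightarrow> ratqt) \<Rightarrow> 'm ind" where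
  "lcX c \<equiv> V.lc F c X"

lemma FX: "F \<in> X \<rightarrow> carV"
  by (rule F_funcset[OF X_subset])

lemma lcX_closed: "lcX c \<in> carV"
  by (rule V.lincomb_closed[OF FX])

text \<open>Coordinates with respect to the \<open>F\<^sub>\<tau>\<close> are functions supported on \<open>X\<close>; \<open>M i\<close> is the action of
  \<open>T\<^sub>i\<close> in coordinates.\<close>

definition coords :: "(tableau \<Rightarrow> ratqt) set" where
  "coords = {c. \<forall>\<sigma>. \<sigma> \<notin> X \<longrightarrow> c \<sigma> = 0}"

definition M :: "nat \<Rightarrow> (tableau \<Rightarrow> ratqt) \<Rightarrow> tableau \<Rightarrow> ratqt" where
  "M i c \<sigma> = (if \<sigma> \<in> X then \<alpha> i \<sigma> * c \<sigma> +
     (if s_act lam i \<sigma> \<in> X then \<beta> i (s_act lam i \<sigma>) * c (s_act lam i \<sigma>) else 0) else 0)"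

lemma coords_eqI:
  assumes "c \<in> coords" "d \<in> coords" "lcX c = lcX d"
  shows "c = d"
proof
  fix \<sigma> show "c \<sigma> = d \<sigma>"
    using assms V.kbasis_unique[OF kbasis_F finite_X X_subset assms(3)]
    by (cases "\<sigma> \<in> X") (auto simp: coords_def)
qed

lemma M_closed: "M i c \<in> coords"
  by (simp add: coords_def M_def)

lemma s_act_X_s_act: "\<sigma> \<in> X \<Longrightarrow> s_act lam i (s_act lam i \<sigma>) = \<sigma>"
  by (rule s_act_s_act[OF X_labelling])

lemma act_T_lcX:
  assumes i: "i \<in> {1..<n}"
  shows "V.act (fT i) (lcX c) = lcX (M i c)"
proof -
  define m where "m \<tau> \<sigma> = (if \<sigma> = \<tau> then \<alpha> i \<tau> else 0) +
      (if \<sigma> = s_act lam i \<tau> then if s_act lam i \<tau> \<in> X then \<beta> i \<tau> else 0 else 0)" for \<tau> \<sigma>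
  have m: "V.act (fT i) (F \<tau>) = lcX (m \<tau>)" if \<tau>: "\<tau> \<in> X" for \<tau>
  proof (cases "s_act lam i \<tau> \<in> X")
    case True
    then show ?thesis
      using \<tau> FX finite_X
      unfolding m_def V.lincomb_add[OF finite_X FX] T_F_free[OF \<tau> i True]
      by (simp add: V.lincomb_single)
  next
    case False
    have "lcX (m \<tau>) = lcX (\<lambda>\<sigma>. if \<sigma> = \<tau> then \<alpha> i \<tau> else 0)"
      by (rule V.lincomb_cong[OF _ FX]) (simp add: m_def False)
    also have "\<dots> = scale 1 (F \<tau>)"
      using V.lincomb_single[OF finite_X \<tau> FX] eigval_not_s_act(3)[OF \<tau> i False] by simp
    finally show ?thesis
      using T_F_row[OF \<tau> i False] FX \<tau> by (simp add: scalar_one V.act_one Pi_iff)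
  qed
  have "V.act (fT i) (lcX c) = lcX (\<lambda>\<sigma>. \<Sum>\<tau>\<in>X. c \<tau> * m \<tau> \<sigma>)"
    by (rule V.act_lincomb[OF finite_X FX words_closed(1)[OF i] m])
  also have "\<dots> = lcX (M i c)"
  proof (rule V.lincomb_cong[OF _ FX])
    fix \<sigma> assume \<sigma>: "\<sigma> \<in> X"
    let ?s = "s_act lam i \<sigma>"
    \<comment> \<open>As \<open>s_i\<close> is an involution, only the columns \<sigma> and
      \<open>s_i(\<sigma>)\<close> meet row \<sigma>. This is why \<open>M\<close> evaluates \<beta>
      at \<open>s_i(\<sigma>)\<close>.\<close>
    have eq: "\<sigma> = s_act lam i \<tau> \<longleftrightarrow> \<tau> = ?s" if "\<tau> \<in> X" for \<tau>
      using s_act_X_s_act \<sigma> that by metis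
    have "(\<Sum>\<tau>\<in>X. c \<tau> * m \<tau> \<sigma>) =
        (\<Sum>\<tau>\<in>X. if \<tau> = \<sigma> then \<alpha> i \<tau> * c \<tau> else 0) + (\<Sum>\<tau>\<in>X. if \<tau> = ?s then \<beta> i \<tau> * c \<tau> else 0)"
      unfolding sum.distrib[symmetric]
    proof (rule sum.cong[OF refl])
      fix \<tau> assume "\<tau> \<in> X"
      have "s_act lam i \<tau> \<in> X" if "\<tau> = ?s" using that s_act_X_s_act[OF \<sigma>] \<sigma> by simp
      then show "c \<tau> * m \<tau> \<sigma> = (if \<tau> = \<sigma> then \<alpha> i \<tau> * c \<tau> else 0) + (if \<tau> = ?s then \<beta> i \<tau> * c \<tau> else 0)"
        unfolding m_def eq[OF \<open>\<tau> \<in> X\<close>] by (auto simp: algebra_simps)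
    qed
    also have "\<dots> = M i c \<sigma>" using \<sigma> finite_X by (simp add: M_def)
    finally show "(\<Sum>\<tau>\<in>X. c \<tau> * m \<tau> \<sigma>) = M i c \<sigma>" .
  qed
  finally show ?thesis .
qed

section \<open>The Hecke relations and the symmetrizer in coordinates\<close>

lemma M_linear:
  assumes "finite I"
  shows "M i (\<lambda>x. \<Sum>a\<in>I. k a * f a x) \<sigma> = (\<Sum>a\<in>I. k a * M i (f a) \<sigma>)"
  using assms by (induction I rule: finite_induct) (auto simp: M_def algebra_simps)

lemma M_scale: "M i (\<lambda>\<sigma>. k * c \<sigma>) = (\<lambda>\<sigma>. k * M i c \<sigma>)"
  by (auto simp: M_def fun_eq_iff algebra_simps)

lemma M_diff: "M i (\<lambda>\<sigma>. c \<sigma> - d \<sigma>) = (\<lambda>\<sigma>. M i c \<sigma> - M i d \<sigma>)"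
  by (auto simp: M_def fun_eq_iff algebra_simps)

lemma M_quadratic:
  assumes i: "i \<in> {1..<n}" and c: "c \<in> coords"
  shows "M i (M i c) \<sigma> = (1 - tt) * M i c \<sigma> + tt * c \<sigma>"
proof -
  have "lcX (M i (M i c)) = lcX (\<lambda>\<sigma>. (1 - tt) * M i c \<sigma> + tt * c \<sigma>)"
    using quadratic_act[OF i lcX_closed[of c]]
    by (simp add: act_T_lcX[OF i] V.act_scalar_lincomb[OF finite_X FX] V.lincomb_add[OF finite_X FX])
  then have "M i (M i c) = (\<lambda>\<sigma>. (1 - tt) * M i c \<sigma> + tt * c \<sigma>)"
    by (intro coords_eqI M_closed) (use c M_closed[of i c] in \<open>auto simp: coords_def\<close>)
  then show ?thesis by (rule fun_cong)
qed

lemma M_braid: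
  assumes i: "i \<in> {1..<n}" "Suc i \<in> {1..<n}"
  shows "M i (M (Suc i) (M i c)) = M (Suc i) (M i (M (Suc i) c))"
  using braid_act[OF i lcX_closed[of c]] i by (intro coords_eqI M_closed) (simp add: act_T_lcX)

lemma M_commute:
  assumes i: "i \<in> {1..<n}" "j \<in> {1..<n}" "\<bar>int i - int j\<bar> > 1"
  shows "M i (M j c) = M j (M i c)"
  using commute_act[OF i lcX_closed[of c]] i by (intro coords_eqI M_closed) (simp add: act_T_lcX)

text \<open>The same choice as in \<open>fTperm\<close>, so that \<open>fTperm n \<pi>\<close> acts
  in coordinates literally as the word \<open>rw \<pi>\<close>.\<close>

definition rw :: "(nat \<Rightarrow> nat) \<Rightarrow> nat list" where
  "rw \<pi> = (SOME u. reduced_word n \<pi> u)"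

lemma reduced_rw: "\<pi> permutes {1..n} \<Longrightarrow> reduced_word n \<pi> (rw \<pi>)"
  unfolding rw_def using reduced_word_exists by (rule someI_ex)

definition E :: "(tableau \<Rightarrow> ratqt) \<Rightarrow> tableau \<Rightarrow> ratqt" where
  "E c = (\<lambda>x. \<Sum>\<pi> | \<pi> permutes {1..n}. tt ^ ((n choose 2) - perm_length n \<pi>) * foldr M (rw \<pi>) c x)"

lemma M_E:
  assumes "i \<in> {1..<n}" "c \<in> coords"
  shows "M i (E c) = E c"
  unfolding E_def
  by (rule ext, rule symmetrizer_invariant[where M = M and S = coords and t = tt and rw = rw and n = n])
     (use assms in \<open>simp_all add: M_closed M_braid M_commute M_quadratic M_linear reduced_rw\<close>)

lemma act_word:
  "set u \<subseteq> {1..<n} \<Longrightarrow> V.act (prod_list (map fT u)) (lcX c) = lcX (foldr M u c)"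
proof (induction u)
  case Nil
  then show ?case using lcX_closed by (simp add: V.act_one)
next
  case (Cons i u)
  then have "prod_list (map fT u) \<in> V.words"
    by (intro free_alg_closed(8)) (auto intro!: words_closed)
  then show ?case
    using Cons lcX_closed words_closed(1)[of i] by (simp add: V.act_mult act_T_lcX)
qed

lemma act_eps: "V.act (eps n) (lcX c) = lcX (\<lambda>\<sigma>. 1 / t_factorial n * E c \<sigma>)"
proof -
  let ?f = "\<lambda>\<pi>. scalar (tt ^ ((n choose 2) - perm_length n \<pi>)) * fTperm n \<pi> :: gens falg"
  have P: "fTperm n \<pi> \<in> V.words" "V.act (fTperm n \<pi>) (lcX c) = lcX (foldr M (rw \<pi>) c)"
    if "\<pi> permutes {1..n}" for \<pi>
  proof -
    have r: "set (rw \<pi>) \<subseteq> {1..<n}" using reduced_rw[OF that] by (simp add: reduced_word_def)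
    show "fTperm n \<pi> \<in> V.words"
      unfolding fTperm_def rw_def[symmetric]
      using r by (intro free_alg_closed(8)) (auto intro!: words_closed)
    show "V.act (fTperm n \<pi>) (lcX c) = lcX (foldr M (rw \<pi>) c)"
      unfolding fTperm_def rw_def[symmetric] by (rule act_word[OF r])
  qed
  \<comment> \<open>Membership in \<open>V.words\<close> is carried through the induction because
    additivity of the action requires it.\<close>
  have sum: "(\<Sum>\<pi>\<in>I. ?f \<pi>) \<in> V.words \<and>
      V.act (\<Sum>\<pi>\<in>I. ?f \<pi>) (lcX c) =
      lcX (\<lambda>x. \<Sum>\<pi>\<in>I. tt ^ ((n choose 2) - perm_length n \<pi>) * foldr M (rw \<pi>) c x)"
    if "finite I" "I \<subseteq> {\<pi>. \<pi> permutes {1..n}}" for I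
    using that
  proof (induction I rule: finite_induct)
    case empty
    have "lcX (\<lambda>x. 0) = V.lc F (\<lambda>x. 0) {}"
      using FX finite_X by (intro V.lincomb_mono_neutral[symmetric]) auto
    then show ?case using lcX_closed by (simp add: V.act_zero_left free_alg_closed)
  next
    case (insert \<pi> I)
    then have \<pi>: "\<pi> permutes {1..n}" by simp
    have f: "?f \<pi> \<in> V.words" using P(1)[OF \<pi>] by (intro free_alg_closed(3,7))
    have "V.act (?f \<pi>) (lcX c) = lcX (\<lambda>x. tt ^ ((n choose 2) - perm_length n \<pi>) * foldr M (rw \<pi>) c x)"
      using P[OF \<pi>] lcX_closed
      by (simp add: V.act_mult free_alg_closed V.act_scalar_lincomb[OF finite_X FX])
    then show ?case
      using insert f lcX_closed
      by (simp add: V.act_add_left V.lincomb_add[OF finite_X FX] free_alg_closed)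
  qed
  have "finite {\<pi>. \<pi> permutes {1..n}}" by (simp add: finite_permutations)
  from sum[OF this subset_refl] show ?thesis
    using lcX_closed
    by (simp add: eps_def V.act_mult free_alg_closed V.act_scalar_lincomb[OF finite_X FX] E_def)
qed

lemma E_fixed:
  assumes "\<And>i. i \<in> {1..<n} \<Longrightarrow> M i c = c"
  shows "E c = (\<lambda>\<sigma>. (\<Sum>\<pi> | \<pi> permutes {1..n}. tt ^ ((n choose 2) - perm_length n \<pi>)) * c \<sigma>)"
proof -
  have fixed: "foldr M u c = c" if "set u \<subseteq> {1..<n}" for u
    using that by (induction u) (auto simp: assms)
  have "foldr M (rw \<pi>) c = c" if "\<pi> permutes {1..n}" for \<pi>
    using reduced_rw[OF that] by (intro fixed) (simp add: reduced_word_def)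
  then show ?thesis unfolding E_def sum_distrib_right by (intro ext sum.cong) auto
qed

section \<open>The product formula as a fixed vector\<close>

definition \<kappa> :: "tableau \<Rightarrow> ratqt" where
  "\<kappa> \<tau> = (\<Prod>(x, y)\<in>Inv lam \<tau>.
     (qq ^ T x * tt powi (box_content x + 1) - qq ^ T y * tt powi box_content y) /
     (qq ^ T x * tt powi box_content x - qq ^ T y * tt powi box_content y))"

text \<open>The additional inversion is the pair of the boxes of \<open>i + 1\<close> and
  \<open>i\<close>, in this order. Its factor is \<open>(t y - x) / (y - x)\<close>, which equals
  \<open>t + \<alpha>\<close>.\<close>

lemma \<kappa>_up:
  assumes \<tau>: "\<tau> \<in> X" and i: "i \<in> {1..<n}" and u: "up lam \<tau> i"
  shows "\<kappa> \<tau> = (tt + \<alpha> i \<tau>) * \<kappa> (s_act lam i \<tau>)"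
proof -
  let ?x = "eigval lam \<tau> i" and ?y = "eigval lam \<tau> (Suc i)"
  let ?p = "box_of lam \<tau> i" and ?q = "box_of lam \<tau> (Suc i)"
  have i': "i \<in> {1..<sum_list lam}" "i \<in> {1..sum_list lam}" "Suc i \<in> {1..sum_list lam}" using i n by auto
  have ne: "?x \<noteq> ?y" using u by (auto simp: eigval_eq_iff up_def)
  have ev: "?x = qq ^ T ?p * tt powi box_content ?p" "?y = qq ^ T ?q * tt powi box_content ?q"
    using wt_X[OF \<tau>] i' by (simp_all add: eigval_def cont_def)
  have "\<kappa> \<tau> = (qq ^ T ?q * tt powi (box_content ?q + 1) - qq ^ T ?p * tt powi box_content ?p) /
     (qq ^ T ?q * tt powi box_content ?q - qq ^ T ?p * tt powi box_content ?p) * \<kappa> (s_act lam i \<tau>)"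
    unfolding \<kappa>_def Inv_up(1)[OF \<tau> i'(1) u]
    by (subst prod.insert[OF finite_Inv Inv_up(2)[OF \<tau> i'(1) u]]) simp
  also have "qq ^ T ?q * tt powi (box_content ?q + 1) = tt * ?y"
    using tt_nonzero by (simp add: ev power_int_add_1)
  also have "(tt * ?y - qq ^ T ?p * tt powi box_content ?p) /
     (qq ^ T ?q * tt powi box_content ?q - qq ^ T ?p * tt powi box_content ?p) = (tt * ?y - ?x) / (?y - ?x)"
    by (simp add: ev)
  also have "\<dots> = tt + \<alpha> i \<tau>"
    using ne by (simp add: \<alpha>_def field_simps)
  finally show ?thesis .
qed

lemma \<kappa>_Top: "\<kappa> (Top_tab lam T) = 1"
  by (simp add: \<kappa>_def Inv_Top_tab)

lemma up_cases:
  assumes "\<sigma> \<in> X" "i \<in> {1..<n}" "s_act lam i \<sigma> \<in> X"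
  obtains "up lam \<sigma> i" "\<not> up lam (s_act lam i \<sigma>) i" | "\<not> up lam \<sigma> i" "up lam (s_act lam i \<sigma>) i"
  using up_s_act[of \<sigma> i] assms n by blast

text \<open>With \<alpha> taken at the lower tableau of a block, both of its coordinates reduce to
  the ratio \<open>t + \<alpha>\<close> of \<open>\<kappa>_up\<close>; they are compatible because
  the product of the off-diagonal entries, \<open>t + \<alpha> (1 - t - \<alpha>)\<close>, factors
  as \<open>(1 - \<alpha>) (t + \<alpha>)\<close>.\<close>

lemma M_\<kappa>:
  assumes i: "i \<in> {1..<n}"
  shows "M i (\<lambda>\<sigma>. if \<sigma> \<in> X then \<kappa> \<sigma> else 0) = (\<lambda>\<sigma>. if \<sigma> \<in> X then \<kappa> \<sigma> else 0)"
proof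
  fix \<sigma>
  let ?s = "s_act lam i \<sigma>"
  have "\<alpha> i \<sigma> * \<kappa> \<sigma> + (if ?s \<in> X then \<beta> i ?s * \<kappa> ?s else 0) = \<kappa> \<sigma>" if \<sigma>: "\<sigma> \<in> X"
  proof (cases "?s \<in> X")
    case False
    then show ?thesis using eigval_not_s_act(3)[OF \<sigma> i] by simp
  next
    case s: True
    from \<sigma> i s show ?thesis
    proof (cases rule: up_cases)
      case 1
      have b: "\<beta> i ?s = tt + (1 - tt - \<alpha> i \<sigma>) * \<alpha> i \<sigma>"
        using 1(2) by (simp add: \<beta>_def \<alpha>_s_act[OF \<sigma> i 1(1)])
      show ?thesis using s by (simp add: \<kappa>_up[OF \<sigma> i 1(1)] b algebra_simps)
    next
      case 2
      have "\<kappa> ?s = (1 - \<alpha> i \<sigma>) * \<kappa> \<sigma>"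
        using \<kappa>_up[OF s i 2(2)] \<alpha>_s_act[OF s i 2(2)] by (simp add: s_act_X_s_act[OF \<sigma>])
      then show ?thesis using 2 s by (simp add: \<beta>_def algebra_simps)
    qed
  qed
  then show "M i (\<lambda>\<sigma>. if \<sigma> \<in> X then \<kappa> \<sigma> else 0) \<sigma> = (if \<sigma> \<in> X then \<kappa> \<sigma> else 0)"
    by (cases "\<sigma> \<in> X"; cases "?s \<in> X") (simp_all add: M_def)
qed

text \<open>The fixed point equation is read at \<open>s_i(\<sigma>)\<close> for a step up from
  \<sigma>. There \<open>d \<sigma>\<close> has coefficient 1, and all other terms contain
  \<open>d\<close> at a tableau with fewer inversions.\<close>

lemma fixed_eq_zero:
  assumes inv: "\<And>i. i \<in> {1..<n} \<Longrightarrow> M i d = d" and top: "d (Top_tab lam T) = 0" and \<sigma>: "\<sigma> \<in> X"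
  shows "d \<sigma> = 0"
  using \<sigma>
proof (induction "card (Inv lam \<sigma>)" arbitrary: \<sigma> rule: less_induct)
  case less
  show ?case
  proof (cases "\<sigma> = Top_tab lam T")
    case False
    then obtain i where i': "i \<in> {1..<sum_list lam}" and u: "up lam \<sigma> i" using up_exists less(2) by blast
    then have i: "i \<in> {1..<n}" by (simp add: n)
    let ?s = "s_act lam i \<sigma>"
    have s: "?s \<in> X" by (rule up_iff(2)[OF less(2) i' u])
    have "d ?s = 0" using card_Inv_up[OF less(2) i' u] s by (intro less(1)) simp_all
    moreover have "M i d ?s = \<alpha> i ?s * d ?s + d \<sigma>"
      using s u less(2) by (simp add: M_def s_act_X_s_act \<beta>_def)
    ultimately show ?thesis using inv[OF i] by simp
  qed (use top in simp)
qed

text \<open>For existence, the fixed vector divided by the scalar \<open>c0\<close>, by which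
  \<epsilon> acts on it, is a preimage in \<open>U_T\<close>. For uniqueness, any candidate lies in
  the image of \<epsilon> and is fixed, so its difference from the product formula is a fixed vector
  without top coefficient.\<close>

lemma P_elt_eq: "P_elt lam L F T = lcX \<kappa>"
proof -
  let ?k = "\<lambda>\<sigma>. if \<sigma> \<in> X then \<kappa> \<sigma> else 0"
  let ?top = "Top_tab lam T"
  have k: "lcX \<kappa> = lcX ?k" by (rule V.lincomb_cong[OF _ FX]) simp
  have FX': "F \<in> X - {?top} \<rightarrow> carV" "F \<in> insert ?top (X - {?top}) \<rightarrow> carV"
    using FX Top_tab_in_X by auto
  have split: "lcX c = F ?top \<oplus>V V.lc F c (X - {?top})" if "c ?top = 1" for c
  proof -
    have "lcX c = V.lc F c (insert ?top (X - {?top}))" using Top_tab_in_X by (simp add: insert_absorb)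
    also have "\<dots> = scale (c ?top) (F ?top) \<oplus>V V.lc F c (X - {?top})"
      using finite_X FX' by (intro V.lincomb_insert) auto
    finally show ?thesis using that FX Top_tab_in_X by (simp add: scalar_one V.act_one Pi_iff)
  qed
  define c0 where "c0 = 1 / t_factorial n * (\<Sum>\<pi> | \<pi> permutes {1..n}. tt ^ ((n choose 2) - perm_length n \<pi>))"
  have "{\<pi>. \<pi> permutes {1..n}} \<noteq> {}" using permutes_id by blast
  then have "(\<Sum>\<pi> | \<pi> permutes {1..n}. tt ^ ((n choose 2) - perm_length n \<pi>)) \<noteq> 0"
    by (intro sum_tt_power_nonzero finite_permutations finite_atLeastAtMost)
  then have c0: "c0 \<noteq> 0" unfolding c0_def using t_factorial_nonzero by simp
  have "lcX ?k = V.act (eps n) (lcX (\<lambda>\<sigma>. 1 / c0 * ?k \<sigma>))"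
  proof -
    have "M i (\<lambda>\<sigma>. 1 / c0 * ?k \<sigma>) = (\<lambda>\<sigma>. 1 / c0 * ?k \<sigma>)" if "i \<in> {1..<n}" for i
      unfolding M_scale M_\<kappa>[OF that] ..
    from E_fixed[OF this]
    have "1 / t_factorial n * E (\<lambda>\<sigma>. 1 / c0 * ?k \<sigma>) \<sigma> = c0 * (1 / c0 * ?k \<sigma>)" for \<sigma>
      by (simp add: c0_def)
    also have "c0 * (1 / c0 * ?k \<sigma>) = ?k \<sigma>" for \<sigma> using c0 by simp
    finally show ?thesis unfolding act_eps by presburger
  qed
  moreover have "lcX (\<lambda>\<sigma>. 1 / c0 * ?k \<sigma>) \<in> U_sub lam L F T"
    unfolding U_sub_def kspan_def n using finite_X by blast
  ultimately have mem: "lcX \<kappa> \<in> V_act lam L (eps (sum_list lam)) ` U_sub lam L F T"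
    unfolding k n V_act_eq by (rule image_eqI)
  have unique: "p = lcX \<kappa>"
    if p: "p \<in> V_act lam L (eps (sum_list lam)) ` U_sub lam L F T" "p = F ?top \<oplus>V V.lc F e (X - {?top})" for p e
  proof -
    obtain c J where J: "finite J" "J \<subseteq> X" "p = V.act (eps n) (V.lc F c J)"
      using p(1) unfolding U_sub_def kspan_def n V_act_eq by blast
    \<comment> \<open>An element of \<open>U_T\<close> is given as a sum over some finite
      \<open>J\<close>; extension by zero makes it a coordinate function on all of
      \<open>X\<close>.\<close>
    define c' where "c' \<sigma> = (if \<sigma> \<in> J then c \<sigma> else 0)" for \<sigma>
    have FJ: "F \<in> J \<rightarrow> carV" using FX J(2) by blast
    have "V.lc F c J = V.lc F c' J" by (rule V.lincomb_cong[OF _ FJ]) (simp add: c'_def)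
    also have "\<dots> = lcX c'"
      by (rule V.lincomb_mono_neutral[OF finite_X J(2) _ FX]) (simp add: c'_def)
    finally have J3: "p = V.act (eps n) (lcX c')" using J(3) by simp
    have c': "c' \<in> coords" using J(2) by (auto simp: c'_def coords_def)
    define f where "f = (\<lambda>\<sigma>. 1 / t_factorial n * E c' \<sigma>)"
    have pf: "p = lcX f" unfolding J3 act_eps f_def ..
    have Mf: "M i f = f" if "i \<in> {1..<n}" for i
      unfolding f_def M_scale M_E[OF that c'] ..
    \<comment> \<open>The value of \<open>e\<close> at \<open>?top\<close> is arbitrary, as
      \<open>?top\<close> is left out of its sum. Setting it to 1 gives the complete coefficient
      function of \<open>p\<close>.\<close>
    have "lcX f = lcX (e(?top := 1))"
    proof -
      have "lcX (e(?top := 1)) = F ?top \<oplus>V V.lc F (e(?top := 1)) (X - {?top})" by (rule split) simp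
      also have "V.lc F (e(?top := 1)) (X - {?top}) = V.lc F e (X - {?top})"
        by (rule V.lincomb_cong[OF _ FX'(1)]) simp
      finally show ?thesis unfolding pf[symmetric] p(2) by (rule sym)
    qed
    from V.kbasis_unique[OF kbasis_F finite_X X_subset this Top_tab_in_X] have f1: "f ?top = 1" by simp
    define d where "d = (\<lambda>\<sigma>. f \<sigma> - ?k \<sigma>)"
    have d: "d \<sigma> = 0" if "\<sigma> \<in> X" for \<sigma>
    proof (rule fixed_eq_zero[OF _ _ that])
      show "M i d = d" if "i \<in> {1..<n}" for i
        unfolding d_def M_diff Mf[OF that] M_\<kappa>[OF that] ..
      show "d ?top = 0" using f1 \<kappa>_Top Top_tab_in_X by (simp add: d_def)
    qed
    show ?thesis
      unfolding pf by (rule V.lincomb_cong[OF _ FX]) (use d in \<open>auto simp: d_def\<close>)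
  qed
  show ?thesis
    unfolding P_elt_def Top_eq
  proof (rule the_equality)
    have "lcX \<kappa> = F ?top \<oplus>V V.lc F \<kappa> (X - {?top})" by (rule split) (rule \<kappa>_Top)
    with mem show "lcX \<kappa> \<in> V_act lam L (eps (sum_list lam)) ` U_sub lam L F T \<and>
      (\<exists>\<kappa>'. lcX \<kappa> = F ?top \<oplus>V lincomb (D_pres (sum_list lam)) (V_mod lam L) F \<kappa>' (X - {?top}))"
      unfolding n by blast
  next
    fix p
    assume "p \<in> V_act lam L (eps (sum_list lam)) ` U_sub lam L F T \<and>
      (\<exists>\<kappa>'. p = F ?top \<oplus>V lincomb (D_pres (sum_list lam)) (V_mod lam L) F \<kappa>' (X - {?top}))"
    then show "p = lcX \<kappa>" using unique unfolding n by blast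
  qed
qed

end

theorem proposition4p4:
  fixes lam :: "nat list"
    and n :: nat
    and L :: "(gens falg set, 'm) module"
    and b :: "tableau \<Rightarrow> 'm"
    and F :: "tableau \<Rightarrow> 'm ind"
    and T :: "box \<Rightarrow> nat"
  assumes "is_partition lam"
    and "sum_list lam = n"
    and "specht_module lam L b"
    and "F_basis lam L b F"
    and "T \<in> RSSYT lam"
  shows "P_elt lam L F T =
    (\<Oplus>\<^bsub>V_mod lam L\<^esub>\<tau>\<in>PSYT_over lam T.
       kscale (D_pres n) (V_mod lam L)
         (\<Prod>(x, y)\<in>Inv lam \<tau>.
            (qq ^ T x * tt powi (box_content x + 1) - qq ^ T y * tt powi box_content y) /
            (qq ^ T x * tt powi box_content x - qq ^ T y * tt powi box_content y))
         (F \<tau>))"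
proof -
  interpret daha_module lam T n L b F
    by unfold_locales (fact assms)+
  show ?thesis using P_elt_eq by (simp only: lincomb_def \<kappa>_def)
qed

end
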